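(* Let $G$ be a Lie group with Lie algebra $\mathfrak g$. The Poisson reduction of ${}^{1}T^*TG=(G\circledS\mathfrak g_1)\circledS(\mathfrak g_2^*\times\mathfrak g_3^* )\ni(g,\xi,\mu,\nu)$ by the Abelian subgroup $\mathfrak g_1$ gives the Poisson manifold $G\circledS(\mathfrak g_2^*\times\mathfrak g_3^* )\ni(g,\mu,\nu)$ with the following bracket: the functions on ${}^{1}T^*TG$ that do not depend on $\xi$ are closed under the Poisson bracket of ${}^{1}T^*TG$, and for two such functions $H,K$ $$\{H,K\}(g,\mu,\nu)=\Big\langle T_e^*R_g\frac{\delta K}{\delta g},\frac{\delta H}{\delta\mu}\Big\rangle-\Big\langle T_e^*R_g\frac{\delta H}{\delta g},\frac{\delta K}{\delta\mu}\Big\rangle+\Big\langle\mu,\Big[\frac{\delta H}{\delta\mu},\frac{\delta K}{\delta\mu}\Big]\Big\rangle+\Big\langle\nu,\Big[\frac{\delta H}{\delta\mu},\frac{\delta K}{\delta\nu}\Big]-\Big[\frac{\delta K}{\delta\mu},\frac{\delta H}{\delta\nu}\Big]\Big\rangle.$$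
   Context: Conventions. $G$ is a (finite-dimensional) Lie group with identity $e$, $\mathfrak g=T_eG$, $\mathfrak g^*$ its dual, $\mathfrak g^{**}=\mathfrak g$. $R_g$ is right translation and $T_e^*R_g:T_g^*G\to\mathfrak g^*$ is the dual of $T_eR_g$. $Ad_g$ is the tangent map at $e$ of $h\mapsto g^{-1}hg$; the Lie bracket is $[\xi,\eta]=ad_\xi\eta=\frac{d}{dt}|_{t=0}Ad_{\exp(t\xi)}\eta$ (the bracket of right invariant vector fields). $ad^*_\xi$ is defined by $\langle ad^*_\xi\mu,\eta\rangle=\langle\mu,[\xi,\eta]\rangle$. Partial derivatives: $\delta H/\delta g\in T_g^*G$, $\delta H/\delta\mu,\delta H/\delta\nu\in\mathfrak g$. As a manifold ${}^{1}T^*TG=G\times\mathfrak g\times\mathfrak g^*\times\mathfrak g^*$ (subscripts on copies of $\mathfrak g,\mathfrak g^*$ are only labels). For $(\eta,\zeta,\lambda_1,\lambda_2)\in\mathfrak g\times\mathfrak g\times\mathfrak g^*\times\mathfrak g^*$ let $$X_{(\eta,\zeta,\lambda_1,\lambda_2)}(g,\xi,\mu,\nu)=(T_eR_g\eta,\ \zeta+[\xi,\eta],\ \lambda_1+ad^*_\eta\mu+ad^*_\zeta\nu,\ \lambda_2+ad^*_\eta\nu).$$ The symplectic form is determined by $$\Omega(X_{(\eta,\zeta,\lambda_1,\lambda_2)},X_{(\bar\eta,\bar\zeta,\bar\lambda_1,\bar\lambda_2)})=\langle\lambda_1,\bar\eta\rangle+\langle\lambda_2,\bar\zeta\rangle-\langle\bar\lambda_1,\eta\rangle-\langle\bar\lambda_2,\zeta\rangle+\langle\mu,[\eta,\bar\eta]\rangle+\langle\nu,[\eta,\bar\zeta]-[\bar\eta,\zeta]\rangle.$$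 Hamiltonian vector fields are given by $i_{X_H}\Omega=-dH$ and the Poisson bracket by $\{H,K\}=\Omega(X_H,X_K)=-\langle dH,X_K\rangle$. Functions independent of $\xi$ (called "right invariant under $\mathfrak g$") are identified with functions on $G\circledS(\mathfrak g_2^*\times\mathfrak g_3^* )$. *)

theory Defs
  imports "HOL-Analysis.Analysis"
begin

section \<open>Smooth maps between normed spaces\<close>

text \<open>
  Model spaces are arbitrary finite-dimensional normed spaces. Unlike
  \<open>euclidean_space\<close>, this class contains zero-dimensional spaces.
\<close>

class finite_dim_normed = real_normed_vector +
  assumes finite_dim: "\<exists>B. finite B \<and> (\<forall>x. \<exists>c. x = (\<Sum>b\<in>B. c b *\<^sub>R b))"

text \<open>
  \<open>C_k_on k S f\<close> is only meant for open \<open>S\<close> and finite-dimensional domains, where it says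
  that all iterated directional derivatives up to order \<open>k\<close> exist and are continuous.
\<close>

primrec C_k_on ::
  "nat \<Rightarrow> 'a::real_normed_vector set \<Rightarrow> ('a \<Rightarrow> 'b::real_normed_vector) \<Rightarrow> bool" where
  "C_k_on 0 S f \<longleftrightarrow> continuous_on S f"
| "C_k_on (Suc k) S f \<longleftrightarrow>
     (\<forall>x\<in>S. f differentiable (at x)) \<and>
     (\<forall>v. C_k_on k S (\<lambda>x. frechet_derivative f (at x) v))"

definition smooth_on ::
  "'a::real_normed_vector set \<Rightarrow> ('a \<Rightarrow> 'b::real_normed_vector) \<Rightarrow> bool" where
  "smooth_on S f \<longleftrightarrow> (\<forall>k. C_k_on k S f)"


section \<open>Manifolds\<close>

text \<open>
  A smooth structure on a type is given by an atlas \<open>c\<close> indexed by the points of the manifold: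
  \<open>c p\<close> is a chart (domain, coordinate map) whose domain contains \<open>p\<close>. Every atlas contains such
  a family, and the family determines the smooth structure. The tangent space at \<open>p\<close> is the model
  space, a tangent vector being represented by its components in the distinguished chart \<open>c p\<close>.
\<close>

type_synonym ('m, 'e) atlas = "'m \<Rightarrow> 'm set \<times> ('m \<Rightarrow> 'e)"

abbreviation chart_dom :: "('m, 'e) atlas \<Rightarrow> 'm \<Rightarrow> 'm set" where
  "chart_dom c p \<equiv> fst (c p)"

abbreviation chart_map :: "('m, 'e) atlas \<Rightarrow> 'm \<Rightarrow> 'm \<Rightarrow> 'e" where
  "chart_map c p \<equiv> snd (c p)"

definition chart_inv :: "('m, 'e) atlas \<Rightarrow> 'm \<Rightarrow> 'e \<Rightarrow> 'm" where
  "chart_inv c p = inv_into (chart_dom c p) (chart_map c p)"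

definition smooth_manifold ::
  "('m::topological_space, 'e::real_normed_vector) atlas \<Rightarrow> bool" where
  "smooth_manifold c \<longleftrightarrow>
     Hausdorff_space (euclidean :: 'm topology) \<and>
     second_countable (euclidean :: 'm topology) \<and>
     (\<forall>p. p \<in> chart_dom c p \<and> open (chart_dom c p) \<and>
          open (chart_map c p ` chart_dom c p) \<and>
          homeomorphism (chart_dom c p) (chart_map c p ` chart_dom c p)
            (chart_map c p) (chart_inv c p)) \<and>
     (\<forall>p q. smooth_on (chart_map c p ` (chart_dom c p \<inter> chart_dom c q))
              (chart_map c q \<circ> chart_inv c p))"

definition vector_atlas :: "('v, 'v) atlas" where
  "vector_atlas = (\<lambda>_. (UNIV, \<lambda>v. v))"

definition prod_atlas ::
  "('m, 'e) atlas \<Rightarrow> ('n, 'f) atlas \<Rightarrow> ('m \<times> 'n, 'e \<times> 'f) atlas" where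
  "prod_atlas c d =
     (\<lambda>(p, q). (chart_dom c p \<times> chart_dom d q, map_prod (chart_map c p) (chart_map d q)))"

definition smooth_map ::
  "('m::topological_space, 'e::real_normed_vector) atlas \<Rightarrow>
   ('n::topological_space, 'f::real_normed_vector) atlas \<Rightarrow> ('m \<Rightarrow> 'n) \<Rightarrow> bool" where
  "smooth_map c d f \<longleftrightarrow>
     continuous_on UNIV f \<and>
     (\<forall>p q. smooth_on (chart_map c p ` (chart_dom c p \<inter> f -` chart_dom d q))
              (chart_map d q \<circ> f \<circ> chart_inv c p))"

definition smooth_functions ::
  "('m::topological_space, 'e::real_normed_vector) atlas \<Rightarrow> ('m \<Rightarrow> real) set" where
  "smooth_functions c = {f. smooth_map c vector_atlas f}"

definition tangent_map ::
  "('m, 'e::real_normed_vector) atlas \<Rightarrow> ('n, 'f::real_normed_vector) atlas \<Rightarrow>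
   ('m \<Rightarrow> 'n) \<Rightarrow> 'm \<Rightarrow> 'e \<Rightarrow> 'f" where
  "tangent_map c d f p =
     frechet_derivative (chart_map d (f p) \<circ> f \<circ> chart_inv c p) (at (chart_map c p p))"


section \<open>Poisson manifolds\<close>

definition poisson_manifold ::
  "('m::topological_space, 'e::real_normed_vector) atlas \<Rightarrow>
   (('m \<Rightarrow> real) \<Rightarrow> ('m \<Rightarrow> real) \<Rightarrow> ('m \<Rightarrow> real)) \<Rightarrow> bool" where
  "poisson_manifold c br \<longleftrightarrow>
     smooth_manifold c \<and>
     (\<forall>f\<in>smooth_functions c. \<forall>g\<in>smooth_functions c. br f g \<in> smooth_functions c) \<and>
     (\<forall>f\<in>smooth_functions c. \<forall>g\<in>smooth_functions c. \<forall>x. br f g x = - br g f x) \<and>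
     (\<forall>f\<in>smooth_functions c. \<forall>g\<in>smooth_functions c. \<forall>h\<in>smooth_functions c.
        (\<forall>a b x. br (\<lambda>y. a * f y + b * g y) h x = a * br f h x + b * br g h x) \<and>
        (\<forall>x. br f (\<lambda>y. g y * h y) x = br f g x * h x + g x * br f h x) \<and>
        (\<forall>x. br f (br g h) x + br g (br h f) x + br h (br f g) x = 0))"


section \<open>Lie groups\<close>

record ('g, 'e) lie_data =
  mul :: "'g \<Rightarrow> 'g \<Rightarrow> 'g"
  unit :: "'g"
  inverse_of :: "'g \<Rightarrow> 'g"
  atlas :: "('g, 'e) atlas"

definition lie_group ::
  "('g::topological_space, 'e::finite_dim_normed) lie_data \<Rightarrow> bool" where
  "lie_group G \<longleftrightarrow>
     group (mul G) (unit G) (inverse_of G) \<and>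
     smooth_manifold (atlas G) \<and>
     smooth_map (prod_atlas (atlas G) (atlas G)) (atlas G) (\<lambda>(g, h). mul G g h) \<and>
     smooth_map (atlas G) (atlas G) (inverse_of G)"

text \<open>
  The Lie algebra is \<open>'e\<close>, the tangent space at \<open>unit G\<close>, and its dual is \<open>'e \<Rightarrow>\<^sub>L real\<close>.
  (In finite dimension every linear functional is bounded.)
\<close>

abbreviation pairing :: "('v::real_normed_vector \<Rightarrow>\<^sub>L real) \<Rightarrow> 'v \<Rightarrow> real"
    (\<open>(\<open>open_block notation=\<open>mixfix pairing\<close>\<close>\<langle>_,/ _\<rangle>)\<close>) where
  "\<langle>\<mu>, \<eta>\<rangle> \<equiv> blinfun_apply \<mu> \<eta>"

text \<open>\<open>TR G g\<close> is the tangent map at the identity of right translation by \<open>g\<close>.\<close>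

definition TR :: "('g, 'e::real_normed_vector) lie_data \<Rightarrow> 'g \<Rightarrow> 'e \<Rightarrow> 'e" where
  "TR G g = tangent_map (atlas G) (atlas G) (\<lambda>h. mul G h g) (unit G)"

definition TR_dual ::
  "('g, 'e::real_normed_vector) lie_data \<Rightarrow> 'g \<Rightarrow> ('e \<Rightarrow>\<^sub>L real) \<Rightarrow> ('e \<Rightarrow>\<^sub>L real)" where
  "TR_dual G g \<alpha> = Blinfun (\<lambda>\<eta>. \<langle>\<alpha>, TR G g \<eta>\<rangle>)"

text \<open>Note the convention: \<open>Ad\<close> comes from \<open>h \<mapsto> g\<inverse> h g\<close>, not from \<open>h \<mapsto> g h g\<inverse>\<close>.\<close>

definition Ad :: "('g, 'e::real_normed_vector) lie_data \<Rightarrow> 'g \<Rightarrow> 'e \<Rightarrow> 'e" where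
  "Ad G g =
     tangent_map (atlas G) (atlas G) (\<lambda>h. mul G (mul G (inverse_of G g) h) g) (unit G)"

definition one_parameter_subgroup ::
  "('g::topological_space, 'e::real_normed_vector) lie_data \<Rightarrow> 'e \<Rightarrow> (real \<Rightarrow> 'g) \<Rightarrow> bool" where
  "one_parameter_subgroup G \<xi> \<gamma> \<longleftrightarrow>
     smooth_map vector_atlas (atlas G) \<gamma> \<and>
     (\<forall>s t. \<gamma> (s + t) = mul G (\<gamma> s) (\<gamma> t)) \<and>
     tangent_map vector_atlas (atlas G) \<gamma> 0 1 = \<xi>"

definition lie_exp ::
  "('g::topological_space, 'e::real_normed_vector) lie_data \<Rightarrow> 'e \<Rightarrow> 'g" where
  "lie_exp G \<xi> = (THE \<gamma>. one_parameter_subgroup G \<xi> \<gamma>) 1"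

definition lie_bracket ::
  "('g::topological_space, 'e::real_normed_vector) lie_data \<Rightarrow> 'e \<Rightarrow> 'e \<Rightarrow> 'e" where
  "lie_bracket G \<xi> \<eta> =
     vector_derivative (\<lambda>t. Ad G (lie_exp G (t *\<^sub>R \<xi>)) \<eta>) (at 0)"

definition coad ::
  "('g::topological_space, 'e::real_normed_vector) lie_data \<Rightarrow>
   'e \<Rightarrow> ('e \<Rightarrow>\<^sub>L real) \<Rightarrow> ('e \<Rightarrow>\<^sub>L real)" where
  "coad G \<xi> \<mu> = Blinfun (\<lambda>\<eta>. \<langle>\<mu>, lie_bracket G \<xi> \<eta>\<rangle>)"


section \<open>The symplectic structure on the trivialised cotangent bundle of the tangent group\<close>

text \<open>
  The tangent space of \<open>G \<times> \<gg> \<times> \<gg>\<^sup>* \<times> \<gg>\<^sup>*\<close> at \<open>(g, \<xi>, \<mu>, \<nu>)\<close>, namely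
  \<open>T\<^sub>g G \<times> \<gg> \<times> \<gg>\<^sup>* \<times> \<gg>\<^sup>*\<close>, and the parameter space \<open>\<gg> \<times> \<gg> \<times> \<gg>\<^sup>* \<times> \<gg>\<^sup>*\<close> of the right
  invariant vector fields are represented by the same type \<open>'e tangent4\<close>.
\<close>

type_synonym ('g, 'e) phase_space = "'g \<times> 'e \<times> ('e \<Rightarrow>\<^sub>L real) \<times> ('e \<Rightarrow>\<^sub>L real)"
type_synonym 'e tangent4 = "'e \<times> 'e \<times> ('e \<Rightarrow>\<^sub>L real) \<times> ('e \<Rightarrow>\<^sub>L real)"
type_synonym ('g, 'e) reduced_space = "'g \<times> ('e \<Rightarrow>\<^sub>L real) \<times> ('e \<Rightarrow>\<^sub>L real)"

definition phase_atlas ::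
  "('g, 'e::real_normed_vector) lie_data \<Rightarrow> (('g, 'e) phase_space, 'e tangent4) atlas" where
  "phase_atlas G = prod_atlas (atlas G) vector_atlas"

definition right_inv_field ::
  "('g::topological_space, 'e::real_normed_vector) lie_data \<Rightarrow>
   'e tangent4 \<Rightarrow> ('g, 'e) phase_space \<Rightarrow> 'e tangent4" where
  "right_inv_field G = (\<lambda>(\<eta>, \<zeta>, \<alpha>, \<beta>) (g, \<xi>, \<mu>, \<nu>).
     (TR G g \<eta>,
      \<zeta> + lie_bracket G \<xi> \<eta>,
      \<alpha> + coad G \<eta> \<mu> + coad G \<zeta> \<nu>,
      \<beta> + coad G \<eta> \<nu>))"

text \<open>
  At each point of phase space, \<open>a \<mapsto> right_inv_field G a p\<close> is a bijection onto the tangent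
  space, so prescribing the symplectic form on these vector fields determines it.
\<close>

definition Omega ::
  "('g::topological_space, 'e::real_normed_vector) lie_data \<Rightarrow>
   ('g, 'e) phase_space \<Rightarrow> 'e tangent4 \<Rightarrow> 'e tangent4 \<Rightarrow> real" where
  "Omega G p v w =
     (case (p, inv (\<lambda>a. right_inv_field G a p) v, inv (\<lambda>a. right_inv_field G a p) w) of
        ((g, \<xi>, \<mu>, \<nu>), (\<eta>, \<zeta>, \<alpha>, \<beta>), (\<eta>', \<zeta>', \<alpha>', \<beta>')) \<Rightarrow>
          \<langle>\<alpha>, \<eta>'\<rangle> + \<langle>\<beta>, \<zeta>'\<rangle> - \<langle>\<alpha>', \<eta>\<rangle> - \<langle>\<beta>', \<zeta>\<rangle>
          + \<langle>\<mu>, lie_bracket G \<eta> \<eta>'\<rangle>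
          + \<langle>\<nu>, lie_bracket G \<eta> \<zeta>' - lie_bracket G \<eta>' \<zeta>\<rangle>)"

definition hamiltonian_field ::
  "('g::topological_space, 'e::real_normed_vector) lie_data \<Rightarrow>
   (('g, 'e) phase_space \<Rightarrow> real) \<Rightarrow> ('g, 'e) phase_space \<Rightarrow> 'e tangent4" where
  "hamiltonian_field G H p =
     (THE v. \<forall>w. Omega G p v w = - tangent_map (phase_atlas G) vector_atlas H p w)"

definition phase_bracket ::
  "('g::topological_space, 'e::real_normed_vector) lie_data \<Rightarrow>
   (('g, 'e) phase_space \<Rightarrow> real) \<Rightarrow> (('g, 'e) phase_space \<Rightarrow> real) \<Rightarrow>
   ('g, 'e) phase_space \<Rightarrow> real" where
  "phase_bracket G H K p = Omega G p (hamiltonian_field G H p) (hamiltonian_field G K p)"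


section \<open>Reduction by the first copy of the Lie algebra\<close>

definition xi_independent :: "(('g, 'e::real_normed_vector) phase_space \<Rightarrow> real) \<Rightarrow> bool" where
  "xi_independent H \<longleftrightarrow> (\<forall>g \<xi> \<xi>' \<mu> \<nu>. H (g, \<xi>, \<mu>, \<nu>) = H (g, \<xi>', \<mu>, \<nu>))"

definition invariant_functions ::
  "('g::topological_space, 'e::real_normed_vector) lie_data \<Rightarrow>
   (('g, 'e) phase_space \<Rightarrow> real) set" where
  "invariant_functions G = {H \<in> smooth_functions (phase_atlas G). xi_independent H}"

definition reduced_atlas ::
  "('g, 'e::real_normed_vector) lie_data \<Rightarrow>
   (('g, 'e) reduced_space, 'e \<times> ('e \<Rightarrow>\<^sub>L real) \<times> ('e \<Rightarrow>\<^sub>L real)) atlas" where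
  "reduced_atlas G = prod_atlas (atlas G) vector_atlas"

definition reduction_map ::
  "('g, 'e::real_normed_vector) phase_space \<Rightarrow> ('g, 'e) reduced_space" where
  "reduction_map = (\<lambda>(g, \<xi>, \<mu>, \<nu>). (g, \<mu>, \<nu>))"

definition reduced_bracket ::
  "('g::topological_space, 'e::real_normed_vector) lie_data \<Rightarrow>
   (('g, 'e) reduced_space \<Rightarrow> real) \<Rightarrow> (('g, 'e) reduced_space \<Rightarrow> real) \<Rightarrow>
   ('g, 'e) reduced_space \<Rightarrow> real" where
  "reduced_bracket G H K =
     (THE F. F \<circ> reduction_map = phase_bracket G (H \<circ> reduction_map) (K \<circ> reduction_map))"


section \<open>Partial derivatives of functions on the reduced space\<close>

definition delta_g ::
  "('g, 'e::real_normed_vector) lie_data \<Rightarrow>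
   (('g, 'e) reduced_space \<Rightarrow> real) \<Rightarrow> ('g, 'e) reduced_space \<Rightarrow> ('e \<Rightarrow>\<^sub>L real)" where
  "delta_g G H = (\<lambda>(g, \<mu>, \<nu>).
     Blinfun (tangent_map (atlas G) vector_atlas (\<lambda>h. H (h, \<mu>, \<nu>)) g))"

text \<open>
  The derivative in a dual variable is an element of the bidual; it is identified with a vector.
\<close>

definition bidual_vector :: "(('e::real_normed_vector \<Rightarrow>\<^sub>L real) \<Rightarrow> real) \<Rightarrow> 'e" where
  "bidual_vector F = (THE v. \<forall>\<alpha>. F \<alpha> = \<langle>\<alpha>, v\<rangle>)"

definition delta_mu ::
  "(('g, 'e::real_normed_vector) reduced_space \<Rightarrow> real) \<Rightarrow> ('g, 'e) reduced_space \<Rightarrow> 'e" where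
  "delta_mu H = (\<lambda>(g, \<mu>, \<nu>).
     bidual_vector (frechet_derivative (\<lambda>m. H (g, m, \<nu>)) (at \<mu>)))"

definition delta_nu ::
  "(('g, 'e::real_normed_vector) reduced_space \<Rightarrow> real) \<Rightarrow> ('g, 'e) reduced_space \<Rightarrow> 'e" where
  "delta_nu H = (\<lambda>(g, \<mu>, \<nu>).
     bidual_vector (frechet_derivative (\<lambda>n. H (g, \<mu>, n)) (at \<nu>)))"

end

theory Submission
  imports Defs
begin

text \<open>
  In the frame of right invariant vector fields the symplectic form has constant shape, so
  \<open>i\<^sub>X \<Omega> = - dH\<close> can be solved explicitly: if \<open>H\<close> does not depend on \<open>\<xi>\<close>, the parameters of
  \<open>X\<^sub>H\<close> are \<open>(\<delta>H/\<delta>\<mu>, \<delta>H/\<delta>\<nu>, - T\<^sup>*R \<delta>H/\<delta>g, 0)\<close>, and the bracket formula is \<open>\<Omega>(X\<^sub>H, X\<^sub>K)\<close>.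

  For the Jacobi identity one works in a chart, where \<open>{H, K}\<close> is a bivector applied to \<open>dH\<close> and
  \<open>dK\<close>. The second derivatives of the three functions cancel by symmetry; what is left is the Jacobi
  identity of \<open>\<gg>\<close> together with the fact that the right invariant vector fields represent \<open>\<gg>\<close>.
  Both follow by differentiating the associativity of the multiplication in charts.

  The bracket of \<open>\<gg>\<close> is defined through the exponential map, so existence and uniqueness of
  one-parameter subgroups are needed. Picard iteration solves \<open>y' = R(y) \<xi>\<close> near the identity,
  uniqueness makes the solution a local homomorphism, and \<open>\<gamma>(t) = \<gamma>(t/n)\<^sup>n\<close> extends it.
\<close>

section \<open>Finite-dimensional normed spaces\<close>

text \<open>A tangent vector at \<open>p\<close> is its coordinate vector in the chart
  \<open>c p\<close>, and this chart may jump as \<open>p\<close> varies, so the components of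
  \<open>TR G g\<close> say nothing about smoothness in \<open>g\<close>. Hence every field is
  studied in one fixed chart, as \<open>R g z\<close> with \<open>g\<close> fixed and
  \<open>z\<close> moving; it equals \<open>TR\<close> only at the centre \<open>z = cm g g\<close>.
  Different charts are compared through the chart-free map \<open>x \<mapsto> x \<odot> h\<close>,
  whose derivative at the identity is the right invariant field. The bracket is treated alike:
  \<open>lb\<close> is built from second derivatives of the multiplication, is bilinear and
  satisfies the Jacobi identity by calculus alone, and is matched with \<open>lie_bracket\<close>
  separately. Smoothness is given by iterated derivatives in fixed directions, while the chain rule
  and fields such as \<open>R (fst p) (gm F p)\<close> involve moving directions. A basis expansion
  converts one into the other, and this is the main use of coordinates on finite-dimensional normed
  spaces.\<close>

lemma finite_dim_normedI:
  fixes B :: "'a::real_normed_vector set"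
  assumes "finite B" "span B = UNIV"
  shows "\<exists>B::'a set. finite B \<and> (\<forall>x. \<exists>c. x = (\<Sum>b\<in>B. c b *\<^sub>R b))"
proof (intro exI[of _ B] conjI allI assms(1))
  fix x
  have "x \<in> range (\<lambda>c. \<Sum>b\<in>B. c b *\<^sub>R b)"
    using assms by (simp flip: span_finite)
  then show "\<exists>c. x = (\<Sum>b\<in>B. c b *\<^sub>R b)" by blast
qed

section \<open>Bases and coordinate functionals\<close>

definition fbasis :: "'a::finite_dim_normed set" where
  "fbasis = (SOME B. finite B \<and> independent B \<and> span B = UNIV)"

lemma fbasis_ex: "\<exists>B::'a::finite_dim_normed set. finite B \<and> independent B \<and> span B = UNIV"
proof -
  obtain B :: "'a set" where B: "finite B" "\<forall>x. \<exists>c. x = (\<Sum>b\<in>B. c b *\<^sub>R b)"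
    using finite_dim by blast
  then have spB: "span B = UNIV"
    unfolding span_finite[OF B(1)] by blast
  obtain C where C: "C \<subseteq> B" "independent C" "B \<subseteq> span C"
    using maximal_independent_subset by blast
  have "span C = UNIV"
    using C(3) spB by (metis span_mono span_span top.extremum_uniqueI)
  with C B(1) show ?thesis
    using finite_subset by blast
qed

lemma
  shows finite_fbasis [simp]: "finite (fbasis :: 'a::finite_dim_normed set)"
    and independent_fbasis: "independent (fbasis :: 'a set)"
    and span_fbasis: "span (fbasis :: 'a set) = UNIV"
  using someI_ex[OF fbasis_ex] unfolding fbasis_def by blast+

text \<open>Indexed by all vectors: off the basis the functional is identically zero, which lets
  later bounds quantify over every \<open>b\<close>.\<close>

definition crd :: "'a::finite_dim_normed \<Rightarrow> 'a \<Rightarrow> real" where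
  "crd b x = representation fbasis x b"

lemma sum_crd: "(\<Sum>b\<in>fbasis. crd b x *\<^sub>R b) = x"
  unfolding crd_def
  by (rule real_vector.sum_representation_eq)
    (simp_all add: independent_fbasis span_fbasis)

lemma linear_crd: "linear (crd b)"
proof -
  have "linear (\<lambda>x. representation fbasis x b)"
    using real_vector.linear_representation[OF independent_fbasis span_fbasis, of b]
    unfolding linear_def real_scaleR_def[abs_def] .
  then show ?thesis
    by (simp add: crd_def[abs_def])
qed

text \<open>The norm dominates the coordinates because the span of a finite independent set is
  closed: by the bound already available for \<open>B\<close>, the coefficients of a convergent
  sequence in \<open>span B\<close> converge. So the new vector \<open>b\<close> has a positive
  distance \<open>d\<close> from \<open>span B\<close>.\<close>

lemma coefficients_bounded:
  fixes B :: "'a::real_normed_vector set"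
  assumes "finite B" "independent B"
  shows "\<exists>C>0. \<forall>c. \<forall>b\<in>B. \<bar>c b\<bar> \<le> C * norm (\<Sum>b\<in>B. c b *\<^sub>R b)"
  using assms
proof (induction B)
  case empty
  then show ?case by (auto intro: exI[of _ 1])
next
  case (insert b B)
  have ind: "independent B" and nb: "b \<notin> span B"
    using insert.prems insert.hyps by (auto simp: independent_insert)
  then obtain C where C: "C > 0" "\<And>c b. b \<in> B \<Longrightarrow> \<bar>c b\<bar> \<le> C * norm (\<Sum>b\<in>B. c b *\<^sub>R b)"
    using insert.IH by blast
  have "\<exists>d>0. \<forall>s\<in>span B. d \<le> norm (b - s)"
  proof (rule ccontr)
    assume "\<not> ?thesis"
    then have "\<forall>n. \<exists>s\<in>span B. norm (b - s) < inverse (real (Suc n))"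
      by (metis not_less inverse_positive_iff_positive of_nat_0_less_iff zero_less_Suc)
    then obtain s where s: "\<And>n. s n \<in> span B" "\<And>n. norm (b - s n) < inverse (real (Suc n))"
      by metis
    have "(\<lambda>n. s n - b) \<longlonglongrightarrow> 0"
      by (rule Lim_null_comparison[OF _ LIMSEQ_inverse_real_of_nat])
        (use s(2) in \<open>auto simp: norm_minus_commute intro!: always_eventually less_imp_le\<close>)
    then have lim: "s \<longlonglongrightarrow> b"
      by (simp add: LIM_zero_iff)
    have "\<forall>n. \<exists>c. s n = (\<Sum>b\<in>B. c b *\<^sub>R b)"
      using s(1) span_finite[OF insert.hyps(1)] by blast
    then obtain c where c: "\<And>n. s n = (\<Sum>b\<in>B. c n b *\<^sub>R b)" by metis
    have "Cauchy (\<lambda>n. c n x)" if "x \<in> B" for x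
      unfolding Cauchy_def
    proof (intro allI impI)
      fix e :: real assume "e > 0"
      then obtain N where N: "\<And>m n. m \<ge> N \<Longrightarrow> n \<ge> N \<Longrightarrow> dist (s m) (s n) < e / C"
        using LIMSEQ_imp_Cauchy[OF lim] C(1) unfolding Cauchy_def
        by (metis divide_pos_pos)
      have "dist (c m x) (c n x) < e" if "m \<ge> N" "n \<ge> N" for m n
      proof -
        have "\<bar>c m x - c n x\<bar> \<le> C * norm (\<Sum>b\<in>B. (c m b - c n b) *\<^sub>R b)"
          using C(2)[OF \<open>x \<in> B\<close>, of "\<lambda>b. c m b - c n b"] .
        also have "(\<Sum>b\<in>B. (c m b - c n b) *\<^sub>R b) = s m - s n"
          by (simp add: c scaleR_diff_left sum_subtractf)
        finally show ?thesis
          using N[OF that] C(1) by (simp add: dist_norm field_simps)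
      qed
      then show "\<exists>M. \<forall>m\<ge>M. \<forall>n\<ge>M. dist (c m x) (c n x) < e" by blast
    qed
    then have "\<forall>x\<in>B. \<exists>l. (\<lambda>n. c n x) \<longlonglongrightarrow> l"
      using Cauchy_convergent_iff convergent_def by blast
    then obtain l where l: "\<And>x. x \<in> B \<Longrightarrow> (\<lambda>n. c n x) \<longlonglongrightarrow> l x" by metis
    have "s \<longlonglongrightarrow> (\<Sum>b\<in>B. l b *\<^sub>R b)"
      unfolding c[abs_def] by (intro tendsto_intros l)
    then have "b = (\<Sum>b\<in>B. l b *\<^sub>R b)"
      using LIMSEQ_unique lim by blast
    also have "\<dots> \<in> span B"
      by (intro span_sum span_scale span_base)
    finally show False using nb by blast
  qed
  then obtain d where d: "d > 0" "\<And>s. s \<in> span B \<Longrightarrow> d \<le> norm (b - s)" by blast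
  \<comment> \<open>\<open>1 / d\<close> bounds the coefficient of \<open>b\<close>; the other
    summand bounds the old coefficients after \<open>c b *\<^sub>R b\<close> is subtracted from the
    total.\<close>
  define K where "K = 1 / d + C * (1 + norm b / d)"
  have "\<bar>c x\<bar> \<le> K * norm (\<Sum>b\<in>insert b B. c b *\<^sub>R b)" if x: "x \<in> insert b B" for c x
  proof -
    define s where "s = (\<Sum>b\<in>B. c b *\<^sub>R b)"
    define t where "t = c b *\<^sub>R b + s"
    have t: "(\<Sum>b\<in>insert b B. c b *\<^sub>R b) = t"
      using insert.hyps by (simp add: t_def s_def)
    have s: "s \<in> span B"
      unfolding s_def by (intro span_sum span_scale span_base)
    have 1: "\<bar>c b\<bar> \<le> 1 / d * norm t"
    proof (cases "c b = 0")
      case False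
      \<comment> \<open>Dividing by \<open>c b\<close> writes the total as \<open>c b\<close> times
        the difference of \<open>b\<close> and a vector of \<open>span B\<close>, to which the
        distance bound applies.\<close>
      have "d \<le> norm (b - (- (1 / c b)) *\<^sub>R s)"
        by (intro d(2) span_scale s)
      then have "\<bar>c b\<bar> * d \<le> norm (c b *\<^sub>R (b - (- (1 / c b)) *\<^sub>R s))"
        by (simp add: mult_left_mono)
      also have "c b *\<^sub>R (b - (- (1 / c b)) *\<^sub>R s) = t"
        using False by (simp add: t_def scaleR_add_right)
      finally show ?thesis using d(1) by (simp add: field_simps)
    qed (use d in simp)
    have pos: "0 \<le> C * (1 + norm b / d) * norm t" "0 \<le> 1 / d * norm t"
      using C d by auto
    show ?thesis
    proof (cases "x = b")
      case True
      then show ?thesis using 1 pos by (simp only: t K_def distrib_right)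
    next
      case False
      then have "\<bar>c x\<bar> \<le> C * norm s" using C(2)[of x c] x by (simp add: s_def)
      also have "norm s \<le> norm t + \<bar>c b\<bar> * norm b"
        using norm_triangle_ineq4[of t "c b *\<^sub>R b"] by (simp add: t_def)
      also have "\<bar>c b\<bar> * norm b \<le> 1 / d * norm t * norm b"
        by (rule mult_right_mono[OF 1]) simp
      finally have "\<bar>c x\<bar> \<le> C * (norm t + 1 / d * norm t * norm b)"
        using C(1) by simp
      also have "\<dots> = C * (1 + norm b / d) * norm t"
        by (simp add: algebra_simps)
      finally show ?thesis using pos by (simp only: t K_def distrib_right)
    qed
  qed
  moreover have "K > 0"
    using C d by (simp add: K_def add_pos_pos add_pos_nonneg)
  ultimately show ?case by blast
qed

lemma bounded_linear_crd: "bounded_linear (crd (b::'a::finite_dim_normed))"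
proof (cases "b \<in> fbasis")
  case True
  obtain C where C: "\<And>c. \<forall>b\<in>fbasis::'a set. \<bar>c b\<bar> \<le> C * norm (\<Sum>b\<in>fbasis. c b *\<^sub>R b)"
    using coefficients_bounded[OF finite_fbasis independent_fbasis] by blast
  have "\<bar>crd b x\<bar> \<le> norm x * C" for x
    using C[of "\<lambda>b. crd b x"] True by (simp add: sum_crd mult.commute)
  then show ?thesis
    using linear_crd[of b] by (intro bounded_linear_intro[where K=C]) (auto simp: linear_iff)
next
  case False
  then have "crd b = (\<lambda>_. 0)"
    using real_vector.representation_ne_zero by (fastforce simp: crd_def[abs_def])
  then show ?thesis by simp
qed

lemma linear_sum_crd:
  fixes f :: "'a::finite_dim_normed \<Rightarrow> 'b::real_normed_vector"
  assumes "linear f"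
  shows "f x = (\<Sum>b\<in>fbasis. crd b x *\<^sub>R f b)"
proof -
  have "f x = f (\<Sum>b\<in>fbasis. crd b x *\<^sub>R b)" by (simp add: sum_crd)
  also have "\<dots> = (\<Sum>b\<in>fbasis. crd b x *\<^sub>R f b)"
    using assms by (simp add: linear_sum linear_scale)
  finally show ?thesis .
qed

lemma linear_imp_bounded_linear:
  fixes f :: "'a::finite_dim_normed \<Rightarrow> 'b::real_normed_vector"
  assumes "linear f"
  shows "bounded_linear f"
proof -
  have "bounded_linear (\<lambda>x. \<Sum>b\<in>fbasis. crd b x *\<^sub>R f b)"
    by (intro bounded_linear_sum bounded_linear_scaleR_const bounded_linear_crd)
  then show ?thesis by (simp flip: linear_sum_crd[OF assms])
qed

lemma bilinear_imp_bounded_bilinear: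
  fixes f :: "'a::finite_dim_normed \<Rightarrow> 'b::finite_dim_normed \<Rightarrow> 'c::real_normed_vector"
  assumes l: "\<And>y. linear (\<lambda>x. f x y)" and r: "\<And>x. linear (f x)"
  shows "bounded_bilinear f"
proof -
  obtain Ka where Ka: "\<And>b x. norm (crd (b::'a) x) \<le> norm x * Ka b"
    using bounded_linear.bounded[OF bounded_linear_crd] by metis
  obtain Kb where Kb: "\<And>b x. norm (crd (b::'b) x) \<le> norm x * Kb b"
    using bounded_linear.bounded[OF bounded_linear_crd] by metis
  have eq: "f x y = (\<Sum>b\<in>fbasis. \<Sum>c\<in>fbasis. (crd b x * crd c y) *\<^sub>R f b c)" for x y
    by (subst linear_sum_crd[OF l], subst linear_sum_crd[OF r]) (simp add: scaleR_sum_right)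
  have bound: "norm (f x y) \<le> norm x * norm y * (\<Sum>b\<in>fbasis. \<Sum>c\<in>fbasis. Ka b * Kb c * norm (f b c))" for x y
    unfolding eq[of x y] sum_distrib_left
  proof (intro sum_norm_le)
    fix b :: 'a and c :: 'b
    have "\<bar>crd b x\<bar> * \<bar>crd c y\<bar> \<le> (norm x * Ka b) * (norm y * Kb c)"
      by (rule mult_mono) (use Ka[of b x] Kb[of c y] in auto)
    then have "\<bar>crd b x\<bar> * \<bar>crd c y\<bar> * norm (f b c)
        \<le> (norm x * Ka b) * (norm y * Kb c) * norm (f b c)"
      by (rule mult_right_mono) simp
    then show "norm ((crd b x * crd c y) *\<^sub>R f b c) \<le> norm x * norm y * (Ka b * Kb c * norm (f b c))"
      by (simp add: abs_mult mult_ac)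
  qed
  show ?thesis
    by (rule bounded_bilinear.intro)
      (use bound in \<open>auto simp: linear_add[OF l] linear_add[OF r] linear_scale[OF l] linear_scale[OF r]\<close>)
qed

text \<open>Completeness is what the fixed point argument for differential equations requires;
  coordinates reduce it to the real line.\<close>

instance finite_dim_normed \<subseteq> banach
proof
  fix X :: "nat \<Rightarrow> 'a" assume X: "Cauchy X"
  have "convergent (\<lambda>n. crd b (X n))" for b
    using bounded_linear.Cauchy[OF bounded_linear_crd X] Cauchy_convergent_iff by blast
  then obtain l where "\<And>b. (\<lambda>n. crd b (X n)) \<longlonglongrightarrow> l b"
    unfolding convergent_def by metis
  then have "(\<lambda>n. \<Sum>b\<in>fbasis. crd b (X n) *\<^sub>R b) \<longlonglongrightarrow> (\<Sum>b\<in>fbasis. l b *\<^sub>R b)"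
    by (intro tendsto_intros)
  then show "convergent X"
    by (auto simp: sum_crd convergent_def)
qed

instance real :: finite_dim_normed
proof (standard, intro exI[of _ "{1}"] conjI allI)
  fix x :: real
  show "\<exists>c. x = (\<Sum>b\<in>{1}. c b *\<^sub>R b)"
    by (rule exI[of _ "\<lambda>_. x"]) simp
qed simp

instance prod :: (finite_dim_normed, finite_dim_normed) finite_dim_normed
proof (standard, rule finite_dim_normedI)
  let ?B = "(\<lambda>b. (b, 0)) ` fbasis \<union> (\<lambda>b. (0, b)) ` fbasis :: ('a \<times> 'b) set"
  show "finite ?B" by simp
  have "(x, y) \<in> span ?B" for x y
  proof -
    have "(x, y) = (\<Sum>b\<in>fbasis. crd b x *\<^sub>R (b, 0)) + (\<Sum>b\<in>fbasis. crd b y *\<^sub>R (0, b))"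
      by (simp add: prod_eq_iff fst_sum snd_sum sum_crd)
    also have "\<dots> \<in> span ?B"
      by (intro span_add span_sum span_scale span_base) auto
    finally show ?thesis .
  qed
  then show "span ?B = UNIV" by auto
qed

definition dual_crd :: "'a::finite_dim_normed \<Rightarrow> 'a \<Rightarrow>\<^sub>L real" where
  "dual_crd b = Blinfun (crd b)"

lemma dual_crd_apply [simp]: "\<langle>dual_crd b, x\<rangle> = crd b x"
  unfolding dual_crd_def by (simp add: bounded_linear_crd bounded_linear_Blinfun_apply)

text \<open>The maps \<open>?e (b, c)\<close> send \<open>x\<close> to \<open>crd b x\<close> times
  \<open>c\<close>: they are the matrix units of the two bases.\<close>

instance blinfun :: (finite_dim_normed, finite_dim_normed) finite_dim_normed
proof (standard, rule finite_dim_normedI)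
  let ?e = "\<lambda>(b, c). blinfun_scaleR_left c o\<^sub>L dual_crd b :: 'a \<Rightarrow>\<^sub>L 'b"
  let ?B = "?e ` (fbasis \<times> fbasis)"
  show "finite ?B" by simp
  have "f \<in> span ?B" for f
  proof -
    have "f = (\<Sum>b\<in>fbasis. \<Sum>c\<in>fbasis. crd c (blinfun_apply f b) *\<^sub>R ?e (b, c))"
    proof (rule blinfun_eqI)
      fix x
      have "blinfun_apply f x = (\<Sum>b\<in>fbasis. crd b x *\<^sub>R blinfun_apply f b)"
        by (rule linear_sum_crd) (simp add: blinfun.bounded_linear_right bounded_linear.linear)
      also have "\<dots> = (\<Sum>b\<in>fbasis. crd b x *\<^sub>R (\<Sum>c\<in>fbasis. crd c (blinfun_apply f b) *\<^sub>R c))"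
        by (simp add: sum_crd)
      finally show "blinfun_apply f x
        = blinfun_apply (\<Sum>b\<in>fbasis. \<Sum>c\<in>fbasis. crd c (blinfun_apply f b) *\<^sub>R ?e (b, c)) x"
        by (simp add: blinfun.sum_left blinfun.scaleR_left scaleR_sum_right mult.commute)
    qed
    also have "\<dots> \<in> span ?B"
      by (intro span_sum span_scale span_base) auto
    finally show ?thesis .
  qed
  then show "span ?B = UNIV" by auto
qed

lemma dual_sum_crd: "(\<Sum>b\<in>fbasis. \<langle>\<alpha>, b\<rangle> *\<^sub>R dual_crd b) = (\<alpha> :: 'a::finite_dim_normed \<Rightarrow>\<^sub>L real)"
proof (rule blinfun_eqI)
  fix x
  have "\<langle>\<alpha>, x\<rangle> = (\<Sum>b\<in>fbasis. crd b x *\<^sub>R \<langle>\<alpha>, b\<rangle>)"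
    by (rule linear_sum_crd) (simp add: blinfun.bounded_linear_right bounded_linear.linear)
  then show "\<langle>\<Sum>b\<in>fbasis. \<langle>\<alpha>, b\<rangle> *\<^sub>R dual_crd b, x\<rangle> = \<langle>\<alpha>, x\<rangle>"
    by (simp add: blinfun.sum_left blinfun.scaleR_left mult.commute)
qed

lemma dual_separates:
  fixes v w :: "'a::finite_dim_normed"
  assumes "\<And>\<alpha> :: 'a \<Rightarrow>\<^sub>L real. \<langle>\<alpha>, v\<rangle> = \<langle>\<alpha>, w\<rangle>"
  shows "v = w"
proof -
  have "crd b v = crd b w" for b
    using assms[of "dual_crd b"] by simp
  then show ?thesis
    by (metis (no_types, lifting) sum.cong sum_crd)
qed

text \<open>Reflexivity: it gives the definite description in \<open>bidual_vector\<close> its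
  value, and the explicit basis expansion shows later that gradients depend smoothly on the
  point.\<close>

lemma bidual_vector_eq:
  fixes F :: "('a::finite_dim_normed \<Rightarrow>\<^sub>L real) \<Rightarrow> real"
  assumes "linear F"
  shows "bidual_vector F = (\<Sum>b\<in>fbasis. F (dual_crd b) *\<^sub>R b)"
    and pairing_bidual_vector: "\<langle>\<alpha>, bidual_vector F\<rangle> = F \<alpha>"
proof -
  have *: "\<langle>\<alpha>, \<Sum>b\<in>fbasis. F (dual_crd b) *\<^sub>R b\<rangle> = F \<alpha>" for \<alpha>
  proof -
    have "F \<alpha> = F (\<Sum>b\<in>fbasis. \<langle>\<alpha>, b\<rangle> *\<^sub>R dual_crd b)" by (simp add: dual_sum_crd)
    also have "\<dots> = (\<Sum>b\<in>fbasis. \<langle>\<alpha>, b\<rangle> * F (dual_crd b))"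
      using assms by (simp add: linear_sum linear_scale)
    finally show ?thesis
      by (simp add: blinfun.sum_right blinfun.scaleR_right mult.commute)
  qed
  show eq: "bidual_vector F = (\<Sum>b\<in>fbasis. F (dual_crd b) *\<^sub>R b)"
    unfolding bidual_vector_def by (rule the_equality) (use * in \<open>auto intro: dual_separates\<close>)
  show "\<langle>\<alpha>, bidual_vector F\<rangle> = F \<alpha>"
    using * eq by simp
qed

lemma Blinfun_apply_linear:
  fixes f :: "'a::finite_dim_normed \<Rightarrow> real"
  shows "linear f \<Longrightarrow> blinfun_apply (Blinfun f) = f"
  by (simp add: bounded_linear_Blinfun_apply linear_imp_bounded_linear)

text \<open>Vectors with rational coordinates form a countable dense set; the balls of radius
  \<open>1 / real (Suc n)\<close> around them are a base.\<close>

lemma second_countable_finite_dim: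
  "second_countable (euclidean :: 'a::finite_dim_normed topology)"
proof -
  define D where "D = (\<lambda>q. \<Sum>b\<in>fbasis. q b *\<^sub>R b :: 'a) ` (PiE fbasis (\<lambda>_. \<rat>))"
  define \<B> where "\<B> = (\<lambda>(x, n). ball x (1 / real (Suc n))) ` (D \<times> (UNIV :: nat set))"
  have "countable D"
    unfolding D_def by (intro countable_image countable_PiE finite_fbasis countable_rat)
  then have "countable \<B>"
    unfolding \<B>_def by (intro countable_image countable_SIGMA) auto
  have dense: "\<exists>y\<in>D. dist x y < e" if "e > 0" for x :: 'a and e
  proof -
    \<comment> \<open>The added 1 keeps \<open>K\<close> positive in dimension zero and makes the
      final estimate strict.\<close>
    define K where "K = (\<Sum>b\<in>fbasis. norm (b::'a)) + 1"
    have K: "K > 0" unfolding K_def by (simp add: add_nonneg_pos sum_nonneg)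
    have "\<exists>q\<in>\<rat>. \<bar>crd b x - q\<bar> < e / K" for b
    proof -
      obtain q where "q \<in> \<rat>" "crd b x - e / K < q" "q < crd b x"
        using Rats_dense_in_real[of "crd b x - e / K" "crd b x"] divide_pos_pos[OF \<open>e > 0\<close> K] by auto
      then show ?thesis by (intro bexI[of _ q]) auto
    qed
    then obtain q where q: "\<And>b. q b \<in> \<rat>" "\<And>b. \<bar>crd b x - q b\<bar> < e / K" by metis
    let ?y = "\<Sum>b\<in>fbasis. restrict q fbasis b *\<^sub>R b"
    have "?y \<in> D" unfolding D_def using q(1) by (intro imageI) auto
    moreover have "dist x ?y < e"
    proof -
      have "x - ?y = (\<Sum>b\<in>fbasis. (crd b x - q b) *\<^sub>R b)"
        using sum_crd[of x] by (simp add: scaleR_diff_left sum_subtractf)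
      then have "norm (x - ?y) \<le> (\<Sum>b\<in>fbasis. \<bar>crd b x - q b\<bar> * norm b)"
        by (simp add: sum_norm_le)
      also have "\<dots> \<le> (\<Sum>b\<in>fbasis. e / K * norm (b::'a))"
        by (intro sum_mono mult_right_mono less_imp_le[OF q(2)]) auto
      also have "\<dots> = e * ((K - 1) / K)"
        unfolding K_def by (simp add: sum_distrib_left flip: sum_divide_distrib)
      also have "\<dots> < e * 1"
        using K \<open>e > 0\<close> by (intro mult_strict_left_mono) simp_all
      finally show ?thesis by (simp add: dist_norm)
    qed
    ultimately show ?thesis by blast
  qed
  have "\<exists>V\<in>\<B>. x \<in> V \<and> V \<subseteq> U" if U: "open U" "x \<in> U" for U x
  proof -
    obtain e where e: "e > 0" "ball x e \<subseteq> U" by (rule openE[OF U])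
    obtain n where n: "1 / real (Suc n) < e / 2"
      using reals_Archimedean[of "e / 2"] e by (auto simp: inverse_eq_divide)
    obtain y where y: "y \<in> D" "dist x y < 1 / real (Suc n)" using dense[of "1 / real (Suc n)" x] by auto
    have "ball y (1 / real (Suc n)) \<subseteq> U"
    proof
      fix z assume "z \<in> ball y (1 / real (Suc n))"
      then have "dist x z < e"
        using dist_triangle[of x z y] y(2) n by simp
      then show "z \<in> U" using e by auto
    qed
    moreover have "ball y (1 / real (Suc n)) \<in> \<B>" unfolding \<B>_def using y by auto
    ultimately show ?thesis using y by (intro bexI[of _ "ball y (1 / real (Suc n))"]) (auto simp: dist_commute)
  qed
  moreover have "\<forall>V\<in>\<B>. open V" unfolding \<B>_def by auto
  ultimately show ?thesis
    unfolding second_countable_def using \<open>countable \<B>\<close> by (intro exI[of _ \<B>]) auto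
qed

section \<open>Smooth maps on open sets\<close>

abbreviation fd :: "('a::real_normed_vector \<Rightarrow> 'b::real_normed_vector) \<Rightarrow> 'a \<Rightarrow> 'a \<Rightarrow> 'b" where
  "fd f x \<equiv> frechet_derivative f (at x)"

lemma fd_eq: "(f has_derivative f') (at x) \<Longrightarrow> fd f x = f'"
  using frechet_derivative_at[of f f' x] by simp

lemma fd_has_derivative: "f differentiable (at x) \<Longrightarrow> (f has_derivative fd f x) (at x)"
  by (simp add: frechet_derivative_works)

lemma bounded_linear_fd: "f differentiable (at x) \<Longrightarrow> bounded_linear (fd f x)"
  using fd_has_derivative has_derivative_bounded_linear by blast

lemma linear_fd: "f differentiable (at x) \<Longrightarrow> linear (fd f x)"
  using bounded_linear_fd bounded_linear.linear by blast

text \<open>Both functions have the same derivatives at \<open>x\<close>, so the choice made by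
  \<open>frechet_derivative\<close> is literally the same, even where no derivative exists.\<close>

lemma fd_cong:
  assumes "open S" "x \<in> S" "\<And>y. y \<in> S \<Longrightarrow> f y = g y"
  shows "fd f x = fd g x"
proof -
  have "(f has_derivative f') (at x) \<longleftrightarrow> (g has_derivative f') (at x)" for f'
    using has_derivative_transform_within_open[OF _ assms(1,2), of f f' UNIV g]
      has_derivative_transform_within_open[OF _ assms(1,2), of g f' UNIV f] assms(3) by auto
  then show ?thesis
    unfolding frechet_derivative_def by simp
qed

lemma differentiable_cong_open:
  assumes "f differentiable (at x)" "open S" "x \<in> S" "\<And>y. y \<in> S \<Longrightarrow> f y = g y"
  shows "g differentiable (at x)"
  using assms(1) has_derivative_transform_within_open[OF _ assms(2,3), of f _ UNIV g] assms(4)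
  unfolding differentiable_def by auto

lemma fd_compose:
  assumes "g differentiable (at x)" "f differentiable (at (g x))"
  shows "fd (\<lambda>x. f (g x)) x = (\<lambda>v. fd f (g x) (fd g x v))"
  by (rule fd_eq) (rule has_derivative_compose[OF fd_has_derivative fd_has_derivative, OF assms])

section \<open>Closure properties of the classes \<open>C_k_on\<close>\<close>

lemma C_k_on_cong:
  assumes "open S" "\<And>x. x \<in> S \<Longrightarrow> f x = g x" "C_k_on k S f"
  shows "C_k_on k S g"
  using assms(2,3)
proof (induction k arbitrary: f g)
  case 0
  then show ?case using continuous_on_cong[of S S f g] by simp
next
  case (Suc k)
  have "C_k_on k S (\<lambda>x. fd g x v)" for v
    by (rule Suc.IH[of "\<lambda>x. fd f x v"]) (use Suc.prems fd_cong[OF assms(1) _ Suc.prems(1)] in auto)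
  moreover have "g differentiable (at x)" if "x \<in> S" for x
    using differentiable_cong_open[OF _ assms(1) that Suc.prems(1)] Suc.prems(2) that by auto
  ultimately show ?case by simp
qed

lemma C_k_on_local:
  assumes "\<And>x. x \<in> S \<Longrightarrow> \<exists>U. open U \<and> x \<in> U \<and> C_k_on k U f"
  shows "C_k_on k S f"
  using assms
proof (induction k arbitrary: f)
  case 0
  then show ?case
    using continuous_on_eq_continuous_at by (fastforce intro: continuous_at_imp_continuous_on)
next
  case (Suc k)
  have "C_k_on k S (\<lambda>x. fd f x v)" for v
    by (rule Suc.IH) (use Suc.prems in fastforce)
  moreover have "f differentiable (at x)" if "x \<in> S" for x
    using Suc.prems[OF that] by auto
  ultimately show ?case by simp
qed

lemma C_k_on_subset: "C_k_on k S f \<Longrightarrow> T \<subseteq> S \<Longrightarrow> C_k_on k T f"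
  by (induction k arbitrary: f) (auto intro: continuous_on_subset)

lemma C_k_on_SucD: "C_k_on (Suc k) S f \<Longrightarrow> C_k_on k S f"
proof (induction k arbitrary: f)
  case 0
  then show ?case
    by (auto intro!: continuous_at_imp_continuous_on differentiable_imp_continuous_within)
next
  case (Suc k)
  have "C_k_on k S (\<lambda>x. fd f x v)" for v
    using Suc.IH Suc.prems by fastforce
  with Suc.prems show ?case by simp
qed

lemma C_k_on_const: "C_k_on k S (\<lambda>_. c)"
proof (induction k arbitrary: c)
  case (Suc k)
  then show ?case by simp
qed simp

lemma C_k_on_linear_compose:
  assumes L: "bounded_linear L" and S: "open S" and f: "C_k_on k S f"
  shows "C_k_on k S (\<lambda>x. L (f x))"
  using f
proof (induction k arbitrary: f)
  case 0
  then show ?case using bounded_linear.continuous_on[OF L] by auto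
next
  case (Suc k)
  have *: "((\<lambda>x. L (f x)) has_derivative (\<lambda>v. L (fd f x v))) (at x)" if "x \<in> S" for x
    using bounded_linear.has_derivative[OF L fd_has_derivative] Suc.prems that by auto
  have "C_k_on k S (\<lambda>x. fd (\<lambda>x. L (f x)) x v)" for v
    by (rule C_k_on_cong[OF S _ Suc.IH[of "\<lambda>x. fd f x v"]]) (use fd_eq[OF *] Suc.prems in auto)
  with * show ?case unfolding C_k_on.simps differentiable_def by blast
qed

lemma C_k_on_linear:
  assumes L: "bounded_linear L"
  shows "C_k_on k S L"
proof (cases k)
  case 0
  then show ?thesis using linear_continuous_on[OF L] by simp
next
  case (Suc j)
  have "(L has_derivative L) (at x)" for x
    by (rule bounded_linear_imp_has_derivative[OF L])
  moreover from this have "fd L x = L" for x by (rule fd_eq)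
  ultimately show ?thesis using Suc by (auto simp: C_k_on_const differentiable_def)
qed

lemma C_k_on_add:
  assumes S: "open S" and "C_k_on k S f" "C_k_on k S g"
  shows "C_k_on k S (\<lambda>x. f x + g x)"
  using assms(2,3)
proof (induction k arbitrary: f g)
  case 0
  then show ?case by (simp add: continuous_on_add)
next
  case (Suc k)
  have *: "((\<lambda>x. f x + g x) has_derivative (\<lambda>v. fd f x v + fd g x v)) (at x)" if "x \<in> S" for x
    by (intro has_derivative_add fd_has_derivative) (use Suc.prems that in auto)
  have "C_k_on k S (\<lambda>x. fd (\<lambda>x. f x + g x) x v)" for v
    by (rule C_k_on_cong[OF S _ Suc.IH[of "\<lambda>x. fd f x v" "\<lambda>x. fd g x v"]]) (use fd_eq[OF *] Suc.prems in auto)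
  with * show ?case unfolding C_k_on.simps differentiable_def by blast
qed

lemma C_k_on_bilinear:
  assumes B: "bounded_bilinear B" and S: "open S" and "C_k_on k S f" "C_k_on k S g"
  shows "C_k_on k S (\<lambda>x. B (f x) (g x))"
  using assms(3,4)
proof (induction k arbitrary: f g)
  case 0
  then show ?case using bounded_bilinear.continuous_on[OF B] by auto
next
  case (Suc k)
  have *: "((\<lambda>x. B (f x) (g x)) has_derivative (\<lambda>v. B (f x) (fd g x v) + B (fd f x v) (g x))) (at x)"
    if "x \<in> S" for x
    by (intro bounded_bilinear.FDERIV[OF B] fd_has_derivative) (use Suc.prems that in auto)
  have "C_k_on k S (\<lambda>x. B (f x) (fd g x v) + B (fd f x v) (g x))" for v
    by (intro C_k_on_add S Suc.IH) (use Suc.prems in \<open>auto simp: C_k_on_SucD simp del: C_k_on.simps\<close>, auto)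
  then have "C_k_on k S (\<lambda>x. fd (\<lambda>x. B (f x) (g x)) x v)" for v
    by (rule C_k_on_cong[OF S, rotated]) (use fd_eq[OF *] in auto)
  with * show ?case unfolding C_k_on.simps differentiable_def by blast
qed

lemma C_k_on_sum:
  assumes "open S" "\<And>i. i \<in> I \<Longrightarrow> C_k_on k S (f i)"
  shows "C_k_on k S (\<lambda>x. \<Sum>i\<in>I. f i x)"
  using assms(2)
  by (induction I rule: infinite_finite_induct) (auto intro: C_k_on_add[OF assms(1)] C_k_on_const)

text \<open>\<open>C_k_on\<close> controls derivatives in fixed directions only, while the chain
  rule evaluates \<open>fd g (f x)\<close> in the moving direction \<open>fd f x v\<close>.
  Expanding that vector in \<open>fbasis\<close> leaves a sum of products covered by the induction
  hypothesis.\<close>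

lemma C_k_on_compose:
  fixes f :: "'a::real_normed_vector \<Rightarrow> 'b::finite_dim_normed" and g :: "'b \<Rightarrow> 'c::real_normed_vector"
  assumes S: "open S" and fS: "f ` S \<subseteq> T" and "C_k_on k S f" "C_k_on k T g"
  shows "C_k_on k S (\<lambda>x. g (f x))"
  using assms(3,4)
proof (induction k arbitrary: g)
  case 0
  then show ?case using continuous_on_compose2[of T g S f] fS by auto
next
  case (Suc k)
  have d: "f differentiable (at x)" "g differentiable (at (f x))" if "x \<in> S" for x
    using Suc.prems that fS by auto
  have "C_k_on k S f"
    using Suc.prems C_k_on_SucD by blast
  then have "C_k_on k S (\<lambda>x. \<Sum>b\<in>fbasis. crd b (fd f x v) *\<^sub>R fd g (f x) b)" for v
    using Suc.prems
    by (intro C_k_on_sum C_k_on_bilinear[OF bounded_bilinear_scaleR] S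
        C_k_on_linear_compose[OF bounded_linear_crd] Suc.IH) auto
  then have "C_k_on k S (\<lambda>x. fd (\<lambda>x. g (f x)) x v)" for v
  proof (rule C_k_on_cong[OF S, rotated])
    fix x assume "x \<in> S"
    then show "(\<Sum>b\<in>fbasis. crd b (fd f x v) *\<^sub>R fd g (f x) b) = fd (\<lambda>x. g (f x)) x v"
      using fd_compose[OF d] linear_sum_crd[OF linear_fd[OF d(2)], of x "fd f x v"] by simp
  qed
  moreover have "(\<lambda>x. g (f x)) differentiable (at x)" if "x \<in> S" for x
    using differentiable_chain_at[OF d[OF that]] by (simp add: o_def)
  ultimately show ?case by simp
qed

section \<open>Closure properties of smooth maps\<close>

lemma smooth_on_cong: "open S \<Longrightarrow> (\<And>x. x \<in> S \<Longrightarrow> f x = g x) \<Longrightarrow> smooth_on S f \<Longrightarrow> smooth_on S g"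
  unfolding smooth_on_def by (intro allI C_k_on_cong[of S f g]) auto

lemma smooth_on_local:
  "(\<And>x. x \<in> S \<Longrightarrow> \<exists>U. open U \<and> x \<in> U \<and> smooth_on U f) \<Longrightarrow> smooth_on S f"
  unfolding smooth_on_def by (intro allI C_k_on_local) blast

lemma smooth_on_subset: "smooth_on S f \<Longrightarrow> T \<subseteq> S \<Longrightarrow> smooth_on T f"
  unfolding smooth_on_def by (auto intro: C_k_on_subset)

lemma smooth_on_const: "smooth_on S (\<lambda>_. c)"
  unfolding smooth_on_def by (intro allI C_k_on_const)

lemma smooth_on_linear: "bounded_linear L \<Longrightarrow> smooth_on S L"
  unfolding smooth_on_def by (intro allI C_k_on_linear)

lemma smooth_on_linear_compose:
  "bounded_linear L \<Longrightarrow> open S \<Longrightarrow> smooth_on S f \<Longrightarrow> smooth_on S (\<lambda>x. L (f x))"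
  unfolding smooth_on_def by (rule allI, rule C_k_on_linear_compose[of L]) auto

lemma smooth_on_add: "open S \<Longrightarrow> smooth_on S f \<Longrightarrow> smooth_on S g \<Longrightarrow> smooth_on S (\<lambda>x. f x + g x)"
  unfolding smooth_on_def by (intro allI C_k_on_add) auto

lemma smooth_on_bilinear:
  "bounded_bilinear B \<Longrightarrow> open S \<Longrightarrow> smooth_on S f \<Longrightarrow> smooth_on S g \<Longrightarrow> smooth_on S (\<lambda>x. B (f x) (g x))"
  unfolding smooth_on_def by (intro allI C_k_on_bilinear[of B]) auto

lemma smooth_on_minus: "open S \<Longrightarrow> smooth_on S f \<Longrightarrow> smooth_on S (\<lambda>x. - f x)"
  using smooth_on_linear_compose[OF bounded_linear_minus[OF bounded_linear_ident], of S f] by simp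

lemma smooth_on_diff: "open S \<Longrightarrow> smooth_on S f \<Longrightarrow> smooth_on S g \<Longrightarrow> smooth_on S (\<lambda>x. f x - g x)"
  using smooth_on_add[of S f "\<lambda>x. - g x"] smooth_on_minus[of S g] by simp

lemma smooth_on_sum:
  "open S \<Longrightarrow> (\<And>i. i \<in> I \<Longrightarrow> smooth_on S (f i)) \<Longrightarrow> smooth_on S (\<lambda>x. \<Sum>i\<in>I. f i x)"
  unfolding smooth_on_def by (intro allI C_k_on_sum[of S I _ f]) auto

lemma smooth_on_compose:
  fixes f :: "'a::real_normed_vector \<Rightarrow> 'b::finite_dim_normed" and g :: "'b \<Rightarrow> 'c::real_normed_vector"
  shows "open S \<Longrightarrow> f ` S \<subseteq> T \<Longrightarrow> smooth_on S f \<Longrightarrow> smooth_on T g \<Longrightarrow> smooth_on S (\<lambda>x. g (f x))"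
  unfolding smooth_on_def by (rule allI, rule C_k_on_compose[of S f T]) auto

lemma smooth_on_Pair:
  assumes S: "open S" and "smooth_on S f" "smooth_on S g"
  shows "smooth_on S (\<lambda>x. (f x, g x))"
proof -
  have "smooth_on S (\<lambda>x. (f x, 0) + (0, g x))"
    by (intro smooth_on_add S smooth_on_linear_compose[OF _ S assms(2)] smooth_on_linear_compose[OF _ S assms(3)]
        bounded_linear_Pair bounded_linear_ident bounded_linear_zero)
  then show ?thesis by simp
qed

lemma smooth_on_differentiable: "smooth_on S f \<Longrightarrow> x \<in> S \<Longrightarrow> f differentiable (at x)"
  unfolding smooth_on_def by (drule spec[of _ "Suc 0"]) simp

lemma smooth_on_continuous: "smooth_on S f \<Longrightarrow> continuous_on S f"
  unfolding smooth_on_def by (drule spec[of _ 0]) simp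

lemma smooth_on_fd: "smooth_on S f \<Longrightarrow> smooth_on S (\<lambda>x. fd f x v)"
  unfolding smooth_on_def
proof
  fix k assume "\<forall>k. C_k_on k S f"
  then have "C_k_on (Suc k) S f" ..
  then show "C_k_on k S (\<lambda>x. fd f x v)" by simp
qed

text \<open>The same expansion as in the chain rule: the coefficients depend on the point, the
  directions are constant.\<close>

lemma smooth_on_linear_family:
  fixes A :: "'z::real_normed_vector \<Rightarrow> 'a::finite_dim_normed \<Rightarrow> 'b::real_normed_vector"
  assumes T: "open T" and lin: "\<And>x. x \<in> T \<Longrightarrow> linear (A x)"
    and A: "\<And>v. smooth_on T (\<lambda>x. A x v)" and u: "smooth_on T u"
  shows "smooth_on T (\<lambda>x. A x (u x))"
proof -
  have "smooth_on T (\<lambda>x. \<Sum>b\<in>fbasis. crd b (u x) *\<^sub>R A x b)"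
    by (intro smooth_on_sum T smooth_on_bilinear[OF bounded_bilinear_scaleR] u
        smooth_on_linear_compose[OF bounded_linear_crd] A)
  then show ?thesis
    by (rule smooth_on_cong[OF T, rotated]) (simp add: linear_sum_crd[OF lin, symmetric])
qed

lemma smooth_on_fd_apply:
  fixes f :: "'a::finite_dim_normed \<Rightarrow> 'b::real_normed_vector"
  assumes T: "open T" and hT: "h ` T \<subseteq> S" and f: "smooth_on S f" and h: "smooth_on T h" and u: "smooth_on T u"
  shows "smooth_on T (\<lambda>x. fd f (h x) (u x))"
proof (rule smooth_on_linear_family[OF T _ _ u])
  show "linear (fd f (h x))" if "x \<in> T" for x
    using that hT by (intro linear_fd smooth_on_differentiable[OF f]) blast
  show "smooth_on T (\<lambda>x. fd f (h x) v)" for v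
    by (rule smooth_on_compose[OF T hT h smooth_on_fd[OF f]])
qed

text \<open>A product rule obtained from the basis expansion: differentiability is assumed only at
  fixed vectors \<open>v\<close>, while the argument \<open>u y\<close> moves.\<close>

lemma has_derivative_linear_family:
  fixes A :: "'z::real_normed_vector \<Rightarrow> 'a::finite_dim_normed \<Rightarrow> 'b::real_normed_vector"
  assumes S: "open S" "p \<in> S" and lin: "\<And>y. y \<in> S \<Longrightarrow> linear (A y)"
    and A: "\<And>v. (\<lambda>y. A y v) differentiable (at p)" and u: "(u has_derivative u') (at p)"
  shows "((\<lambda>y. A y (u y)) has_derivative (\<lambda>w. fd (\<lambda>y. A y (u p)) p w + A p (u' w))) (at p)"
proof -
  note d = fd_has_derivative[OF A]
  have sum: "A y v = (\<Sum>b\<in>fbasis. crd b v *\<^sub>R A y b)" if "y \<in> S" for y v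
    by (rule linear_sum_crd[OF lin[OF that]])
  have cu: "((\<lambda>y. crd b (u y)) has_derivative (\<lambda>w. crd b (u' w))) (at p)" for b
    by (rule bounded_linear.has_derivative[OF bounded_linear_crd u])
  have "((\<lambda>y. \<Sum>b\<in>fbasis. crd b (u y) *\<^sub>R A y b) has_derivative
      (\<lambda>w. \<Sum>b\<in>fbasis. crd b (u p) *\<^sub>R fd (\<lambda>y. A y b) p w + crd b (u' w) *\<^sub>R A p b)) (at p)"
    by (intro has_derivative_sum has_derivative_scaleR cu d)
  moreover have "((\<lambda>y. \<Sum>b\<in>fbasis. crd b (u p) *\<^sub>R A y b) has_derivative
      (\<lambda>w. \<Sum>b\<in>fbasis. crd b (u p) *\<^sub>R fd (\<lambda>y. A y b) p w)) (at p)"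
    by (intro has_derivative_sum has_derivative_scaleR_right d)
  then have "((\<lambda>y. A y (u p)) has_derivative
      (\<lambda>w. \<Sum>b\<in>fbasis. crd b (u p) *\<^sub>R fd (\<lambda>y. A y b) p w)) (at p)"
    by (rule has_derivative_transform_within_open[OF _ S]) (simp add: sum[of _ "u p"])
  then have "fd (\<lambda>y. A y (u p)) p = (\<lambda>w. \<Sum>b\<in>fbasis. crd b (u p) *\<^sub>R fd (\<lambda>y. A y b) p w)"
    by (rule fd_eq)
  ultimately have "((\<lambda>y. \<Sum>b\<in>fbasis. crd b (u y) *\<^sub>R A y b) has_derivative
      (\<lambda>w. fd (\<lambda>y. A y (u p)) p w + A p (u' w))) (at p)"
    by (simp add: sum[OF S(2), of "u' _"] sum.distrib)
  then show ?thesis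
    by (rule has_derivative_transform_within_open[OF _ S]) (simp add: sum[of _ "u _"])
qed

lemma has_derivative_fd_apply:
  fixes f :: "'a::finite_dim_normed \<Rightarrow> 'b::real_normed_vector"
  assumes S: "open S" "p \<in> S" and f: "smooth_on S f" and u: "(u has_derivative u') (at p)"
  shows "((\<lambda>y. fd f y (u y)) has_derivative (\<lambda>w. fd (\<lambda>y. fd f y (u p)) p w + fd f p (u' w))) (at p)"
  by (rule has_derivative_linear_family[OF S linear_fd[OF smooth_on_differentiable[OF f]]
        smooth_on_differentiable[OF smooth_on_fd[OF f] S(2)] u])

subsection \<open>Symmetry of second derivatives\<close>

lemma has_real_derivative_line:
  fixes f :: "'a::real_normed_vector \<Rightarrow> real"
  assumes "f differentiable (at (p + s *\<^sub>R u))"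
  shows "((\<lambda>s. f (p + s *\<^sub>R u)) has_real_derivative fd f (p + s *\<^sub>R u) u) (at s)"
proof -
  have "((\<lambda>s. p + s *\<^sub>R u) has_derivative (\<lambda>s. s *\<^sub>R u)) (at s)"
    by (auto intro!: derivative_eq_intros)
  from has_derivative_compose[OF this fd_has_derivative[OF assms]]
  show ?thesis
    using linear_scale[OF linear_fd[OF assms]] by (simp add: has_field_derivative_def mult_commute_abs)
qed

text \<open>The mean value theorem is used twice: along \<open>u\<close> for the difference of
  \<open>f\<close> on two parallel segments, then along \<open>v\<close> for the directional
  derivative of \<open>f\<close> along \<open>u\<close>.\<close>

lemma second_difference:
  fixes f :: "'a::real_normed_vector \<Rightarrow> real"
  assumes f: "C_k_on 2 S f" and r: "ball x r \<subseteq> S" and h: "h > 0" "h * (norm u + norm v) < r"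
  shows "\<exists>y\<in>ball x r. f (x + h *\<^sub>R u + h *\<^sub>R v) - f (x + h *\<^sub>R u) - f (x + h *\<^sub>R v) + f x
           = h * h * fd (\<lambda>z. fd f z u) y v"
proof -
  have in_ball: "x + s *\<^sub>R u + t *\<^sub>R v \<in> ball x r" if "0 \<le> s" "s \<le> h" "0 \<le> t" "t \<le> h" for s t
  proof -
    have "norm (s *\<^sub>R u + t *\<^sub>R v) \<le> s * norm u + t * norm v"
      using norm_triangle_ineq[of "s *\<^sub>R u" "t *\<^sub>R v"] that by simp
    also have "\<dots> \<le> h * (norm u + norm v)"
      using that by (simp add: distrib_left add_mono mult_right_mono)
    finally have "norm (s *\<^sub>R u + t *\<^sub>R v) < r" using h by simp
    then show ?thesis by (simp add: dist_norm norm_minus_commute algebra_simps)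
  qed
  have df: "f differentiable (at y)" "(\<lambda>z. fd f z u) differentiable (at y)" if "y \<in> ball x r" for y
    using f r that by (auto simp: numeral_2_eq_2)
  let ?\<phi> = "\<lambda>s. f ((x + h *\<^sub>R v) + s *\<^sub>R u) - f (x + s *\<^sub>R u)"
  have "\<exists>s. 0 < s \<and> s < h \<and> ?\<phi> h - ?\<phi> 0 = (h - 0) * (fd f ((x + h *\<^sub>R v) + s *\<^sub>R u) u - fd f (x + s *\<^sub>R u) u)"
  proof (rule MVT2[OF h(1)])
    fix s assume s: "0 \<le> s" "s \<le> h"
    have "(x + h *\<^sub>R v) + s *\<^sub>R u \<in> ball x r" "x + s *\<^sub>R u \<in> ball x r"
      using in_ball[of s h] in_ball[of s 0] s h by (auto simp: add_ac)
    then show "(?\<phi> has_real_derivative fd f ((x + h *\<^sub>R v) + s *\<^sub>R u) u - fd f (x + s *\<^sub>R u) u) (at s)"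
      by (intro DERIV_diff has_real_derivative_line df)
  qed
  then obtain s where s: "0 < s" "s < h"
    and e1: "?\<phi> h - ?\<phi> 0 = h * (fd f ((x + h *\<^sub>R v) + s *\<^sub>R u) u - fd f (x + s *\<^sub>R u) u)" by auto
  let ?\<psi> = "\<lambda>t. fd f ((x + s *\<^sub>R u) + t *\<^sub>R v) u"
  have "\<exists>t. 0 < t \<and> t < h \<and> ?\<psi> h - ?\<psi> 0 = (h - 0) * fd (\<lambda>z. fd f z u) ((x + s *\<^sub>R u) + t *\<^sub>R v) v"
  proof (rule MVT2[OF h(1)])
    fix t assume t: "0 \<le> t" "t \<le> h"
    have "(x + s *\<^sub>R u) + t *\<^sub>R v \<in> ball x r"
      using in_ball[of s t] s t by auto
    then show "(?\<psi> has_real_derivative fd (\<lambda>z. fd f z u) ((x + s *\<^sub>R u) + t *\<^sub>R v) v) (at t)"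
      by (intro has_real_derivative_line df)
  qed
  then obtain t where t: "0 < t" "t < h"
    and e2: "?\<psi> h - ?\<psi> 0 = h * fd (\<lambda>z. fd f z u) ((x + s *\<^sub>R u) + t *\<^sub>R v) v" by auto
  have "f (x + h *\<^sub>R u + h *\<^sub>R v) - f (x + h *\<^sub>R u) - f (x + h *\<^sub>R v) + f x = ?\<phi> h - ?\<phi> 0"
    by (simp add: add_ac)
  also have "\<dots> = h * (?\<psi> h - ?\<psi> 0)"
    unfolding e1 by (simp add: add_ac)
  also have "\<dots> = h * h * fd (\<lambda>z. fd f z u) ((x + s *\<^sub>R u) + t *\<^sub>R v) v"
    unfolding e2 by simp
  finally show ?thesis
    using in_ball[of s t] s t by auto
qed

text \<open>The second difference is symmetric in \<open>u\<close> and \<open>v\<close>, so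
  arbitrarily near \<open>x\<close> the two mixed derivatives share a value, possibly at different
  points; continuity then excludes distinct values at \<open>x\<close>.\<close>

lemma second_derivative_symmetric_real:
  fixes f :: "'a::real_normed_vector \<Rightarrow> real"
  assumes S: "open S" "x \<in> S" and f: "C_k_on 2 S f"
  shows "fd (\<lambda>y. fd f y u) x v = fd (\<lambda>y. fd f y v) x u"
proof (rule ccontr)
  let ?A = "\<lambda>y. fd (\<lambda>z. fd f z u) y v" and ?B = "\<lambda>y. fd (\<lambda>z. fd f z v) y u"
  assume "?A x \<noteq> ?B x"
  then have e: "dist (?A x) (?B x) / 2 > 0" (is "?e > 0") by simp
  have "isCont ?A x" "isCont ?B x"
    using f S by (auto simp: numeral_2_eq_2 continuous_on_eq_continuous_at)
  then obtain r1 r2 where r12: "r1 > 0" "\<And>y. dist y x < r1 \<Longrightarrow> dist (?A y) (?A x) < ?e"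
      "r2 > 0" "\<And>y. dist y x < r2 \<Longrightarrow> dist (?B y) (?B x) < ?e"
    using e unfolding continuous_at_eps_delta by metis
  obtain r3 where r3: "r3 > 0" "ball x r3 \<subseteq> S" by (rule openE[OF S])
  define r where "r = min r1 (min r2 r3)"
  have r: "r > 0" "ball x r \<subseteq> S" using r12 r3 by (auto simp: r_def)
  \<comment> \<open>The denominator makes \<open>h * (norm u + norm v)\<close> smaller than
    \<open>r\<close>, also for \<open>u = v = 0\<close>.\<close>
  define h where "h = r / (norm u + norm v + 1)"
  have n: "norm u + norm v + 1 > 0" by (simp add: add_nonneg_pos)
  have h: "h > 0" using r n by (simp add: h_def)
  have hr: "h * (norm u + norm v) < r"
    using r n by (simp add: h_def field_simps)
  obtain y where y: "y \<in> ball x r" "f (x + h *\<^sub>R u + h *\<^sub>R v) - f (x + h *\<^sub>R u) - f (x + h *\<^sub>R v) + f x = h * h * ?A y"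
    using second_difference[OF f r(2) h hr] by blast
  obtain z where z: "z \<in> ball x r" "f (x + h *\<^sub>R v + h *\<^sub>R u) - f (x + h *\<^sub>R v) - f (x + h *\<^sub>R u) + f x = h * h * ?B z"
    using second_difference[OF f r(2) h, of v u] hr by (auto simp: add.commute)
  have "h * h * ?A y = h * h * ?B z"
    using y(2) z(2) by (simp add: algebra_simps)
  then have "?A y = ?B z" using h by simp
  moreover have "dist (?A y) (?A x) < ?e" "dist (?B z) (?B x) < ?e"
    using r12(2)[of y] r12(4)[of z] y(1) z(1) by (auto simp: r_def dist_commute)
  ultimately show False
    using dist_triangle2[of "?A x" "?B x" "?A y"] by (simp add: dist_commute)
qed

lemma second_derivative_symmetric:
  fixes f :: "'a::real_normed_vector \<Rightarrow> 'b::finite_dim_normed"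
  assumes S: "open S" "x \<in> S" and f: "smooth_on S f"
  shows "fd (\<lambda>y. fd f y u) x v = fd (\<lambda>y. fd f y v) x u"
proof -
  have c1: "fd (\<lambda>y. crd b (f y)) y w = crd b (fd f y w)" if "y \<in> S" for b y w
    using fd_eq[OF bounded_linear.has_derivative[OF bounded_linear_crd fd_has_derivative]]
      smooth_on_differentiable[OF f that] by fastforce
  have c2: "fd (\<lambda>y. fd (\<lambda>y. crd b (f y)) y w) x w' = crd b (fd (\<lambda>y. fd f y w) x w')" for b w w'
  proof -
    have "fd (\<lambda>y. fd (\<lambda>y. crd b (f y)) y w) x = fd (\<lambda>y. crd b (fd f y w)) x"
      by (rule fd_cong[OF S c1])
    also have "\<dots> = (\<lambda>w'. crd b (fd (\<lambda>y. fd f y w) x w'))"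
      by (intro fd_eq bounded_linear.has_derivative[OF bounded_linear_crd] fd_has_derivative
          smooth_on_differentiable[OF smooth_on_fd[OF f] S(2)])
    finally show ?thesis by simp
  qed
  have "C_k_on 2 S (\<lambda>y. crd b (f y))" for b
    using smooth_on_linear_compose[OF bounded_linear_crd S(1) f] unfolding smooth_on_def by blast
  then have "crd b (fd (\<lambda>y. fd f y u) x v) = crd b (fd (\<lambda>y. fd f y v) x u)" for b
    using second_derivative_symmetric_real[OF S, of "\<lambda>y. crd b (f y)" u v] unfolding c2 by blast
  then show ?thesis
    by (metis (no_types, lifting) sum.cong sum_crd)
qed

subsection \<open>Ordinary differential equations\<close>

lemma vector_derivative_bound:
  fixes f :: "real \<Rightarrow> 'b::real_normed_vector"
  assumes "convex S" "\<And>t. t \<in> S \<Longrightarrow> (f has_vector_derivative f' t) (at t within S)"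
    "\<And>t. t \<in> S \<Longrightarrow> norm (f' t) \<le> B" "s \<in> S" "t \<in> S"
  shows "norm (f s - f t) \<le> B * \<bar>s - t\<bar>"
proof -
  have "onorm (\<lambda>h. h *\<^sub>R f' t) \<le> B" if "t \<in> S" for t
  proof (rule onorm_bound)
    show "0 \<le> B" using assms(3)[OF that] norm_ge_zero order_trans by blast
    show "norm (h *\<^sub>R f' t) \<le> B * norm h" for h
      using mult_right_mono[OF assms(3)[OF that], of "\<bar>h\<bar>"] by (simp add: mult.commute)
  qed
  then show ?thesis
    using differentiable_bound[of S f "\<lambda>t h. h *\<^sub>R f' t" B s t] assms
    by (simp add: has_vector_derivative_def)
qed

text \<open>Near \<open>x0\<close> the norms of the finitely many derivatives along
  \<open>fbasis\<close> exceed those at \<open>x0\<close> by at most 1. This bounds the operator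
  norm on a ball, and the mean value inequality does the rest.\<close>

lemma smooth_on_lipschitz_ball:
  fixes f :: "'a::finite_dim_normed \<Rightarrow> 'b::real_normed_vector"
  assumes S: "open S" "x0 \<in> S" and f: "smooth_on S f"
  obtains r L where "r > 0" "L > 0" "cball x0 r \<subseteq> S"
    "\<And>x y. x \<in> cball x0 r \<Longrightarrow> y \<in> cball x0 r \<Longrightarrow> norm (f x - f y) \<le> L * norm (x - y)"
proof -
  have "eventually (\<lambda>x. norm (fd f x b) < norm (fd f x0 b) + 1) (at x0)" for b
  proof -
    have "isCont (\<lambda>x. fd f x b) x0"
      using smooth_on_continuous[OF smooth_on_fd[OF f]] S by (simp add: continuous_on_eq_continuous_at)
    then have "isCont (\<lambda>x. norm (fd f x b)) x0"
      by (rule isCont_norm)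
    then show ?thesis
      unfolding isCont_def by (rule order_tendstoD) simp
  qed
  then have "eventually (\<lambda>x. \<forall>b\<in>fbasis. norm (fd f x b) < norm (fd f x0 b) + 1) (at x0)"
    by (intro eventually_ball_finite) auto
  then obtain r1 where r1: "r1 > 0" "\<And>x b. x \<noteq> x0 \<Longrightarrow> dist x x0 < r1 \<Longrightarrow> b \<in> fbasis \<Longrightarrow> norm (fd f x b) < norm (fd f x0 b) + 1"
    unfolding eventually_at by blast
  obtain r2 where r2: "r2 > 0" "ball x0 r2 \<subseteq> S" by (rule openE[OF S])
  define r where "r = min r1 r2 / 2"
  have r: "r > 0" "r < r1" "r < r2" using r1 r2 by (auto simp: r_def min_def)
  obtain K where K: "\<And>b x. norm (crd (b::'a) x) \<le> norm x * K b" and K0: "\<And>b. K b \<ge> 0"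
    using bounded_linear.nonneg_bounded[OF bounded_linear_crd] by metis
  \<comment> \<open>The added 1 makes \<open>L\<close> positive even when the basis is
    empty.\<close>
  define L where "L = (\<Sum>b\<in>fbasis. K b * (norm (fd f x0 b) + 1)) + 1"
  have sub: "cball x0 r \<subseteq> S" using r r2 by auto
  have Lnn: "L > 0" unfolding L_def by (intro add_nonneg_pos sum_nonneg) (simp_all add: K0)
  have on: "onorm (fd f x) \<le> L" if x: "x \<in> cball x0 r" for x
  proof (rule onorm_bound)
    fix v
    have le: "norm (fd f x b) \<le> norm (fd f x0 b) + 1" if "b \<in> fbasis" for b
      using r1(2)[of x b] x r that by (cases "x = x0") (auto simp: dist_commute)
    have "norm (fd f x v) = norm (\<Sum>b\<in>fbasis. crd b v *\<^sub>R fd f x b)"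
      using linear_sum_crd[OF linear_fd[OF smooth_on_differentiable[OF f]], of x v] x sub by auto
    also have "\<dots> \<le> (\<Sum>b\<in>fbasis. (norm v * K b) * (norm (fd f x0 b) + 1))"
      by (intro sum_norm_le) (simp, intro mult_mono, use K le K0 in auto)
    also have "\<dots> = norm v * (L - 1)"
      by (simp add: L_def sum_distrib_left mult.assoc)
    also have "\<dots> \<le> L * norm v"
      by (simp add: algebra_simps)
    finally show "norm (fd f x v) \<le> L * norm v" .
  qed (use Lnn in simp)
  show ?thesis
  proof
    fix x y assume xy: "x \<in> cball x0 r" "y \<in> cball x0 r"
    show "norm (f x - f y) \<le> L * norm (x - y)"
      by (rule differentiable_bound[OF convex_cball _ on xy])
        (use sub in \<open>auto intro!: has_derivative_at_withinI fd_has_derivative smooth_on_differentiable[OF f]\<close>)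
  qed (use r Lnn sub in auto)
qed

text \<open>The largest deviation on the interval is at most \<open>L * d\<close> times itself,
  hence zero; the short interval replaces a Gronwall estimate.\<close>

lemma ode_unique:
  fixes f :: "'a::real_normed_vector \<Rightarrow> 'a"
  assumes lip: "\<And>x y. x \<in> B \<Longrightarrow> y \<in> B \<Longrightarrow> norm (f x - f y) \<le> L * norm (x - y)"
    and L: "0 \<le> L" and d: "0 \<le> d" "L * d < 1"
    and y: "\<And>t. t \<in> {-d..d} \<Longrightarrow> y t \<in> B" "\<And>t. t \<in> {-d..d} \<Longrightarrow> (y has_vector_derivative f (y t)) (at t within {-d..d})"
    and z: "\<And>t. t \<in> {-d..d} \<Longrightarrow> z t \<in> B" "\<And>t. t \<in> {-d..d} \<Longrightarrow> (z has_vector_derivative f (z t)) (at t within {-d..d})"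
    and eq: "y 0 = z 0" and t: "t \<in> {-d..d}"
  shows "y t = z t"
proof -
  let ?u = "\<lambda>t. y t - z t"
  have du: "(?u has_vector_derivative (f (y t) - f (z t))) (at t within {-d..d})" if "t \<in> {-d..d}" for t
    by (intro has_vector_derivative_diff y z that)
  have "continuous_on {-d..d} (\<lambda>t. norm (?u t))"
    by (intro continuous_on_norm) (use du has_vector_derivative_continuous continuous_on_eq_continuous_within in blast)
  then obtain s where s: "s \<in> {-d..d}" "\<And>t. t \<in> {-d..d} \<Longrightarrow> norm (?u t) \<le> norm (?u s)"
    using continuous_attains_sup[of "{-d..d}" "\<lambda>t. norm (?u t)"] d by auto
  have "norm (?u s - ?u 0) \<le> (L * norm (?u s)) * \<bar>s - 0\<bar>"
  proof (rule vector_derivative_bound[OF _ du])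
    fix t assume t: "t \<in> {-d..d}"
    show "norm (f (y t) - f (z t)) \<le> L * norm (?u s)"
      using order_trans[OF lip[OF y(1)[OF t] z(1)[OF t]] mult_left_mono[OF s(2)[OF t] L]] .
  qed (use s d in auto)
  also have "\<dots> \<le> (L * norm (?u s)) * d"
    by (intro mult_left_mono) (use s L in auto)
  finally have "norm (?u s) \<le> (L * d) * norm (?u s)" using eq by (simp add: mult_ac)
  then have "norm (?u s) \<le> 0"
    using mult_strict_right_mono[OF d(2), of "norm (?u s)"] by linarith
  then show ?thesis using s(2)[OF t] by simp
qed

text \<open>Picard iteration is a contraction on the closed set \<open>X\<close> of bounded
  continuous functions with values in the ball.\<close>

lemma ode_exists:
  fixes f :: "'a::banach \<Rightarrow> 'a"
  assumes r: "r > 0" and L: "L > 0"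
    and lip: "\<And>x y. x \<in> cball x0 r \<Longrightarrow> y \<in> cball x0 r \<Longrightarrow> norm (f x - f y) \<le> L * norm (x - y)"
  obtains d y where "d > 0" "y 0 = x0" "\<And>t. t \<in> {-d<..<d} \<Longrightarrow> y t \<in> cball x0 r"
    "\<And>t. t \<in> {-d<..<d} \<Longrightarrow> (y has_vector_derivative f (y t)) (at t)"
proof -
  define M where "M = norm (f x0) + L * r"
  have M: "norm (f x) \<le> M" if "x \<in> cball x0 r" for x
  proof -
    have "norm (f x) \<le> norm (f x0) + norm (f x - f x0)"
      using norm_triangle_sub by blast
    also have "\<dots> \<le> norm (f x0) + L * norm (x - x0)"
      using lip[OF that, of x0] r by simp
    also have "\<dots> \<le> M"
      using that L unfolding M_def by (auto intro!: mult_left_mono simp: dist_norm norm_minus_commute)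
    finally show ?thesis .
  qed
  have Mpos: "M > 0" using r L by (simp add: M_def add_nonneg_pos)
  \<comment> \<open>\<open>r / M\<close> keeps the iterates in the ball, as \<open>M\<close> bounds
    the speed; \<open>1 / (2 * L)\<close> makes the iteration contract by the factor 1/2.\<close>
  define d where "d = min (r / M) (1 / (2 * L))"
  have d: "d > 0" "M * d \<le> r" "L * d \<le> 1 / 2"
    using r L Mpos by (auto simp: d_def min_def field_simps)
  \<comment> \<open>Clamping time to \<open>{-d..d}\<close> extends the iterates to the whole line,
    where bounded continuous functions form a complete space.\<close>
  define c where "c t = max (- d) (min d t)" for t :: real
  have c: "c t \<in> {-d..d}" "\<bar>c t\<bar> \<le> d" for t using d by (auto simp: c_def)
  have c_id: "c t = t" if "t \<in> {-d..d}" for t using that by (auto simp: c_def)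
  have cc: "continuous_on UNIV c" unfolding c_def[abs_def] by (intro continuous_intros)
  define X where "X = PiC UNIV (\<lambda>_::real. cball x0 r)"
  have X: "y \<in> X \<longleftrightarrow> (\<forall>t. apply_bcontfun y t \<in> cball x0 r)" for y
    by (auto simp: X_def mem_PiC_iff)
  \<comment> \<open>The integral starts at the left end, so that one formula serves both signs of
    \<open>s\<close>; \<open>P\<close> subtracts the value at 0.\<close>
  define G where "G y s = integral {-d..s} (\<lambda>t. f (apply_bcontfun y t))" for y s
  have contf: "continuous_on (cball x0 r) f"
    by (rule lipschitz_on_continuous_on[of L]) (use lip L in \<open>auto simp: lipschitz_on_def dist_norm\<close>)
  have dG: "(G y has_vector_derivative f (apply_bcontfun y s)) (at s within {-d..d})"
    if "y \<in> X" "s \<in> {-d..d}" for y s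
    unfolding G_def[abs_def]
    by (rule integral_has_vector_derivative[OF _ that(2)])
      (rule continuous_on_compose2[OF contf], use that X in \<open>auto intro!: continuous_intros\<close>)
  have contG: "continuous_on {-d..d} (G y)" if "y \<in> X" for y
    using dG[OF that] has_vector_derivative_continuous continuous_on_eq_continuous_within by blast
  define P where "P y t = x0 + (G y (c t) - G y 0)" for y t
  have Pball: "P y t \<in> cball x0 r" if "y \<in> X" for y t
  proof -
    have "norm (G y (c t) - G y 0) \<le> M * \<bar>c t - 0\<bar>"
      by (rule vector_derivative_bound[OF _ dG[OF that]]) (use that X M c d in auto)
    also have "\<dots> \<le> M * d"
      using c(2)[of t] Mpos by simp
    finally show ?thesis using d by (simp add: P_def dist_norm norm_minus_commute)
  qed
  have Pcont: "P y \<in> bcontfun" if "y \<in> X" for y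
  proof (rule bcontfun_normI)
    have Gc: "continuous_on UNIV (\<lambda>t. G y (c t))"
      by (rule continuous_on_compose2[OF contG[OF that] cc]) (use c in blast)
    show "continuous_on UNIV (P y)"
      unfolding P_def[abs_def]
      by (intro continuous_on_add continuous_on_diff continuous_on_const Gc)
    show "norm (P y t) \<le> norm x0 + r" for t
      using Pball[OF that, of t] norm_triangle_sub[of "P y t" x0] by (simp add: dist_norm norm_minus_commute)
  qed
  define Q where "Q y = Bcontfun (P y)" for y
  have Q: "apply_bcontfun (Q y) = P y" if "y \<in> X" for y
    unfolding Q_def using Bcontfun_inverse[OF Pcont[OF that]] .
  have "\<exists>!y\<in>X. Q y = y"
  proof (rule Banach_fix)
    show "complete X"
      unfolding X_def complete_eq_closed by (intro closed_PiC) auto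
    have "const_bcontfun x0 \<in> X" using r by (simp add: X)
    then show "X \<noteq> {}" by blast
    show "Q ` X \<subseteq> X" using Q Pball by (auto simp: X)
    show "(0::real) \<le> 1 / 2" "1 / 2 < (1::real)" by auto
    fix y z assume yz: "y \<in> X" "z \<in> X"
    show "dist (Q y) (Q z) \<le> 1 / 2 * dist y z"
    proof (rule dist_bound)
      fix t
      have "norm ((G y (c t) - G z (c t)) - (G y 0 - G z 0)) \<le> (L * dist y z) * \<bar>c t - 0\<bar>"
      proof (rule vector_derivative_bound[of "{-d..d}" "\<lambda>s. G y s - G z s"])
        fix s assume s: "s \<in> {-d..d}"
        show "((\<lambda>s. G y s - G z s) has_vector_derivative f (apply_bcontfun y s) - f (apply_bcontfun z s)) (at s within {-d..d})"
          by (intro has_vector_derivative_diff dG yz s)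
        have "norm (f (apply_bcontfun y s) - f (apply_bcontfun z s)) \<le> L * norm (apply_bcontfun y s - apply_bcontfun z s)"
          by (rule lip) (use yz X in auto)
        also have "\<dots> \<le> L * dist y z"
          using dist_bounded[of y s z] L by (simp add: dist_norm)
        finally show "norm (f (apply_bcontfun y s) - f (apply_bcontfun z s)) \<le> L * dist y z" .
      qed (use c d in auto)
      also have "\<dots> \<le> (L * dist y z) * d"
        using c(2)[of t] L by (intro mult_left_mono) auto
      also have "\<dots> = (L * d) * dist y z" by simp
      also have "\<dots> \<le> 1 / 2 * dist y z"
        by (rule mult_right_mono[OF d(3)]) simp
      finally show "dist (apply_bcontfun (Q y) t) (apply_bcontfun (Q z) t) \<le> 1 / 2 * dist y z"
        using Q yz by (simp add: P_def dist_norm algebra_simps)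
    qed
  qed
  then obtain y where y: "y \<in> X" "Q y = y" by blast
  then have yP: "apply_bcontfun y t = P y t" for t using Q by metis
  show ?thesis
  proof
    show "d > 0" by (fact d)
    show "apply_bcontfun y 0 = x0" using yP[of 0] c_id[of 0] d by (simp add: P_def)
    fix t assume t: "t \<in> {-d<..<d}"
    show "apply_bcontfun y t \<in> cball x0 r" using y X by blast
    have t': "t \<in> interior {-d..d}" using t by simp
    have "(G y has_vector_derivative f (apply_bcontfun y t)) (at t)"
      using dG[OF y(1), of t] t at_within_interior[OF t'] by simp
    then have "((\<lambda>t. x0 + (G y t - G y 0)) has_vector_derivative f (apply_bcontfun y t)) (at t)"
      by (auto intro!: derivative_eq_intros)
    then show "(apply_bcontfun y has_vector_derivative f (apply_bcontfun y t)) (at t)"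
      unfolding has_vector_derivative_def
      by (rule has_derivative_transform_within_open[of _ _ _ _ "{-d<..<d}"])
        (use t yP c_id in \<open>auto simp: P_def\<close>)
  qed
qed

text \<open>Bootstrapping: if \<open>y\<close> is of class k, so is its derivative
  \<open>f (y t)\<close>, and \<open>y\<close> gains one order.\<close>

lemma ode_solution_smooth:
  fixes f :: "'a::finite_dim_normed \<Rightarrow> 'a"
  assumes f: "smooth_on S f" and I: "open I" and y: "\<And>t. t \<in> I \<Longrightarrow> y t \<in> S"
    "\<And>t. t \<in> I \<Longrightarrow> (y has_vector_derivative f (y t)) (at t)"
  shows "smooth_on I y"
  unfolding smooth_on_def
proof
  fix k
  show "C_k_on k I y"
  proof (induction k)
    case 0
    show ?case
      using has_vector_derivative_continuous[OF y(2)] by (auto intro: continuous_at_imp_continuous_on)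
  next
    case (Suc k)
    have "C_k_on k I (\<lambda>t. f (y t))"
      by (rule C_k_on_compose[OF I _ Suc, of S]) (use y f in \<open>auto simp: smooth_on_def\<close>)
    then have **: "C_k_on k I (\<lambda>t. v *\<^sub>R f (y t))" for v
      by (rule C_k_on_linear_compose[OF bounded_linear_scaleR_right I])
    have *: "fd y t = (\<lambda>v. v *\<^sub>R f (y t))" if "t \<in> I" for t
      using y(2)[OF that] fd_eq unfolding has_vector_derivative_def by blast
    have "C_k_on k I (\<lambda>t. fd y t v)" for v
      by (rule C_k_on_cong[OF I _ **[of v]]) (simp add: *)
    moreover have "y differentiable (at t)" if "t \<in> I" for t
      using y(2)[OF that] unfolding has_vector_derivative_def differentiable_def by blast
    ultimately show ?case by simp
  qed
qed

section \<open>Smooth maps between manifolds\<close>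

abbreviation chart_ran :: "('m, 'e) atlas \<Rightarrow> 'm \<Rightarrow> 'e set" where
  "chart_ran c p \<equiv> chart_map c p ` chart_dom c p"

lemma
  assumes "smooth_manifold c"
  shows chart_mem: "p \<in> chart_dom c p"
    and open_chart_dom: "open (chart_dom c p)"
    and open_chart_ran: "open (chart_ran c p)"
    and chart_homeomorphism: "homeomorphism (chart_dom c p) (chart_ran c p) (chart_map c p) (chart_inv c p)"
    and chart_transition: "smooth_on (chart_map c p ` (chart_dom c p \<inter> chart_dom c q)) (chart_map c q \<circ> chart_inv c p)"
  using assms unfolding smooth_manifold_def by blast+

lemma
  assumes "smooth_manifold c"
  shows chart_inv_map: "x \<in> chart_dom c p \<Longrightarrow> chart_inv c p (chart_map c p x) = x"
    and chart_map_inv: "z \<in> chart_ran c p \<Longrightarrow> chart_map c p (chart_inv c p z) = z"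
    and chart_inv_dom: "z \<in> chart_ran c p \<Longrightarrow> chart_inv c p z \<in> chart_dom c p"
    and continuous_chart_map: "continuous_on (chart_dom c p) (chart_map c p)"
    and continuous_chart_inv: "continuous_on (chart_ran c p) (chart_inv c p)"
  using chart_homeomorphism[OF assms, of p] unfolding homeomorphism_def by auto

lemma chart_image_Int:
  assumes "smooth_manifold c"
  shows "chart_map c p ` (chart_dom c p \<inter> A) = {z \<in> chart_ran c p. chart_inv c p z \<in> A}"
proof safe
  fix x assume x: "x \<in> chart_dom c p" "x \<in> A"
  then show "chart_inv c p (chart_map c p x) \<in> A"
    by (simp add: chart_inv_map[OF assms])
next
  fix x assume x: "x \<in> chart_dom c p" "chart_inv c p (chart_map c p x) \<in> A"
  then show "chart_map c p x \<in> chart_map c p ` (chart_dom c p \<inter> A)"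
    by (simp add: chart_inv_map[OF assms])
qed auto

lemma open_chart_image:
  assumes "smooth_manifold c" "open A"
  shows "open {z \<in> chart_ran c p. chart_inv c p z \<in> A}"
  using continuous_open_preimage[OF continuous_chart_inv[OF assms(1)] open_chart_ran[OF assms(1)] assms(2), of p]
  by (simp add: vimage_def Int_def)

lemma smooth_mapD:
  assumes "smooth_map c d f" "smooth_manifold c"
  shows "continuous_on UNIV f"
    and "smooth_on {z \<in> chart_ran c p. f (chart_inv c p z) \<in> chart_dom d q} (\<lambda>z. chart_map d q (f (chart_inv c p z)))"
proof -
  show "continuous_on UNIV f" using assms(1) unfolding smooth_map_def by blast
  have "smooth_on (chart_map c p ` (chart_dom c p \<inter> f -` chart_dom d q)) (chart_map d q \<circ> f \<circ> chart_inv c p)"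
    using assms(1) unfolding smooth_map_def by blast
  then show "smooth_on {z \<in> chart_ran c p. f (chart_inv c p z) \<in> chart_dom d q} (\<lambda>z. chart_map d q (f (chart_inv c p z)))"
    unfolding chart_image_Int[OF assms(2)] by (simp add: o_def)
qed

lemma smooth_map_open_chart:
  assumes "smooth_map c d f" "smooth_manifold c" "smooth_manifold d"
  shows "open {z \<in> chart_ran c p. f (chart_inv c p z) \<in> chart_dom d q}"
  using open_chart_image[OF assms(2) open_vimage[OF open_chart_dom[OF assms(3)] smooth_mapD(1)[OF assms(1,2)]]]
  by simp

text \<open>One pair of charts around each point is enough, because any other pair differs from it
  by smooth transition maps. Continuity, a separate part of \<open>smooth_map\<close>, is recovered
  from continuity of the coordinate expressions.\<close>

lemma smooth_map_local:
  fixes c :: "('m::topological_space, 'e::finite_dim_normed) atlas"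
    and d :: "('n::topological_space, 'f::finite_dim_normed) atlas"
  assumes c: "smooth_manifold c" and d: "smooth_manifold d"
    and loc: "\<And>x. \<exists>p q W. x \<in> chart_dom c p \<and> open W \<and> chart_map c p x \<in> W \<and> W \<subseteq> chart_ran c p \<and>
        (\<forall>z\<in>W. f (chart_inv c p z) \<in> chart_dom d q) \<and>
        smooth_on W (\<lambda>z. chart_map d q (f (chart_inv c p z)))"
  shows "smooth_map c d f"
proof -
  have cont: "continuous_on UNIV f"
  proof -
    have "\<exists>N. open N \<and> x \<in> N \<and> continuous_on N f" for x
    proof -
    obtain p q W where W: "x \<in> chart_dom c p" "open W" "chart_map c p x \<in> W" "W \<subseteq> chart_ran c p"
        "\<forall>z\<in>W. f (chart_inv c p z) \<in> chart_dom d q"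
        "smooth_on W (\<lambda>z. chart_map d q (f (chart_inv c p z)))"
      using loc by blast
    define N where "N = chart_dom c p \<inter> chart_map c p -` W"
    have N: "open N" "x \<in> N"
      using continuous_open_preimage[OF continuous_chart_map[OF c] open_chart_dom[OF c] W(2)] W by (auto simp: N_def)
    have 1: "continuous_on N (\<lambda>x. chart_map d q (f (chart_inv c p (chart_map c p x))))"
      by (rule continuous_on_compose2[OF smooth_on_continuous[OF W(6)] continuous_on_subset[OF continuous_chart_map[OF c]]])
        (auto simp: N_def)
    have "continuous_on N (\<lambda>x. chart_inv d q (chart_map d q (f (chart_inv c p (chart_map c p x)))))"
      by (rule continuous_on_compose2[OF continuous_chart_inv[OF d] 1]) (use W in \<open>auto simp: N_def\<close>)
    then have "continuous_on N f"
    proof (rule continuous_on_eq)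
      fix y assume "y \<in> N"
      then have "chart_inv c p (chart_map c p y) = y" "f (chart_inv c p (chart_map c p y)) \<in> chart_dom d q"
        using W chart_inv_map[OF c] by (auto simp: N_def)
      then show "chart_inv d q (chart_map d q (f (chart_inv c p (chart_map c p y)))) = f y"
        using chart_inv_map[OF d] by simp
    qed
    then show ?thesis using N by blast
    qed
    then obtain N where N: "\<And>x. open (N x)" "\<And>x. x \<in> N x" "\<And>x. continuous_on (N x) f" by metis
    have "continuous_on (\<Union>x. N x) f"
      by (rule continuous_on_open_UN) (use N in auto)
    moreover have "(\<Union>x. N x) = UNIV" using N(2) by blast
    ultimately show ?thesis by simp
  qed
  moreover have "smooth_on (chart_map c p' ` (chart_dom c p' \<inter> f -` chart_dom d q')) (chart_map d q' \<circ> f \<circ> chart_inv c p')"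
    (is "smooth_on ?S ?F") for p' q'
  proof (rule smooth_on_local)
    fix z assume z: "z \<in> ?S"
    define x where "x = chart_inv c p' z"
    have x: "x \<in> chart_dom c p'" "f x \<in> chart_dom d q'" "chart_map c p' x = z"
      using z chart_inv_map[OF c] by (auto simp: x_def)
    obtain p q W where W: "x \<in> chart_dom c p" "open W" "chart_map c p x \<in> W" "W \<subseteq> chart_ran c p"
        "\<forall>z\<in>W. f (chart_inv c p z) \<in> chart_dom d q"
        "smooth_on W (\<lambda>z. chart_map d q (f (chart_inv c p z)))"
      using loc by blast
    \<comment> \<open>On \<open>A\<close> all the charts involved are defined, so transition maps
      can be inserted on both sides.\<close>
    define A where "A = (chart_dom c p \<inter> chart_map c p -` W) \<inter> f -` chart_dom d q'"
    have A: "open A"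
      unfolding A_def using continuous_open_preimage[OF continuous_chart_map[OF c] open_chart_dom[OF c] W(2)]
        open_vimage[OF open_chart_dom[OF d] cont] by blast
    define N where "N = {z \<in> chart_ran c p'. chart_inv c p' z \<in> A}"
    have N: "open N" unfolding N_def by (rule open_chart_image[OF c A])
    have xA: "x \<in> A" using W x by (simp add: A_def)
    have zN: "z \<in> N"
      unfolding N_def using x xA chart_inv_map[OF c x(1)] by auto
    have t1: "smooth_on N (\<lambda>w. chart_map c p (chart_inv c p' w))"
      using smooth_on_subset[OF chart_transition[OF c, of p' p], of N]
      unfolding chart_image_Int[OF c] by (auto simp: N_def A_def o_def)
    have inW: "chart_map c p (chart_inv c p' w) \<in> W" if "w \<in> N" for w
      using that by (simp add: N_def A_def)
    have t2: "smooth_on N (\<lambda>w. chart_map d q (f (chart_inv c p (chart_map c p (chart_inv c p' w)))))"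
      by (rule smooth_on_compose[OF N _ t1 W(6)]) (use inW in auto)
    have fq: "f (chart_inv c p (chart_map c p (chart_inv c p' w))) = f (chart_inv c p' w)"
       "f (chart_inv c p' w) \<in> chart_dom d q" "f (chart_inv c p' w) \<in> chart_dom d q'" if "w \<in> N" for w
      using that W(5) inW[OF that] chart_inv_map[OF c, of "chart_inv c p' w" p] by (auto simp: N_def A_def)
    have t3: "smooth_on N (\<lambda>w. (chart_map d q' \<circ> chart_inv d q)
        (chart_map d q (f (chart_inv c p (chart_map c p (chart_inv c p' w))))))"
      by (rule smooth_on_compose[OF N _ t2 chart_transition[OF d, of q q']]) (use fq in auto)
    have "smooth_on N ?F"
      by (rule smooth_on_cong[OF N _ t3]) (use fq chart_inv_map[OF d] in auto)
    then show "\<exists>N. open N \<and> z \<in> N \<and> smooth_on N ?F"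
      using N zN by blast
  qed
  ultimately show ?thesis unfolding smooth_map_def by blast
qed

lemma smooth_map_compose:
  fixes c :: "('m::topological_space, 'e::finite_dim_normed) atlas"
    and d :: "('n::topological_space, 'f::finite_dim_normed) atlas"
    and e :: "('o::topological_space, 'h::finite_dim_normed) atlas"
  assumes c: "smooth_manifold c" and d: "smooth_manifold d" and e: "smooth_manifold e"
    and f: "smooth_map c d f" and g: "smooth_map d e g"
  shows "smooth_map c e (\<lambda>x. g (f x))"
proof (rule smooth_map_local[OF c e])
  fix x
  let ?r = "f x" and ?q = "g (f x)"
  define A where "A = f -` (chart_dom d ?r \<inter> g -` chart_dom e ?q)"
  have A: "open A" unfolding A_def
    by (intro open_vimage open_Int open_chart_dom[OF d] open_chart_dom[OF e] smooth_mapD(1)[OF f c] smooth_mapD(1)[OF g d])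
  define W where "W = {z \<in> chart_ran c x. chart_inv c x z \<in> A}"
  have W: "open W" unfolding W_def by (rule open_chart_image[OF c A])
  have t1: "smooth_on W (\<lambda>z. chart_map d ?r (f (chart_inv c x z)))"
    by (rule smooth_on_subset[OF smooth_mapD(2)[OF f c]]) (auto simp: W_def A_def)
  have t2: "smooth_on W (\<lambda>z. chart_map e ?q (g (chart_inv d ?r (chart_map d ?r (f (chart_inv c x z))))))"
    by (rule smooth_on_compose[OF W _ t1 smooth_mapD(2)[OF g d]])
      (auto simp: W_def A_def chart_inv_map[OF d])
  have "smooth_on W (\<lambda>z. chart_map e ?q (g (f (chart_inv c x z))))"
    by (rule smooth_on_cong[OF W _ t2]) (auto simp: W_def A_def chart_inv_map[OF d])
  moreover have "chart_map c x x \<in> W"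
    using chart_mem[OF c] chart_mem[OF d] chart_mem[OF e] by (auto simp: W_def A_def chart_inv_map[OF c])
  ultimately show "\<exists>p q W. x \<in> chart_dom c p \<and> open W \<and> chart_map c p x \<in> W \<and> W \<subseteq> chart_ran c p \<and>
        (\<forall>z\<in>W. g (f (chart_inv c p z)) \<in> chart_dom e q) \<and>
        smooth_on W (\<lambda>z. chart_map e q (g (f (chart_inv c p z))))"
    using W chart_mem[OF c] by (intro exI[of _ x] exI[of _ ?q] exI[of _ W]) (auto simp: W_def A_def)
qed

subsection \<open>Vector spaces and products\<close>

lemma vector_atlas_simps [simp]:
  "chart_dom vector_atlas p = UNIV" "chart_map vector_atlas p = (\<lambda>v. v)" "chart_inv vector_atlas p = (\<lambda>v. v)"
  by (auto simp: vector_atlas_def chart_inv_def inv_into_def)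

lemma smooth_manifold_vector_atlas: "smooth_manifold (vector_atlas :: ('v::finite_dim_normed, 'v) atlas)"
  unfolding smooth_manifold_def
  using smooth_on_linear[OF bounded_linear_ident]
  by (auto simp: homeomorphism_def second_countable_finite_dim o_def)

lemma
  shows chart_dom_prod [simp]: "chart_dom (prod_atlas c d) (p, q) = chart_dom c p \<times> chart_dom d q"
    and chart_map_prod [simp]: "chart_map (prod_atlas c d) (p, q) = map_prod (chart_map c p) (chart_map d q)"
  by (simp_all add: prod_atlas_def)

lemma chart_ran_prod [simp]: "chart_ran (prod_atlas c d) (p, q) = chart_ran c p \<times> chart_ran d q"
  by (simp add: map_prod_surj_on)

lemma chart_inv_prod [simp]:
  assumes "smooth_manifold c" "smooth_manifold d" "z \<in> chart_ran c p" "w \<in> chart_ran d q"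
  shows "chart_inv (prod_atlas c d) (p, q) (z, w) = (chart_inv c p z, chart_inv d q w)"
proof -
  have "inj_on (map_prod (chart_map c p) (chart_map d q)) (chart_dom c p \<times> chart_dom d q)"
    by (rule inj_on_inverseI[where g = "map_prod (chart_inv c p) (chart_inv d q)"])
      (auto simp: chart_inv_map[OF assms(1)] chart_inv_map[OF assms(2)])
  moreover have "(chart_inv c p z, chart_inv d q w) \<in> chart_dom c p \<times> chart_dom d q"
    by (intro SigmaI chart_inv_dom[OF assms(1,3)] chart_inv_dom[OF assms(2,4)])
  ultimately have "inv_into (chart_dom c p \<times> chart_dom d q) (map_prod (chart_map c p) (chart_map d q))
      (map_prod (chart_map c p) (chart_map d q) (chart_inv c p z, chart_inv d q w)) = (chart_inv c p z, chart_inv d q w)"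
    by (rule inv_into_f_f)
  then show ?thesis
    unfolding map_prod_simp chart_map_inv[OF assms(1,3)] chart_map_inv[OF assms(2,4)]
    by (simp only: chart_inv_def[of "prod_atlas c d"] chart_dom_prod chart_map_prod)
qed

lemma second_countable_Times:
  assumes "second_countable (euclidean :: 'a::topological_space topology)"
    and "second_countable (euclidean :: 'b::topological_space topology)"
  shows "second_countable (euclidean :: ('a \<times> 'b) topology)"
proof -
  obtain A :: "'a set set" where A: "countable A" "\<And>V. V \<in> A \<Longrightarrow> open V"
      "\<And>U x. open U \<Longrightarrow> x \<in> U \<Longrightarrow> \<exists>V\<in>A. x \<in> V \<and> V \<subseteq> U"
    using assms(1) unfolding second_countable_def by auto
  obtain B :: "'b set set" where B: "countable B" "\<And>V. V \<in> B \<Longrightarrow> open V"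
      "\<And>U x. open U \<Longrightarrow> x \<in> U \<Longrightarrow> \<exists>V\<in>B. x \<in> V \<and> V \<subseteq> U"
    using assms(2) unfolding second_countable_def by auto
  let ?C = "(\<lambda>(V, W). V \<times> W) ` (A \<times> B)"
  have "\<exists>V\<in>?C. x \<in> V \<and> V \<subseteq> U" if U: "open U" "x \<in> U" for U :: "('a \<times> 'b) set" and x
  proof -
    obtain S T where ST: "open S" "open T" "x \<in> S \<times> T" "S \<times> T \<subseteq> U"
      using open_prod_elim[OF U] by blast
    obtain V W where "V \<in> A" "fst x \<in> V" "V \<subseteq> S" "W \<in> B" "snd x \<in> W" "W \<subseteq> T"
      using A(3)[OF ST(1), of "fst x"] B(3)[OF ST(2), of "snd x"] ST(3) by (auto simp: mem_Times_iff)
    with ST(4) show ?thesis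
      by (intro bexI[of _ "V \<times> W"]) (auto simp: mem_Times_iff)
  qed
  moreover have "countable ?C" using A(1) B(1) by simp
  moreover have "\<forall>V\<in>?C. open V" using A(2) B(2) by (auto intro: open_Times)
  ultimately show ?thesis
    unfolding second_countable_def by (intro exI[of _ ?C]) auto
qed

lemma smooth_manifold_prod:
  fixes c :: "('m::topological_space, 'e::finite_dim_normed) atlas"
    and d :: "('n::topological_space, 'f::finite_dim_normed) atlas"
  assumes c: "smooth_manifold c" and d: "smooth_manifold d"
  shows "smooth_manifold (prod_atlas c d)"
proof -
  have "Hausdorff_space (euclidean :: 'm topology)" "Hausdorff_space (euclidean :: 'n topology)"
    "second_countable (euclidean :: 'm topology)" "second_countable (euclidean :: 'n topology)"
    using c d unfolding smooth_manifold_def by blast+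
  then have top: "Hausdorff_space (euclidean :: ('m \<times> 'n) topology)"
    "second_countable (euclidean :: ('m \<times> 'n) topology)"
    using Hausdorff_space_prod_topology[of "euclidean :: 'm topology" "euclidean :: 'n topology"]
    by (simp_all add: second_countable_Times)
  have hom: "homeomorphism (chart_dom c p \<times> chart_dom d q) (chart_ran c p \<times> chart_ran d q)
      (map_prod (chart_map c p) (chart_map d q)) (chart_inv (prod_atlas c d) (p, q))" for p q
  proof -
    have inv: "chart_inv (prod_atlas c d) (p, q) zw = (chart_inv c p (fst zw), chart_inv d q (snd zw))"
      if "zw \<in> chart_ran c p \<times> chart_ran d q" for zw
      using that by (cases zw) (auto simp: chart_inv_prod[OF c d])
    have 1: "continuous_on (chart_dom c p \<times> chart_dom d q) (map_prod (chart_map c p) (chart_map d q))"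
      unfolding map_prod_def case_prod_beta
      by (intro continuous_on_Pair continuous_on_compose2[OF continuous_chart_map[OF c]]
          continuous_on_compose2[OF continuous_chart_map[OF d]] continuous_on_fst continuous_on_snd continuous_on_id) auto
    have "continuous_on (chart_ran c p \<times> chart_ran d q) (\<lambda>zw. (chart_inv c p (fst zw), chart_inv d q (snd zw)))"
      by (intro continuous_on_Pair continuous_on_compose2[OF continuous_chart_inv[OF c]]
          continuous_on_compose2[OF continuous_chart_inv[OF d]] continuous_on_fst continuous_on_snd continuous_on_id) auto
    then have 2: "continuous_on (chart_ran c p \<times> chart_ran d q) (chart_inv (prod_atlas c d) (p, q))"
      by (rule continuous_on_eq) (simp add: inv)
    show ?thesis
    proof (rule homeomorphismI[OF 1 2])
      show "map_prod (chart_map c p) (chart_map d q) ` (chart_dom c p \<times> chart_dom d q) \<subseteq> chart_ran c p \<times> chart_ran d q"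
        by auto
      show "chart_inv (prod_atlas c d) (p, q) ` (chart_ran c p \<times> chart_ran d q) \<subseteq> chart_dom c p \<times> chart_dom d q"
        using inv chart_inv_dom[OF c, of _ p] chart_inv_dom[OF d, of _ q] by fastforce
      show "chart_inv (prod_atlas c d) (p, q) (map_prod (chart_map c p) (chart_map d q) x) = x"
        if "x \<in> chart_dom c p \<times> chart_dom d q" for x
        using that by (cases x) (auto simp: inv chart_inv_map[OF c] chart_inv_map[OF d])
      show "map_prod (chart_map c p) (chart_map d q) (chart_inv (prod_atlas c d) (p, q) y) = y"
        if "y \<in> chart_ran c p \<times> chart_ran d q" for y
        using that by (cases y) (simp add: inv chart_map_inv[OF c] chart_map_inv[OF d])
    qed
  qed
  have trans: "smooth_on (map_prod (chart_map c p) (chart_map d q) `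
      (chart_dom c p \<times> chart_dom d q \<inter> chart_dom c p' \<times> chart_dom d q'))
      (map_prod (chart_map c p') (chart_map d q') \<circ> chart_inv (prod_atlas c d) (p, q))" for p q p' q'
  proof -
    let ?S = "chart_map c p ` (chart_dom c p \<inter> chart_dom c p')" and ?T = "chart_map d q ` (chart_dom d q \<inter> chart_dom d q')"
    have S: "open ?S" "open ?T"
      unfolding chart_image_Int[OF c] chart_image_Int[OF d]
      by (intro open_chart_image c d open_chart_dom)+
    have ST: "open (?S \<times> ?T)" using S by (rule open_Times)
    have eq: "map_prod (chart_map c p) (chart_map d q) `
        (chart_dom c p \<times> chart_dom d q \<inter> chart_dom c p' \<times> chart_dom d q') = ?S \<times> ?T"
      by (simp add: Times_Int_Times map_prod_surj_on)
    have f: "smooth_on (?S \<times> ?T) (\<lambda>zw. (chart_map c p' \<circ> chart_inv c p) (fst zw))"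
      by (rule smooth_on_compose[OF ST _ smooth_on_linear[OF bounded_linear_fst] chart_transition[OF c]]) auto
    have g: "smooth_on (?S \<times> ?T) (\<lambda>zw. (chart_map d q' \<circ> chart_inv d q) (snd zw))"
      by (rule smooth_on_compose[OF ST _ smooth_on_linear[OF bounded_linear_snd] chart_transition[OF d]]) auto
    show ?thesis
      unfolding eq
      by (rule smooth_on_cong[OF ST _ smooth_on_Pair[OF ST f g]]) (auto simp: chart_inv_prod[OF c d])
  qed
  show ?thesis
    unfolding smooth_manifold_def split_paired_all chart_dom_prod chart_map_prod
    using top hom trans chart_mem[OF c] chart_mem[OF d] open_chart_dom[OF c] open_chart_dom[OF d]
      open_chart_ran[OF c] open_chart_ran[OF d]
    by (simp add: map_prod_surj_on open_Times)
qed

lemma smooth_map_id: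
  fixes c :: "('m::topological_space, 'e::finite_dim_normed) atlas"
  assumes c: "smooth_manifold c"
  shows "smooth_map c c (\<lambda>x. x)"
  unfolding smooth_map_def using chart_transition[OF c] by (auto simp: o_def)

lemma smooth_map_const:
  fixes c :: "('m::topological_space, 'e::finite_dim_normed) atlas"
  shows "smooth_map c d (\<lambda>_. y)"
  unfolding smooth_map_def by (auto simp: o_def smooth_on_const)

lemma smooth_map_Pair:
  fixes c :: "('m::topological_space, 'e::finite_dim_normed) atlas"
    and d :: "('n::topological_space, 'f::finite_dim_normed) atlas"
    and e :: "('o::topological_space, 'h::finite_dim_normed) atlas"
  assumes c: "smooth_manifold c" and d: "smooth_manifold d" and e: "smooth_manifold e"
    and f: "smooth_map c d f" and g: "smooth_map c e g"
  shows "smooth_map c (prod_atlas d e) (\<lambda>x. (f x, g x))"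
proof (rule smooth_map_local[OF c smooth_manifold_prod[OF d e]])
  fix x
  define A where "A = f -` chart_dom d (f x) \<inter> g -` chart_dom e (g x)"
  have A: "open A" unfolding A_def
    by (intro open_vimage open_Int open_chart_dom[OF d] open_chart_dom[OF e] smooth_mapD(1)[OF f c] smooth_mapD(1)[OF g c])
  define W where "W = {z \<in> chart_ran c x. chart_inv c x z \<in> A}"
  have W: "open W" unfolding W_def by (rule open_chart_image[OF c A])
  have "smooth_on W (\<lambda>z. (chart_map d (f x) (f (chart_inv c x z)), chart_map e (g x) (g (chart_inv c x z))))"
    by (rule smooth_on_Pair[OF W smooth_on_subset[OF smooth_mapD(2)[OF f c]] smooth_on_subset[OF smooth_mapD(2)[OF g c]]])
      (auto simp: W_def A_def)
  moreover have "chart_map c x x \<in> W"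
    using chart_mem[OF c] chart_mem[OF d] chart_mem[OF e] by (auto simp: W_def A_def chart_inv_map[OF c])
  ultimately show "\<exists>p q W. x \<in> chart_dom c p \<and> open W \<and> chart_map c p x \<in> W \<and> W \<subseteq> chart_ran c p \<and>
        (\<forall>z\<in>W. (f (chart_inv c p z), g (chart_inv c p z)) \<in> chart_dom (prod_atlas d e) q) \<and>
        smooth_on W (\<lambda>z. chart_map (prod_atlas d e) q (f (chart_inv c p z), g (chart_inv c p z)))"
    using W chart_mem[OF c] by (intro exI[of _ x] exI[of _ "(f x, g x)"] exI[of _ W]) (auto simp: W_def A_def)
qed

lemma
  fixes c :: "('m::topological_space, 'e::finite_dim_normed) atlas"
    and d :: "('n::topological_space, 'f::finite_dim_normed) atlas"
  assumes c: "smooth_manifold c" and d: "smooth_manifold d"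
  shows smooth_map_fst: "smooth_map (prod_atlas c d) c fst"
    and smooth_map_snd: "smooth_map (prod_atlas c d) d snd"
proof -
  have o: "open (chart_ran c p \<times> chart_ran d q)" for p q
    by (intro open_Times open_chart_ran c d)
  have f: "smooth_on (chart_ran c p \<times> chart_ran d q) (\<lambda>z. chart_map c p (fst (chart_inv (prod_atlas c d) (p, q) z)))" for p q
    by (rule smooth_on_cong[OF o _ smooth_on_linear[OF bounded_linear_fst]])
      (auto simp: chart_inv_prod[OF c d] chart_map_inv[OF c])
  have s: "smooth_on (chart_ran c p \<times> chart_ran d q) (\<lambda>z. chart_map d q (snd (chart_inv (prod_atlas c d) (p, q) z)))" for p q
    by (rule smooth_on_cong[OF o _ smooth_on_linear[OF bounded_linear_snd]])
      (auto simp: chart_inv_prod[OF c d] chart_map_inv[OF d])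
  have dom: "fst (chart_inv (prod_atlas c d) (p, q) z) \<in> chart_dom c p" "snd (chart_inv (prod_atlas c d) (p, q) z) \<in> chart_dom d q"
    if "z \<in> chart_ran c p \<times> chart_ran d q" for p q z
    using that chart_inv_dom[OF c, of "fst z" p] chart_inv_dom[OF d, of "snd z" q]
    by (cases z; simp add: chart_inv_prod[OF c d])+
  show "smooth_map (prod_atlas c d) c fst"
  proof (rule smooth_map_local[OF smooth_manifold_prod[OF c d] c])
    fix x :: "'m \<times> 'n"
    obtain p q where x: "x = (p, q)" by (cases x)
    show "\<exists>p q W. x \<in> chart_dom (prod_atlas c d) p \<and> open W \<and> chart_map (prod_atlas c d) p x \<in> W \<and>
        W \<subseteq> chart_ran (prod_atlas c d) p \<and>
        (\<forall>z\<in>W. fst (chart_inv (prod_atlas c d) p z) \<in> chart_dom c q) \<and>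
        smooth_on W (\<lambda>z. chart_map c q (fst (chart_inv (prod_atlas c d) p z)))"
      by (rule exI[of _ "(p, q)"], rule exI[of _ p], rule exI[of _ "chart_ran c p \<times> chart_ran d q"])
        (use o f dom in \<open>simp add: x chart_mem[OF c] chart_mem[OF d] map_prod_surj_on\<close>)
  qed
  show "smooth_map (prod_atlas c d) d snd"
  proof (rule smooth_map_local[OF smooth_manifold_prod[OF c d] d])
    fix x :: "'m \<times> 'n"
    obtain p q where x: "x = (p, q)" by (cases x)
    show "\<exists>p q W. x \<in> chart_dom (prod_atlas c d) p \<and> open W \<and> chart_map (prod_atlas c d) p x \<in> W \<and>
        W \<subseteq> chart_ran (prod_atlas c d) p \<and>
        (\<forall>z\<in>W. snd (chart_inv (prod_atlas c d) p z) \<in> chart_dom d q) \<and>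
        smooth_on W (\<lambda>z. chart_map d q (snd (chart_inv (prod_atlas c d) p z)))"
      by (rule exI[of _ "(p, q)"], rule exI[of _ q], rule exI[of _ "chart_ran c p \<times> chart_ran d q"])
        (use o s dom in \<open>simp add: x chart_mem[OF c] chart_mem[OF d] map_prod_surj_on\<close>)
  qed
qed

text \<open>The vector factor has one global chart, so smoothness is tested only in the charts of
  the first factor. This serves the phase space and the reduced space alike.\<close>

lemma smooth_functions_prod_iff:
  fixes c :: "('m::topological_space, 'e::finite_dim_normed) atlas" and H :: "'m \<times> 'v::finite_dim_normed \<Rightarrow> real"
  assumes c: "smooth_manifold c"
  shows "H \<in> smooth_functions (prod_atlas c vector_atlas) \<longleftrightarrow>
    (\<forall>g. smooth_on (chart_ran c g \<times> UNIV) (\<lambda>p. H (chart_inv c g (fst p), snd p)))"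
proof -
  note v = smooth_manifold_vector_atlas
  have o: "open (chart_ran c p \<times> (UNIV :: 'v set))" for p
    by (intro open_Times open_chart_ran c open_UNIV)
  have inv: "chart_inv (prod_atlas c vector_atlas) (g, w) z = (chart_inv c g (fst z), snd z)"
    if "z \<in> chart_ran c g \<times> UNIV" for g and w :: 'v and z
    using that by (cases z) (simp add: chart_inv_prod[OF c v])
  show ?thesis
  proof
    assume "H \<in> smooth_functions (prod_atlas c vector_atlas)"
    then have H: "smooth_map (prod_atlas c vector_atlas) vector_atlas H"
      by (simp add: smooth_functions_def)
    show "\<forall>g. smooth_on (chart_ran c g \<times> UNIV) (\<lambda>p. H (chart_inv c g (fst p), snd p))"
    proof
      fix g
      have "smooth_on (chart_ran c g \<times> UNIV) (\<lambda>z. H (chart_inv (prod_atlas c vector_atlas) (g, 0) z))"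
        using smooth_mapD(2)[OF H smooth_manifold_prod[OF c v], of "(g, 0)" 0]
        by (simp add: map_prod_surj_on)
      then show "smooth_on (chart_ran c g \<times> UNIV) (\<lambda>p. H (chart_inv c g (fst p), snd p))"
        by (rule smooth_on_cong[OF o, rotated]) (simp only: inv)
    qed
  next
    assume H: "\<forall>g. smooth_on (chart_ran c g \<times> UNIV) (\<lambda>p. H (chart_inv c g (fst p), snd p))"
    have "smooth_map (prod_atlas c vector_atlas) vector_atlas H"
    proof (rule smooth_map_local[OF smooth_manifold_prod[OF c v] v])
      fix x :: "'m \<times> 'v"
      obtain g w where x: "x = (g, w)" by (cases x)
      have "smooth_on (chart_ran c g \<times> UNIV) (\<lambda>z. H (chart_inv (prod_atlas c vector_atlas) (g, w) z))"
        by (rule smooth_on_cong[OF o _ H[rule_format]]) (simp only: inv)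
      then show "\<exists>p q W. x \<in> chart_dom (prod_atlas c vector_atlas) p \<and> open W \<and>
          chart_map (prod_atlas c vector_atlas) p x \<in> W \<and> W \<subseteq> chart_ran (prod_atlas c vector_atlas) p \<and>
          (\<forall>z\<in>W. H (chart_inv (prod_atlas c vector_atlas) p z) \<in> chart_dom vector_atlas q) \<and>
          smooth_on W (\<lambda>z. chart_map vector_atlas q (H (chart_inv (prod_atlas c vector_atlas) p z)))"
        using o by (intro exI[of _ "(g, w)"] exI[of _ 0] exI[of _ "chart_ran c g \<times> UNIV"])
          (simp add: x chart_mem[OF c] map_prod_surj_on)
    qed
    then show "H \<in> smooth_functions (prod_atlas c vector_atlas)"
      by (simp add: smooth_functions_def)
  qed
qed

section \<open>The Lie algebra in charts\<close>

lemma
  assumes "f differentiable (at (x, z))"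
  shows has_derivative_partial_fst: "((\<lambda>x. f (x, z)) has_derivative (\<lambda>a. fd f (x, z) (a, 0))) (at x)"
    and has_derivative_partial_snd: "((\<lambda>z. f (x, z)) has_derivative (\<lambda>b. fd f (x, z) (0, b))) (at z)"
proof -
  have "((\<lambda>x. (x, z)) has_derivative (\<lambda>a. (a, 0))) (at x)" "((\<lambda>z. (x, z)) has_derivative (\<lambda>b. (0, b))) (at z)"
    by (auto intro!: derivative_eq_intros)
  from this[THEN has_derivative_compose, OF fd_has_derivative[OF assms]]
  show "((\<lambda>x. f (x, z)) has_derivative (\<lambda>a. fd f (x, z) (a, 0))) (at x)"
    "((\<lambda>z. f (x, z)) has_derivative (\<lambda>b. fd f (x, z) (0, b))) (at z)" .
qed

locale lie_grp =
  fixes G :: "('g::topological_space, 'e::finite_dim_normed) lie_data"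
  assumes lie: "lie_group G"
begin

abbreviation "e \<equiv> unit G"
abbreviation mult (infixl \<open>\<odot>\<close> 70) where "x \<odot> y \<equiv> mul G x y"
abbreviation "cdom g \<equiv> chart_dom (atlas G) g"
abbreviation "cran g \<equiv> chart_ran (atlas G) g"
abbreviation "cm g \<equiv> chart_map (atlas G) g"
abbreviation "ci g \<equiv> chart_inv (atlas G) g"

lemma is_group: "group (mul G) (unit G) (inverse_of G)"
  and mfd: "smooth_manifold (atlas G)"
  and mul_smooth: "smooth_map (prod_atlas (atlas G) (atlas G)) (atlas G) (\<lambda>(g, h). mul G g h)"
  and inv_smooth: "smooth_map (atlas G) (atlas G) (inverse_of G)"
  using lie unfolding lie_group_def by blast+

interpretation group "mul G" "unit G" "inverse_of G" by (rule is_group)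

lemma mult_assoc: "x \<odot> y \<odot> z = x \<odot> (y \<odot> z)"
  and unit_left [simp]: "e \<odot> x = x"
  and unit_right [simp]: "x \<odot> e = x"
  and inverse_left [simp]: "inverse_of G x \<odot> x = e"
  and inverse_right [simp]: "x \<odot> inverse_of G x = e"
  by (simp_all add: assoc)

lemma idempotent_unit: "x \<odot> x = x \<Longrightarrow> x = e"
  by (metis inverse_left mult_assoc unit_left)

lemmas mfd2 = smooth_manifold_prod[OF mfd mfd]
lemmas ci_cm [simp] = chart_inv_map[OF mfd]
lemmas cm_ci [simp] = chart_map_inv[OF mfd]
lemmas ci_dom [simp] = chart_inv_dom[OF mfd]
lemmas mem_dom [simp] = chart_mem[OF mfd]
lemmas open_dom = open_chart_dom[OF mfd]
lemmas open_ran = open_chart_ran[OF mfd]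

lemma cm_ran [simp]: "x \<in> cdom g \<Longrightarrow> cm g x \<in> cran g"
  by blast

section \<open>The multiplication read in charts\<close>

definition "x0 = cm e e"

lemma x0_ran [simp]: "x0 \<in> cran e"
  unfolding x0_def by simp

lemma ci_x0 [simp]: "ci e x0 = e"
  by (simp add: x0_def)

text \<open>The left factor is read in the chart at the identity, where it will be differentiated;
  the right factor and the product share the chart at \<open>g\<close>, so that varying the left
  factor moves \<open>z\<close> within that chart.\<close>

definition "M g p = cm g (ci e (fst p) \<odot> ci g (snd p))"

definition "M_dom g = {p. fst p \<in> cran e \<and> snd p \<in> cran g \<and> ci e (fst p) \<odot> ci g (snd p) \<in> cdom g}"

lemma M_dom_mem: "(x, z) \<in> M_dom g \<longleftrightarrow> x \<in> cran e \<and> z \<in> cran g \<and> ci e x \<odot> ci g z \<in> cdom g"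
  by (simp add: M_dom_def)

lemma M_dom_eq:
  "M_dom g = {z \<in> chart_ran (prod_atlas (atlas G) (atlas G)) (e, g).
     (case chart_inv (prod_atlas (atlas G) (atlas G)) (e, g) z of (g, h) \<Rightarrow> g \<odot> h) \<in> cdom g}"
proof -
  have "(case chart_inv (prod_atlas (atlas G) (atlas G)) (e, g) p of (g, h) \<Rightarrow> g \<odot> h) = ci e (fst p) \<odot> ci g (snd p)"
    if "p \<in> cran e \<times> cran g" for p
    using that by (cases p) (simp add: chart_inv_prod[OF mfd mfd])
  then show ?thesis
    unfolding M_dom_def chart_ran_prod by (auto simp: mem_Times_iff)
qed

lemma open_M_dom: "open (M_dom g)"
  unfolding M_dom_eq by (rule smooth_map_open_chart[OF mul_smooth mfd2 mfd])

lemma M_smooth: "smooth_on (M_dom g) (M g)"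
proof (rule smooth_on_cong[OF open_M_dom])
  show "smooth_on (M_dom g) (\<lambda>z. cm g (case chart_inv (prod_atlas (atlas G) (atlas G)) (e, g) z of (g, h) \<Rightarrow> g \<odot> h))"
    unfolding M_dom_eq by (rule smooth_mapD(2)[OF mul_smooth mfd2])
  fix p assume "p \<in> M_dom g"
  then show "cm g (case chart_inv (prod_atlas (atlas G) (atlas G)) (e, g) p of (g, h) \<Rightarrow> g \<odot> h) = M g p"
    by (cases p) (simp add: M_dom_mem M_def chart_inv_prod[OF mfd mfd])
qed

lemma M_differentiable: "p \<in> M_dom g \<Longrightarrow> M g differentiable (at p)"
  by (rule smooth_on_differentiable[OF M_smooth])

lemma x0_M_dom [simp]: "z \<in> cran g \<Longrightarrow> (x0, z) \<in> M_dom g"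
  by (simp add: M_dom_mem)

lemma M_x0 [simp]: "z \<in> cran g \<Longrightarrow> M g (x0, z) = z"
  by (simp add: M_def)

lemma M_dom_x0 [simp]: "z \<in> cran e \<Longrightarrow> (z, x0) \<in> M_dom e"
  by (simp add: M_dom_mem)

lemma M_right_x0 [simp]: "z \<in> cran e \<Longrightarrow> M e (z, x0) = z"
  by (simp add: M_def)

lemma M_ran: "p \<in> M_dom g \<Longrightarrow> M g p \<in> cran g"
  by (simp add: M_def M_dom_def)

lemma ci_M: "p \<in> M_dom g \<Longrightarrow> ci g (M g p) = ci e (fst p) \<odot> ci g (snd p)"
  by (simp add: M_def M_dom_def)

text \<open>The right invariant vector field generated by \<open>a\<close>, in the chart at \<open>g\<close>.\<close>

definition "R g z a = fd (M g) (x0, z) (a, 0)"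

lemma M_deriv_fst: "z \<in> cran g \<Longrightarrow> ((\<lambda>x. M g (x, z)) has_derivative R g z) (at x0)"
  unfolding R_def[abs_def] by (rule has_derivative_partial_fst[OF M_differentiable]) simp

lemma linear_R: "z \<in> cran g \<Longrightarrow> linear (R g z)"
  using M_deriv_fst has_derivative_linear by blast

lemma R_smooth: "smooth_on (cran g) (\<lambda>z. R g z a)"
  unfolding R_def
  by (rule smooth_on_fd_apply[OF open_ran _ M_smooth
        smooth_on_Pair[OF open_ran smooth_on_const smooth_on_linear[OF bounded_linear_ident]] smooth_on_const]) auto

lemma R_x0 [simp]: "R e x0 a = a"
proof -
  have "((\<lambda>x. x) has_derivative R e x0) (at x0)"
    by (rule has_derivative_transform_within_open[OF M_deriv_fst[OF x0_ran] open_ran x0_ran]) simp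
  from fd_eq[OF this] show ?thesis by (metis frechet_derivative_ident)
qed

lemma TR_eq: "TR G g \<eta> = R g (cm g g) \<eta>"
proof -
  have "((\<lambda>x. M g (x, cm g g)) has_derivative R g (cm g g)) (at x0)"
    by (rule M_deriv_fst) simp
  moreover have "(\<lambda>x. M g (x, cm g g)) = cm (e \<odot> g) \<circ> (\<lambda>h. h \<odot> g) \<circ> ci e"
    by (auto simp: M_def)
  ultimately show ?thesis
    unfolding TR_def tangent_map_def x0_def using fd_eq by metis
qed

text \<open>This is associativity, \<open>x (y z) = (x y) z\<close>, differentiated in
  \<open>x\<close> at the identity.\<close>

lemma R_equivariant:
  assumes yz: "(y, z) \<in> M_dom g"
  shows "R g (M g (y, z)) a = fd (M g) (y, z) (R e y a, 0)"
proof -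
  have yr: "y \<in> cran e" using yz by (simp add: M_dom_mem)
  let ?N = "{x. (x, y) \<in> M_dom e}"
  have "open ((\<lambda>x. (x, y)) -` M_dom e)"
    by (intro open_vimage open_M_dom continuous_intros)
  then have N: "open ?N" by (simp add: vimage_def)
  have "((\<lambda>x. M g (x, M g (y, z))) has_derivative R g (M g (y, z))) (at x0)"
    by (rule M_deriv_fst[OF M_ran[OF yz]])
  then have 1: "((\<lambda>x. M g (M e (x, y), z)) has_derivative R g (M g (y, z))) (at x0)"
  proof (rule has_derivative_transform_within_open[OF _ N])
    show "x0 \<in> ?N" using yr by simp
    fix x assume "x \<in> ?N"
    then show "M g (x, M g (y, z)) = M g (M e (x, y), z)"
      unfolding M_def[of g "(x, M g (y, z))"] M_def[of g "(M e (x, y), z)"]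
      using yz by (simp add: ci_M mult_assoc)
  qed
  have d: "M g differentiable (at (M e (x0, y), z))"
    using M_differentiable[OF yz] yr by simp
  have 2: "((\<lambda>x. M g (M e (x, y), z)) has_derivative (\<lambda>a. fd (M g) (M e (x0, y), z) (R e y a, 0))) (at x0)"
    by (rule has_derivative_compose[OF M_deriv_fst[OF yr] has_derivative_partial_fst[OF d]])
  show ?thesis
    using fun_cong[OF has_derivative_unique[OF 1 2], of a] yr by simp
qed

text \<open>The mixed second derivative of the multiplication at the identity; the slot of \<open>a\<close> is the left factor.\<close>

definition "Bm a b = fd (\<lambda>y. R e y a) x0 b"

text \<open>The bracket of right invariant vector fields at the identity; in a matrix group it is
  minus the commutator, \<open>b a - a b\<close>. \<open>lie_bracket_eq\<close> identifies it with
  the bracket defined through \<open>Ad\<close> and the exponential map.\<close>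

definition "lb a b = Bm b a - Bm a b"

lemma R_has_derivative:
  "z \<in> cran g \<Longrightarrow> ((\<lambda>z. R g z a) has_derivative fd (\<lambda>z. R g z a) z) (at z)"
  by (rule fd_has_derivative[OF smooth_on_differentiable[OF R_smooth]])

text \<open>Equivariance is differentiated in \<open>y\<close> at the identity. On its right-hand
  side \<open>y\<close> occurs as base point of \<open>fd (M g)\<close> and inside
  \<open>R e y a\<close>, hence two summands; the first is a second derivative of
  \<open>M g\<close>, symmetric in \<open>a\<close> and \<open>b\<close>.\<close>

lemma R_derivative_along:
  assumes z: "z \<in> cran g"
  shows "fd (\<lambda>z. R g z a) z (R g z b) = fd (\<lambda>p. fd (M g) p (a, 0)) (x0, z) (b, 0) + R g z (Bm a b)"
proof -
  let ?N = "{y. (y, z) \<in> M_dom g}"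
  have "open ((\<lambda>x. (x, z)) -` M_dom g)"
    by (intro open_vimage open_M_dom continuous_intros)
  then have N: "open ?N" by (simp add: vimage_def)
  have xN: "x0 \<in> ?N" using z by simp
  have "((\<lambda>z. R g z a) has_derivative fd (\<lambda>z. R g z a) z) (at (M g (x0, z)))"
    using R_has_derivative[OF z] z by simp
  from has_derivative_compose[OF M_deriv_fst[OF z] this]
  have 1: "((\<lambda>y. R g (M g (y, z)) a) has_derivative (\<lambda>b. fd (\<lambda>z. R g z a) z (R g z b))) (at x0)" .
  have 2: "((\<lambda>y. fd (M g) (y, z) (R e y a, 0)) has_derivative (\<lambda>b. fd (\<lambda>z. R g z a) z (R g z b))) (at x0)"
    by (rule has_derivative_transform_within_open[OF 1 N xN]) (simp add: R_equivariant)
  have "((\<lambda>q. R e (fst q) a) has_derivative (\<lambda>w. Bm a (fst w))) (at (x0, z))"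
    unfolding Bm_def
    using has_derivative_compose[OF has_derivative_fst[OF has_derivative_ident], of "\<lambda>y. R e y a" "fd (\<lambda>y. R e y a) x0" "(x0, z)"]
      R_has_derivative[OF x0_ran] by simp
  then have u: "((\<lambda>q. (R e (fst q) a, 0)) has_derivative (\<lambda>w. (Bm a (fst w), 0))) (at (x0, z))"
    by (intro has_derivative_Pair has_derivative_const)
  have 3: "((\<lambda>q. fd (M g) q (R e (fst q) a, 0)) has_derivative
      (\<lambda>w. fd (\<lambda>q. fd (M g) q (a, 0)) (x0, z) w + R g z (Bm a (fst w)))) (at (x0, z))"
    using has_derivative_fd_apply[OF open_M_dom x0_M_dom[OF z] M_smooth u]
    unfolding R_def[of g z] by simp
  have "((\<lambda>y. (y, z)) has_derivative (\<lambda>b. (b, 0))) (at x0)"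
    by (auto intro!: derivative_eq_intros)
  from has_derivative_compose[OF this 3]
  have "((\<lambda>y. fd (M g) (y, z) (R e y a, 0)) has_derivative
      (\<lambda>b. fd (\<lambda>q. fd (M g) q (a, 0)) (x0, z) (b, 0) + R g z (Bm a b))) (at x0)"
    by simp
  from fun_cong[OF has_derivative_unique[OF 2 this], of b] show ?thesis .
qed

text \<open>The symmetric second derivative of \<open>M g\<close> drops out on antisymmetrising;
  only the terms with \<open>Bm\<close> survive.\<close>

lemma R_commutator:
  assumes z: "z \<in> cran g"
  shows "fd (\<lambda>z. R g z a) z (R g z b) - fd (\<lambda>z. R g z b) z (R g z a) = R g z (lb b a)"
  using second_derivative_symmetric[OF open_M_dom x0_M_dom[OF z] M_smooth, of "(a, 0)" "(b, 0)"]
  unfolding R_derivative_along[OF z] lb_def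
  by (simp add: linear_diff[OF linear_R[OF z]])

lemma linear_Bm_right: "linear (Bm a)"
  unfolding Bm_def[abs_def] using linear_fd[OF smooth_on_differentiable[OF R_smooth x0_ran]] .

lemma linear_Bm_left: "linear (\<lambda>a. Bm a b)"
proof (rule linearI)
  fix a a' c
  note D = R_has_derivative[OF x0_ran]
  have "((\<lambda>y. R e y (a + a')) has_derivative (\<lambda>b. fd (\<lambda>y. R e y a) x0 b + fd (\<lambda>y. R e y a') x0 b)) (at x0)"
    by (rule has_derivative_transform_within_open[OF has_derivative_add[OF D D] open_ran x0_ran])
      (simp add: linear_add[OF linear_R])
  from fun_cong[OF fd_eq[OF this], of b] show "Bm (a + a') b = Bm a b + Bm a' b"
    by (simp add: Bm_def)
  have "((\<lambda>y. R e y (c *\<^sub>R a)) has_derivative (\<lambda>b. c *\<^sub>R fd (\<lambda>y. R e y a) x0 b)) (at x0)"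
    by (rule has_derivative_transform_within_open[OF has_derivative_scaleR_right[OF D] open_ran x0_ran])
      (simp add: linear_scale[OF linear_R])
  from fun_cong[OF fd_eq[OF this], of b] show "Bm (c *\<^sub>R a) b = c *\<^sub>R Bm a b"
    by (simp add: Bm_def)
qed

lemma bilinear_lb: "bounded_bilinear lb"
  unfolding lb_def[abs_def]
  by (intro bilinear_imp_bounded_bilinear linear_compose_sub linear_Bm_left linear_Bm_right)

lemma lb_antisym: "lb a b = - lb b a"
  by (simp add: lb_def)

text \<open>The commutator identity holds on a whole neighbourhood of \<open>x0\<close>, so it can
  be differentiated once more. In the cyclic sum the second derivatives \<open>D2\<close> cancel by
  symmetry in the last two slots, and the iterated \<open>Bm\<close> terms cancel
  algebraically.\<close>

lemma lb_jacobi: "lb (lb a b) c + lb (lb b c) a + lb (lb c a) b = 0"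
proof -
  define D2 where "D2 a b c = fd (\<lambda>y. fd (\<lambda>z. R e z a) y b) x0 c" for a b c
  have sym: "D2 a b c = D2 a c b" for a b c
    unfolding D2_def by (rule second_derivative_symmetric[OF open_ran x0_ran R_smooth])
  have 1: "((\<lambda>z. fd (\<lambda>z. R e z a) z (R e z b)) has_derivative (\<lambda>c. D2 a b c + Bm a (Bm b c))) (at x0)" for a b
    using has_derivative_fd_apply[OF open_ran x0_ran R_smooth R_has_derivative[OF x0_ran]]
    unfolding D2_def Bm_def by simp
  have eq: "D2 a b c + Bm a (Bm b c) - (D2 b a c + Bm b (Bm a c)) = Bm (lb b a) c" for a b c
  proof -
    have "((\<lambda>z. R e z (lb b a)) has_derivative
        (\<lambda>c. D2 a b c + Bm a (Bm b c) - (D2 b a c + Bm b (Bm a c)))) (at x0)"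
      by (rule has_derivative_transform_within_open[OF has_derivative_diff[OF 1[of a b] 1[of b a]] open_ran x0_ran])
        (simp add: R_commutator)
    from fun_cong[OF fd_eq[OF this], of c] show ?thesis by (simp add: Bm_def)
  qed
  have lb2: "lb (lb a b) c = Bm c (Bm b a) - Bm c (Bm a b) + Bm (lb b a) c" for a b c
    unfolding lb_def[of "lb a b"]
    by (simp add: lb_def linear_diff[OF linear_Bm_right] linear_diff[OF linear_Bm_left])
  show ?thesis
    unfolding lb2 eq[symmetric] by (simp add: sym[of a c b] sym[of b c a] sym[of c b a])
qed

subsection \<open>One-parameter subgroups\<close>

primrec pw :: "'g \<Rightarrow> nat \<Rightarrow> 'g" where
  "pw x 0 = e"
| "pw x (Suc n) = pw x n \<odot> x"

lemma pw_add: "pw x (m + n) = pw x m \<odot> pw x n"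
  by (induction n) (simp_all add: mult_assoc)

lemma pw_mult: "pw x (m * n) = pw (pw x m) n"
proof (induction n)
  case (Suc n)
  have "pw x (m * Suc n) = pw x (m * n + m)" by (simp add: add.commute)
  then show ?case by (simp only: pw_add Suc.IH pw.simps)
qed simp

lemma pw_commute:
  assumes "x \<odot> y = y \<odot> x"
  shows "pw x n \<odot> y = y \<odot> pw x n"
proof (induction n)
  case (Suc n)
  have "pw x n \<odot> x \<odot> y = pw x n \<odot> y \<odot> x" by (simp add: mult_assoc assms)
  then show ?case by (simp add: Suc.IH mult_assoc)
qed simp

lemma pw_distrib:
  assumes "x \<odot> y = y \<odot> x"
  shows "pw (x \<odot> y) n = pw x n \<odot> pw y n"
proof (induction n)
  case (Suc n)
  have "pw (x \<odot> y) (Suc n) = pw x n \<odot> (pw y n \<odot> x) \<odot> y"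
    by (simp add: Suc.IH mult_assoc)
  also have "pw y n \<odot> x = x \<odot> pw y n"
    by (rule pw_commute) (simp add: assms)
  finally show ?case by (simp add: mult_assoc)
qed simp

lemma local_hom_pw:
  assumes hom: "\<And>s t. \<bar>s\<bar> \<le> d \<Longrightarrow> \<bar>t\<bar> \<le> d \<Longrightarrow> \<gamma> (s + t) = \<gamma> s \<odot> \<gamma> t"
    and d: "(d::real) > 0"
  shows "\<bar>real n * u\<bar> \<le> d \<Longrightarrow> \<gamma> (real n * u) = pw (\<gamma> u) n"
proof (induction n)
  case 0
  have "\<gamma> 0 \<odot> \<gamma> 0 = \<gamma> 0" using hom[of 0 0] d by simp
  then show ?case using idempotent_unit by simp
next
  case (Suc n)
  have "\<bar>real n * u\<bar> \<le> \<bar>real (Suc n) * u\<bar>" "\<bar>u\<bar> \<le> \<bar>real (Suc n) * u\<bar>"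
    unfolding abs_mult by (auto simp: distrib_right)
  then have "\<bar>real n * u\<bar> \<le> d" "\<bar>u\<bar> \<le> d" using Suc.prems by linarith+
  then have "\<gamma> (real n * u + u) = pw (\<gamma> u) n \<odot> \<gamma> u"
    using hom Suc.IH by simp
  then show ?case by (simp add: distrib_right add.commute)
qed

text \<open>The value \<open>pw (\<gamma> (t / real n)) n\<close> does not depend on
  \<open>n\<close>, because subdivisions into \<open>n\<close> and \<open>m\<close> parts have the
  common refinement into \<open>n * m\<close> parts. Additivity uses that values at small times
  commute, which follows from \<open>s + t = t + s\<close>.\<close>

lemma local_hom_extends:
  assumes hom: "\<And>s t. \<bar>s\<bar> \<le> d \<Longrightarrow> \<bar>t\<bar> \<le> d \<Longrightarrow> \<gamma> (s + t) = \<gamma> s \<odot> \<gamma> t"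
    and d: "(d::real) > 0"
  obtains \<Gamma> where "\<And>s t. \<Gamma> (s + t) = \<Gamma> s \<odot> \<Gamma> t" "\<And>t. \<bar>t\<bar> \<le> d \<Longrightarrow> \<Gamma> t = \<gamma> t"
proof -
  have indep: "pw (\<gamma> (t / real n)) n = pw (\<gamma> (t / real m)) m"
    if n: "n > 0" "\<bar>t\<bar> \<le> real n * d" and m: "m > 0" "\<bar>t\<bar> \<le> real m * d" for t n m
  proof -
    let ?u = "t / real (n * m)"
    have 1: "real m * ?u = t / real n" "real n * ?u = t / real m"
      using n m by (simp_all add: field_simps)
    have 2: "\<bar>t / real n\<bar> \<le> d" "\<bar>t / real m\<bar> \<le> d"
      using n m by (simp_all add: abs_divide divide_le_eq mult.commute)
    have "pw (\<gamma> (t / real n)) n = pw (pw (\<gamma> ?u) m) n"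
      using local_hom_pw[OF hom d, of m ?u] 1 2 by simp
    also have "\<dots> = pw (pw (\<gamma> ?u) n) m"
      by (simp add: mult.commute flip: pw_mult)
    also have "\<dots> = pw (\<gamma> (t / real m)) m"
      using local_hom_pw[OF hom d, of n ?u] 1 2 by simp
    finally show ?thesis .
  qed
  have ex: "\<exists>n>0. x \<le> real n * d" for x
  proof -
    obtain n where "x < real n * d" using ex_less_of_nat_mult[OF d] by blast
    then have "x \<le> real (Suc n) * d" using d by (simp add: distrib_right)
    then show ?thesis by blast
  qed
  define k where "k t = (SOME n. n > 0 \<and> \<bar>t\<bar> \<le> real n * d)" for t
  have k: "k t > 0" "\<bar>t\<bar> \<le> real (k t) * d" for t
    using someI_ex[OF ex[of "\<bar>t\<bar>"]] unfolding k_def by blast+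
  define \<Gamma> where "\<Gamma> t = pw (\<gamma> (t / real (k t))) (k t)" for t
  have \<Gamma>: "\<Gamma> t = pw (\<gamma> (t / real n)) n" if "n > 0" "\<bar>t\<bar> \<le> real n * d" for t n
    unfolding \<Gamma>_def by (rule indep[OF k that])
  show ?thesis
  proof
    fix s t
    obtain n where n: "n > 0" "\<bar>s\<bar> + \<bar>t\<bar> \<le> real n * d" using ex by blast
    let ?s = "s / real n" and ?t = "t / real n"
    have sm: "\<bar>?s\<bar> \<le> d" "\<bar>?t\<bar> \<le> d"
      using n by (simp_all add: abs_divide divide_le_eq mult.commute)
    have "\<Gamma> (s + t) = pw (\<gamma> (?s + ?t)) n"
      using \<Gamma>[of n "s + t"] n by (simp add: add_divide_distrib)
    also have "\<gamma> (?s + ?t) = \<gamma> ?s \<odot> \<gamma> ?t" by (rule hom[OF sm])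
    also have "pw (\<gamma> ?s \<odot> \<gamma> ?t) n = pw (\<gamma> ?s) n \<odot> pw (\<gamma> ?t) n"
      by (rule pw_distrib) (metis hom sm add.commute)
    also have "\<dots> = \<Gamma> s \<odot> \<Gamma> t"
      using \<Gamma>[of n s] \<Gamma>[of n t] n by simp
    finally show "\<Gamma> (s + t) = \<Gamma> s \<odot> \<Gamma> t" .
  next
    fix t assume "\<bar>t\<bar> \<le> d"
    then show "\<Gamma> t = \<gamma> t" using \<Gamma>[of 1 t] by simp
  qed
qed

text \<open>A homomorphism from the line is determined by its values at small times, being a power
  of its value at \<open>t / real n\<close>.\<close>

lemma hom_eq_near_0:
  assumes "\<And>s t. \<gamma> (s + t) = \<gamma> s \<odot> \<gamma> t" "\<And>s t. \<gamma>' (s + t) = \<gamma>' s \<odot> \<gamma>' t"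
    and d: "(d::real) > 0" "\<And>t. \<bar>t\<bar> \<le> d \<Longrightarrow> \<gamma> t = \<gamma>' t"
  shows "\<gamma> t = \<gamma>' t"
proof -
  obtain n where n: "\<bar>t\<bar> < real n * d" using ex_less_of_nat_mult[OF d(1)] by blast
  then have n0: "n > 0" by (cases n) auto
  have sm: "\<bar>t / real n\<bar> \<le> d"
    using n n0 by (simp add: abs_divide divide_le_eq mult.commute)
  \<comment> \<open>Additivity is global here, so the radius may be taken larger than the time in
    question.\<close>
  have "\<gamma> (real n * (t / real n)) = pw (\<gamma> (t / real n)) n"
    by (rule local_hom_pw[where d = "\<bar>real n * (t / real n)\<bar> + 1"]) (use assms in auto)
  moreover have "\<gamma>' (real n * (t / real n)) = pw (\<gamma>' (t / real n)) n"
    by (rule local_hom_pw[where d = "\<bar>real n * (t / real n)\<bar> + 1"]) (use assms in auto)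
  ultimately show ?thesis using d(2)[OF sm] n0 by simp
qed

lemma left_translation_smooth: "smooth_map (atlas G) (atlas G) (\<lambda>h. g \<odot> h)"
  using smooth_map_compose[OF mfd mfd2 mfd
      smooth_map_Pair[OF mfd mfd mfd smooth_map_const smooth_map_id[OF mfd]] mul_smooth, of g] by simp

lemma one_parameter_subgroup_exists: "\<exists>\<gamma>. one_parameter_subgroup G \<xi> \<gamma>"
proof -
  let ?f = "\<lambda>z. R e z \<xi>"
  obtain r L where r: "r > 0" "L > 0" "cball x0 r \<subseteq> cran e"
    and lip: "\<And>x y. x \<in> cball x0 r \<Longrightarrow> y \<in> cball x0 r \<Longrightarrow> norm (?f x - ?f y) \<le> L * norm (x - y)"
    by (rule smooth_on_lipschitz_ball[OF open_ran x0_ran R_smooth]) blast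
  have "\<exists>d>0. \<exists>y. y 0 = x0 \<and> (\<forall>t\<in>{-d<..<d}. y t \<in> cball x0 r \<and> (y has_vector_derivative ?f (y t)) (at t))"
  proof (rule ode_exists[OF r(1,2)])
    show "norm (?f x - ?f y) \<le> L * norm (x - y)" if "x \<in> cball x0 r" "y \<in> cball x0 r" for x y
      by (rule lip[OF that])
  qed blast
  then obtain d y where d: "d > 0" and y0: "y 0 = x0" and yb: "\<And>t. t \<in> {-d<..<d} \<Longrightarrow> y t \<in> cball x0 r"
    and dy: "\<And>t. t \<in> {-d<..<d} \<Longrightarrow> (y has_vector_derivative ?f (y t)) (at t)"
    by blast
  have yr: "y t \<in> cran e" if "t \<in> {-d<..<d}" for t using yb[OF that] r(3) by blast
  have ysm: "smooth_on {-d<..<d} y"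
    by (rule ode_solution_smooth[OF R_smooth _ yr dy]) auto
  have ycont: "continuous_on {-d<..<d} y" by (rule smooth_on_continuous[OF ysm])
  \<comment> \<open>Products have to stay in the ball where the Lipschitz bound holds, so that the
    uniqueness argument applies to them.\<close>
  define O' where "O' = {p \<in> M_dom e. M e p \<in> ball x0 r}"
  have "open (M_dom e \<inter> M e -` ball x0 r)"
    by (rule continuous_open_preimage[OF smooth_on_continuous[OF M_smooth] open_M_dom open_ball])
  then have O': "open O'" by (simp add: O'_def vimage_def Int_def)
  have "continuous_on ({-d<..<d} \<times> {-d<..<d}) (\<lambda>p. (y (fst p), y (snd p)))"
    by (intro continuous_on_Pair continuous_on_compose2[OF ycont] continuous_on_fst continuous_on_snd continuous_on_id) auto
  from continuous_open_preimage[OF this _ O']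
  have "open (({-d<..<d} \<times> {-d<..<d}) \<inter> (\<lambda>p. (y (fst p), y (snd p))) -` O')"
    by (simp add: open_Times)
  moreover have "(0, 0) \<in> ({-d<..<d} \<times> {-d<..<d}) \<inter> (\<lambda>p. (y (fst p), y (snd p))) -` O'"
    using d r(1) by (simp add: y0 O'_def)
  ultimately obtain S T where ST: "open S" "open T" "(0, 0) \<in> S \<times> T"
      "S \<times> T \<subseteq> ({-d<..<d} \<times> {-d<..<d}) \<inter> (\<lambda>p. (y (fst p), y (snd p))) -` O'"
    by (rule open_prod_elim)
  obtain e1 where e1: "e1 > 0" "ball 0 e1 \<subseteq> S" using ST by (auto elim: openE)
  obtain e2 where e2: "e2 > 0" "ball 0 e2 \<subseteq> T" using ST by (auto elim: openE)
  \<comment> \<open>These bounds put \<open>(y s, y t)\<close> into \<open>O'\<close>, keep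
    \<open>s + t\<close> inside the interval of the solution, and give \<open>L * k < 1\<close> for
    uniqueness.\<close>
  define k where "k = min (min e1 e2 / 2) (min (d / 3) (1 / (2 * L)))"
  have "k > 0" using e1(1) e2(1) d r(2) by (simp add: k_def)
  moreover have "k \<le> e1 / 2" "k \<le> e2 / 2" "k \<le> d / 3" "k \<le> 1 / (2 * L)"
    by (auto simp: k_def)
  moreover from this have "L * k \<le> 1 / 2"
    using mult_left_mono[of k "1 / (2 * L)" L] r(2) by simp
  ultimately have k: "k > 0" "k < e1" "k < e2" "2 * k < d" "L * k < 1"
    using d e1(1) e2(1) by linarith+
  have inO: "(y s, y t) \<in> O'" if "\<bar>s\<bar> \<le> k" "\<bar>t\<bar> \<le> k" for s t
  proof -
    have "s \<in> S" "t \<in> T" using e1(2) e2(2) that k by (auto simp: subset_iff)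
    then show ?thesis using ST(4) by auto
  qed
  \<comment> \<open>For fixed \<open>t\<close> both sides, as functions of \<open>s\<close>, solve
    the same equation with value \<open>y t\<close> at \<open>s = 0\<close>;
    \<open>R_equivariant\<close> yields the equation for the product.\<close>
  have hom: "M e (y s, y t) = y (s + t)" if s: "\<bar>s\<bar> \<le> k" and t: "\<bar>t\<bar> \<le> k" for s t
  proof (rule ode_unique[where B = "cball x0 r" and f = ?f and d = k and L = L and t = s
        and y = "\<lambda>s. M e (y s, y t)" and z = "\<lambda>s. y (s + t)"])
    show "norm (?f x - ?f y) \<le> L * norm (x - y)" if "x \<in> cball x0 r" "y \<in> cball x0 r" for x y
      by (rule lip[OF that])
    show "0 \<le> L" "0 \<le> k" "L * k < 1" using r k by auto
    have yt: "y t \<in> cran e" using t k by (intro yr) auto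
    show "M e (y 0, y t) = y (0 + t)" using yt by (simp add: y0)
    show "s \<in> {-k..k}" using s by auto
    fix s assume s: "s \<in> {-k..k}"
    have sO: "(y s, y t) \<in> M_dom e" "M e (y s, y t) \<in> ball x0 r"
      using inO[of s t] s t by (auto simp: O'_def)
    show "M e (y s, y t) \<in> cball x0 r" using sO by auto
    show "y (s + t) \<in> cball x0 r" using s t k by (intro yb) auto
    have "((\<lambda>s. M e (y s, y t)) has_derivative (\<lambda>h. fd (M e) (y s, y t) (h *\<^sub>R ?f (y s), 0))) (at s)"
    proof -
      have "(y has_derivative (\<lambda>h. h *\<^sub>R ?f (y s))) (at s)"
        using dy[of s] s k by (auto simp: has_vector_derivative_def)
      from has_derivative_compose[OF this has_derivative_partial_fst[OF M_differentiable[OF sO(1)]]]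
      show ?thesis .
    qed
    also have "(\<lambda>h. fd (M e) (y s, y t) (h *\<^sub>R ?f (y s), 0)) = (\<lambda>h. h *\<^sub>R ?f (M e (y s, y t)))"
      using linear_scale[OF linear_fd[OF M_differentiable[OF sO(1)]], of _ "(?f (y s), 0)"]
      by (simp add: R_equivariant[OF sO(1)])
    finally show "((\<lambda>s. M e (y s, y t)) has_vector_derivative ?f (M e (y s, y t))) (at s within {-k..k})"
      unfolding has_vector_derivative_def by (rule has_derivative_at_withinI)
    have st: "s + t \<in> {-d<..<d}" using s t k by auto
    have "((\<lambda>s. s + t) has_derivative (\<lambda>h. h)) (at s)"
      by (auto intro!: derivative_eq_intros)
    from has_derivative_compose[OF this, of y "\<lambda>h. h *\<^sub>R ?f (y (s + t))"]
    have "((\<lambda>s. y (s + t)) has_derivative (\<lambda>h. h *\<^sub>R ?f (y (s + t)))) (at s)"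
      using dy[OF st] by (simp add: has_vector_derivative_def)
    then show "((\<lambda>s. y (s + t)) has_vector_derivative ?f (y (s + t))) (at s within {-k..k})"
      unfolding has_vector_derivative_def by (rule has_derivative_at_withinI)
  qed
  have "ci e (y (s + t)) = ci e (y s) \<odot> ci e (y t)" if "\<bar>s\<bar> \<le> k" "\<bar>t\<bar> \<le> k" for s t
    using hom[OF that] inO[OF that] by (simp add: O'_def ci_M flip: hom[OF that])
  then obtain \<Gamma> where \<Gamma>: "\<And>s t. \<Gamma> (s + t) = \<Gamma> s \<odot> \<Gamma> t" "\<And>t. \<bar>t\<bar> \<le> k \<Longrightarrow> \<Gamma> t = ci e (y t)"
    using local_hom_extends[of k "\<lambda>t. ci e (y t)"] k(1) by blast
  have \<Gamma>0: "\<Gamma> 0 = e" using \<Gamma>(2)[of 0] k y0 by simp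
  \<comment> \<open>Near an arbitrary time \<open>t\<close> the curve is \<open>\<Gamma> t\<close>
    times the local solution, so smoothness follows from that of left translation.\<close>
  have "smooth_map vector_atlas (atlas G) \<Gamma>"
  proof (rule smooth_map_local[OF smooth_manifold_vector_atlas mfd])
    fix t :: real
    let ?q = "\<Gamma> t"
    define X where "X = {z \<in> cran e. ?q \<odot> ci e z \<in> cdom ?q}"
    have X: "open X" unfolding X_def by (rule smooth_map_open_chart[OF left_translation_smooth mfd mfd])
    have ball: "s - t \<in> {-d<..<d}" if "s \<in> ball t k" for s
      using that k by (auto simp: dist_real_def)
    have ysh: "smooth_on (ball t k) (\<lambda>s. y (s - t))"
      by (rule smooth_on_compose[OF open_ball _ smooth_on_diff[OF open_ball smooth_on_linear[OF bounded_linear_ident] smooth_on_const] ysm])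
        (use ball in blast)
    define W where "W = ball t k \<inter> (\<lambda>s. y (s - t)) -` X"
    have W: "open W" unfolding W_def
      by (rule continuous_open_preimage[OF smooth_on_continuous[OF ysh] open_ball X])
    have \<Gamma>W: "\<Gamma> s = ?q \<odot> ci e (y (s - t))" if "s \<in> W" for s
      using \<Gamma>(1)[of t "s - t"] \<Gamma>(2)[of "s - t"] that by (auto simp: W_def dist_real_def)
    have sm: "smooth_on W (\<lambda>s. cm ?q (?q \<odot> ci e (y (s - t))))"
      by (rule smooth_on_compose[OF W _ _ smooth_mapD(2)[OF left_translation_smooth mfd, of e ?q ?q]])
        (use smooth_on_subset[OF ysh, of W] in \<open>auto simp: W_def X_def\<close>)
    have dom: "\<Gamma> s \<in> cdom ?q" if s: "s \<in> W" for s
      unfolding \<Gamma>W[OF s] using s by (simp add: W_def X_def)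
    have "smooth_on W (\<lambda>s. cm ?q (\<Gamma> s))"
      by (rule smooth_on_cong[OF W _ sm]) (simp only: \<Gamma>W)
    moreover have "t \<in> W" using k by (simp add: W_def X_def y0)
    ultimately show "\<exists>p q W. t \<in> chart_dom vector_atlas p \<and> open W \<and> chart_map vector_atlas p t \<in> W \<and>
        W \<subseteq> chart_ran vector_atlas p \<and> (\<forall>z\<in>W. \<Gamma> (chart_inv vector_atlas p z) \<in> cdom q) \<and>
        smooth_on W (\<lambda>z. cm q (\<Gamma> (chart_inv vector_atlas p z)))"
      using W dom by (intro exI[of _ t] exI[of _ ?q] exI[of _ W]) simp
  qed
  moreover have "tangent_map vector_atlas (atlas G) \<Gamma> 0 1 = \<xi>"
  proof -
    have "(y has_derivative (\<lambda>h. h *\<^sub>R \<xi>)) (at 0)"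
      using dy[of 0] d by (simp add: has_vector_derivative_def y0)
    then have "((cm e \<circ> \<Gamma> \<circ> (\<lambda>v. v)) has_derivative (\<lambda>h. h *\<^sub>R \<xi>)) (at 0)"
    proof (rule has_derivative_transform_within_open[of _ _ _ _ "ball 0 k"])
      fix s :: real assume "s \<in> ball 0 k"
      then have s: "\<bar>s\<bar> \<le> k" "s \<in> {-d<..<d}" using k by (auto simp: dist_real_def)
      show "y s = (cm e \<circ> \<Gamma> \<circ> (\<lambda>v. v)) s"
        using yr[OF s(2)] by (simp add: \<Gamma>(2)[OF s(1)])
    qed (use k in auto)
    from fd_eq[OF this] show ?thesis
      by (simp add: tangent_map_def \<Gamma>0)
  qed
  ultimately show ?thesis
    unfolding one_parameter_subgroup_def using \<Gamma>(1) by blast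
qed

text \<open>Differentiating \<open>\<gamma> (h + s) = \<gamma> h \<odot> \<gamma> s\<close> at
  \<open>h = 0\<close> turns the initial velocity into the velocity at \<open>s\<close>: the curve
  is an integral curve of the right invariant field.\<close>

lemma one_parameter_subgroup_ode:
  assumes \<gamma>: "one_parameter_subgroup G \<xi> \<gamma>"
  obtains d where "d > 0" "\<gamma> 0 = e" "\<And>s. \<bar>s\<bar> < d \<Longrightarrow> \<gamma> s \<in> cdom e"
    "\<And>s. \<bar>s\<bar> < d \<Longrightarrow> ((\<lambda>s. cm e (\<gamma> s)) has_vector_derivative R e (cm e (\<gamma> s)) \<xi>) (at s)"
proof -
  have sm: "smooth_map vector_atlas (atlas G) \<gamma>" and hom: "\<And>s t. \<gamma> (s + t) = \<gamma> s \<odot> \<gamma> t"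
    and tan: "tangent_map vector_atlas (atlas G) \<gamma> 0 1 = \<xi>"
    using \<gamma> unfolding one_parameter_subgroup_def by blast+
  note v = smooth_manifold_vector_atlas
  have \<gamma>0: "\<gamma> 0 = e" using hom[of 0 0] idempotent_unit by simp
  have "open (\<gamma> -` cdom e)"
    by (rule open_vimage[OF open_dom smooth_mapD(1)[OF sm v]])
  then obtain d where d: "d > 0" "ball 0 d \<subseteq> \<gamma> -` cdom e"
    using \<gamma>0 by (auto elim!: openE)
  have cdom: "\<gamma> s \<in> cdom e" if "\<bar>s\<bar> < d" for s
    using d(2) that by (auto simp: subset_iff dist_real_def)
  have "smooth_on {z \<in> chart_ran vector_atlas 0. \<gamma> (chart_inv vector_atlas 0 z) \<in> cdom e}
      (\<lambda>z. cm e (\<gamma> (chart_inv vector_atlas 0 z)))"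
    by (rule smooth_mapD(2)[OF sm v])
  then have diff0: "(\<lambda>s. cm e (\<gamma> s)) differentiable (at 0)"
    using \<gamma>0 by (intro smooth_on_differentiable) auto
  moreover have "fd (\<lambda>s. cm e (\<gamma> s)) 0 1 = \<xi>"
    using tan by (simp add: tangent_map_def \<gamma>0 o_def)
  ultimately have "fd (\<lambda>s. cm e (\<gamma> s)) 0 = (\<lambda>h. h *\<^sub>R \<xi>)"
    using linear_scale[OF linear_fd, of "\<lambda>s. cm e (\<gamma> s)" 0 _ 1] by (intro ext) simp
  then have d0: "((\<lambda>s. cm e (\<gamma> s)) has_derivative (\<lambda>h. h *\<^sub>R \<xi>)) (at 0)"
    using fd_has_derivative[OF diff0] by simp
  show ?thesis
  proof (rule that[OF d(1) \<gamma>0 cdom])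
    fix s assume s: "\<bar>s\<bar> < d"
    let ?w = "\<lambda>s. cm e (\<gamma> s)"
    have ws: "?w s \<in> cran e" using cdom[OF s] by simp
    have w0: "?w 0 = x0" by (simp add: \<gamma>0 x0_def)
    have "((\<lambda>h. M e (?w h, ?w s)) has_derivative (\<lambda>h. R e (?w s) (h *\<^sub>R \<xi>))) (at 0)"
      by (rule has_derivative_compose[OF d0]) (use M_deriv_fst[OF ws] in \<open>simp add: w0\<close>)
    then have "((\<lambda>h. ?w (h + s)) has_derivative (\<lambda>h. R e (?w s) (h *\<^sub>R \<xi>))) (at 0)"
      by (rule has_derivative_transform_within_open[of _ _ _ _ "ball 0 d"])
        (use d cdom s in \<open>auto simp: M_def hom dist_real_def\<close>)
    then have 1: "((\<lambda>h. ?w (h + s)) has_derivative (\<lambda>h. h *\<^sub>R R e (?w s) \<xi>)) (at (s - s))"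
      by (simp add: linear_scale[OF linear_R[OF ws]])
    have 2: "((\<lambda>t. t - s) has_derivative (\<lambda>h. h)) (at s)"
      by (auto intro!: derivative_eq_intros)
    show "(?w has_vector_derivative R e (?w s) \<xi>) (at s)"
      using has_derivative_compose[OF 2 1] by (simp add: has_vector_derivative_def)
  qed
qed

text \<open>Both curves solve the same equation near time 0 and agree there; the homomorphism
  property spreads the equality to all times.\<close>

lemma one_parameter_subgroup_unique:
  assumes \<gamma>: "one_parameter_subgroup G \<xi> \<gamma>" and \<gamma>': "one_parameter_subgroup G \<xi> \<gamma>'"
  shows "\<gamma> = \<gamma>'"
proof -
  let ?f = "\<lambda>z. R e z \<xi>"
  obtain r L where r: "r > 0" "L > 0" "cball x0 r \<subseteq> cran e"
    and lip: "\<And>x y. x \<in> cball x0 r \<Longrightarrow> y \<in> cball x0 r \<Longrightarrow> norm (?f x - ?f y) \<le> L * norm (x - y)"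
    by (rule smooth_on_lipschitz_ball[OF open_ran x0_ran R_smooth]) blast
  obtain d where d: "d > 0" "\<gamma> 0 = e" "\<And>s. \<bar>s\<bar> < d \<Longrightarrow> \<gamma> s \<in> cdom e"
    "\<And>s. \<bar>s\<bar> < d \<Longrightarrow> ((\<lambda>s. cm e (\<gamma> s)) has_vector_derivative ?f (cm e (\<gamma> s))) (at s)"
    using one_parameter_subgroup_ode[OF \<gamma>] by blast
  obtain d' where d': "d' > 0" "\<gamma>' 0 = e" "\<And>s. \<bar>s\<bar> < d' \<Longrightarrow> \<gamma>' s \<in> cdom e"
    "\<And>s. \<bar>s\<bar> < d' \<Longrightarrow> ((\<lambda>s. cm e (\<gamma>' s)) has_vector_derivative ?f (cm e (\<gamma>' s))) (at s)"
    using one_parameter_subgroup_ode[OF \<gamma>'] by blast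
  have near: "\<exists>k>0. \<forall>s. \<bar>s\<bar> \<le> k \<longrightarrow> cm e (\<gamma> s) \<in> cball x0 r"
    if "\<gamma> 0 = e" "d > 0" "\<And>s. \<bar>s\<bar> < d \<Longrightarrow> ((\<lambda>s. cm e (\<gamma> s)) has_vector_derivative ?f (cm e (\<gamma> s))) (at s)"
    for \<gamma> and d :: real
  proof -
    have "isCont (\<lambda>s. cm e (\<gamma> s)) 0"
      using has_vector_derivative_continuous[OF that(3)[of 0]] that(2) by simp
    then obtain k where "k > 0" "\<And>s. dist s 0 < k \<Longrightarrow> dist (cm e (\<gamma> s)) (cm e (\<gamma> 0)) < r"
      using r(1) unfolding continuous_at_eps_delta by blast
    then show ?thesis
      using that(1) by (intro exI[of _ "k / 2"]) (auto simp: x0_def dist_commute intro: less_imp_le)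
  qed
  obtain k where k: "k > 0" "\<And>s. \<bar>s\<bar> \<le> k \<Longrightarrow> cm e (\<gamma> s) \<in> cball x0 r"
    using near[OF d(2,1,4)] by blast
  obtain k' where k': "k' > 0" "\<And>s. \<bar>s\<bar> \<le> k' \<Longrightarrow> cm e (\<gamma>' s) \<in> cball x0 r"
    using near[OF d'(2,1,4)] by blast
  \<comment> \<open>Up to time \<open>l\<close> both curves satisfy the equation and stay in the
    Lipschitz ball, and \<open>L * l < 1\<close>.\<close>
  define l where "l = min (min k k') (min (min (d / 2) (d' / 2)) (1 / (2 * L)))"
  have "l > 0" using d(1) d'(1) k(1) k'(1) r(2) by (simp add: l_def)
  moreover have "l \<le> k" "l \<le> k'" "l \<le> d / 2" "l \<le> d' / 2" "l \<le> 1 / (2 * L)"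
    by (auto simp: l_def)
  moreover from this have "L * l \<le> 1 / 2"
    using mult_left_mono[of l "1 / (2 * L)" L] r(2) by simp
  ultimately have l: "l > 0" "l \<le> k" "l \<le> k'" "l < d" "l < d'" "L * l < 1"
    using d(1) d'(1) by linarith+
  have eq: "cm e (\<gamma> t) = cm e (\<gamma>' t)" if t: "\<bar>t\<bar> \<le> l" for t
  proof (rule ode_unique[where B = "cball x0 r" and f = ?f and d = l and L = L])
    show "norm (?f x - ?f y) \<le> L * norm (x - y)" if "x \<in> cball x0 r" "y \<in> cball x0 r" for x y
      by (rule lip[OF that])
    show "0 \<le> L" "0 \<le> l" "L * l < 1" using r l by auto
    show "cm e (\<gamma> 0) = cm e (\<gamma>' 0)" by (simp add: d(2) d'(2))
    show "t \<in> {-l..l}" using t by auto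
    fix s assume "s \<in> {-l..l}"
    then have s: "\<bar>s\<bar> \<le> l" by auto
    show "cm e (\<gamma> s) \<in> cball x0 r" "cm e (\<gamma>' s) \<in> cball x0 r"
      using k(2)[of s] k'(2)[of s] s l by auto
    show "((\<lambda>s. cm e (\<gamma> s)) has_vector_derivative ?f (cm e (\<gamma> s))) (at s within {-l..l})"
      "((\<lambda>s. cm e (\<gamma>' s)) has_vector_derivative ?f (cm e (\<gamma>' s))) (at s within {-l..l})"
      using d(4)[of s] d'(4)[of s] s l by (auto intro: has_vector_derivative_at_within)
  qed
  have "\<gamma> t = \<gamma>' t" if t: "\<bar>t\<bar> \<le> l" for t
    using arg_cong[OF eq[OF t], of "ci e"] d(3)[of t] d'(3)[of t] t l by simp
  then show ?thesis
    using hom_eq_near_0[of \<gamma> \<gamma>' l] \<gamma> \<gamma>' l(1) unfolding one_parameter_subgroup_def by blast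
qed

text \<open>Uniqueness resolves the definite description in \<open>lie_exp\<close>; rescaling time
  in \<open>\<gamma>\<close> yields the one-parameter subgroup of
  \<open>t *\<^sub>R \<xi>\<close>.\<close>

lemma lie_exp_eq:
  assumes \<gamma>: "one_parameter_subgroup G \<xi> \<gamma>"
  shows "lie_exp G (t *\<^sub>R \<xi>) = \<gamma> t"
proof -
  have sm: "smooth_map vector_atlas (atlas G) \<gamma>" and hom: "\<And>s t. \<gamma> (s + t) = \<gamma> s \<odot> \<gamma> t"
    using \<gamma> unfolding one_parameter_subgroup_def by blast+
  note v = smooth_manifold_vector_atlas
  have lin: "smooth_map vector_atlas vector_atlas (\<lambda>s. t * s)"
    by (rule smooth_map_local[OF v v])
      (auto intro!: exI[of _ 0] exI[of _ UNIV] smooth_on_linear bounded_linear_mult_right)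
  obtain d where d: "d > 0" "\<gamma> 0 = e" "\<And>s. \<bar>s\<bar> < d \<Longrightarrow> \<gamma> s \<in> cdom e"
    "\<And>s. \<bar>s\<bar> < d \<Longrightarrow> ((\<lambda>s. cm e (\<gamma> s)) has_vector_derivative R e (cm e (\<gamma> s)) \<xi>) (at s)"
    using one_parameter_subgroup_ode[OF \<gamma>] by blast
  have "((\<lambda>s. cm e (\<gamma> s)) has_derivative (\<lambda>h. h *\<^sub>R \<xi>)) (at (t * 0))"
    using d(4)[of 0] d(1) by (simp add: d(2) has_vector_derivative_def flip: x0_def)
  moreover have "((\<lambda>s. t * s) has_derivative (\<lambda>s. t * s)) (at 0)"
    by (rule bounded_linear_imp_has_derivative[OF bounded_linear_mult_right])
  ultimately have "((\<lambda>s. cm e (\<gamma> (t * s))) has_derivative (\<lambda>h. (t * h) *\<^sub>R \<xi>)) (at 0)"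
    using has_derivative_compose by blast
  then have "tangent_map vector_atlas (atlas G) (\<lambda>s. \<gamma> (t * s)) 0 1 = t *\<^sub>R \<xi>"
    using fd_eq by (fastforce simp: tangent_map_def d(2) o_def)
  then have "one_parameter_subgroup G (t *\<^sub>R \<xi>) (\<lambda>s. \<gamma> (t * s))"
    unfolding one_parameter_subgroup_def
    using smooth_map_compose[OF v v mfd lin sm] hom by (simp add: distrib_left)
  then have "(THE \<gamma>. one_parameter_subgroup G (t *\<^sub>R \<xi>) \<gamma>) = (\<lambda>s. \<gamma> (t * s))"
    using one_parameter_subgroup_unique by blast
  then show ?thesis by (simp add: lie_exp_def)
qed

subsection \<open>The Lie bracket\<close>

definition "conj_dom = {p. fst p \<in> cran e \<and> snd p \<in> cran e \<and>
   inverse_of G (ci e (snd p)) \<odot> ci e (fst p) \<odot> ci e (snd p) \<in> cdom e}"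

text \<open>The first slot is the element being conjugated, so the derivative in it at
  \<open>x0\<close> is \<open>Ad\<close> at the group element of the second slot.\<close>

definition "Cj p = cm e (inverse_of G (ci e (snd p)) \<odot> ci e (fst p) \<odot> ci e (snd p))"

lemma conj_smooth_map:
  "smooth_map (prod_atlas (atlas G) (atlas G)) (atlas G) (\<lambda>p. inverse_of G (snd p) \<odot> fst p \<odot> snd p)"
proof -
  note f = smooth_map_fst[OF mfd mfd] and s = smooth_map_snd[OF mfd mfd]
  have "smooth_map (prod_atlas (atlas G) (atlas G)) (atlas G) (\<lambda>p. inverse_of G (snd p) \<odot> fst p)"
    using smooth_map_compose[OF mfd2 mfd2 mfd
        smooth_map_Pair[OF mfd2 mfd mfd smooth_map_compose[OF mfd2 mfd mfd s inv_smooth] f] mul_smooth] by simp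
  from smooth_map_compose[OF mfd2 mfd2 mfd smooth_map_Pair[OF mfd2 mfd mfd this s] mul_smooth]
  show ?thesis by simp
qed

lemma conj_dom_eq:
  "conj_dom = {z \<in> chart_ran (prod_atlas (atlas G) (atlas G)) (e, e).
     (\<lambda>p. inverse_of G (snd p) \<odot> fst p \<odot> snd p) (chart_inv (prod_atlas (atlas G) (atlas G)) (e, e) z) \<in> cdom e}"
  unfolding conj_dom_def chart_ran_prod by (auto simp: mem_Times_iff chart_inv_prod[OF mfd mfd])

lemma open_conj_dom: "open conj_dom"
  unfolding conj_dom_eq by (rule smooth_map_open_chart[OF conj_smooth_map mfd2 mfd])

lemma Cj_smooth: "smooth_on conj_dom Cj"
proof (rule smooth_on_cong[OF open_conj_dom])
  show "smooth_on conj_dom (\<lambda>z. cm e ((\<lambda>p. inverse_of G (snd p) \<odot> fst p \<odot> snd p)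
      (chart_inv (prod_atlas (atlas G) (atlas G)) (e, e) z)))"
    unfolding conj_dom_eq by (rule smooth_mapD(2)[OF conj_smooth_map mfd2])
  fix p assume "p \<in> conj_dom"
  then show "cm e ((\<lambda>p. inverse_of G (snd p) \<odot> fst p \<odot> snd p)
      (chart_inv (prod_atlas (atlas G) (atlas G)) (e, e) p)) = Cj p"
    by (cases p) (simp add: conj_dom_def Cj_def chart_inv_prod[OF mfd mfd])
qed

lemma x0_conj_dom: "z \<in> cran e \<Longrightarrow> (x0, z) \<in> conj_dom"
  by (simp add: conj_dom_def)

lemma Cj_x0: "z \<in> cran e \<Longrightarrow> Cj (x0, z) = x0"
  by (simp add: Cj_def x0_def)

definition "AdC z \<eta> = fd Cj (x0, z) (\<eta>, 0)"

lemma Cj_deriv: "z \<in> cran e \<Longrightarrow> ((\<lambda>x. Cj (x, z)) has_derivative AdC z) (at x0)"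
  unfolding AdC_def[abs_def]
  by (rule has_derivative_partial_fst[OF smooth_on_differentiable[OF Cj_smooth x0_conj_dom]])

lemma Ad_eq: "z \<in> cran e \<Longrightarrow> Ad G (ci e z) \<eta> = AdC z \<eta>"
proof -
  assume z: "z \<in> cran e"
  have "(\<lambda>x. Cj (x, z)) = cm (inverse_of G (ci e z) \<odot> e \<odot> ci e z) \<circ> (\<lambda>h. inverse_of G (ci e z) \<odot> h \<odot> ci e z) \<circ> ci e"
    by (auto simp: Cj_def)
  then show ?thesis
    unfolding Ad_def tangent_map_def using fd_eq[OF Cj_deriv[OF z]] by (simp add: x0_def)
qed

lemma AdC_smooth: "smooth_on (cran e) (\<lambda>z. AdC z \<eta>)"
  unfolding AdC_def
  by (rule smooth_on_fd_apply[OF open_ran _ Cj_smooth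
        smooth_on_Pair[OF open_ran smooth_on_const smooth_on_linear[OF bounded_linear_ident]] smooth_on_const])
    (auto simp: x0_conj_dom)

text \<open>Differentiating \<open>z \<cdot> (z\<inverse> x z) = x \<cdot> z\<close> in \<open>x\<close> avoids differentiating the inversion.\<close>

lemma M_AdC:
  assumes z: "z \<in> cran e"
  shows "fd (M e) (z, x0) (0, AdC z \<eta>) = R e z \<eta>"
proof -
  let ?N = "{x. (x, z) \<in> conj_dom}"
  have "open ((\<lambda>x. (x, z)) -` conj_dom)"
    by (intro open_vimage open_conj_dom continuous_intros)
  then have N: "open ?N" by (simp add: vimage_def)
  have d: "M e differentiable (at (z, Cj (x0, z)))"
    by (rule M_differentiable) (simp add: Cj_x0[OF z] z)
  have "((\<lambda>x. M e (z, Cj (x, z))) has_derivative (\<lambda>\<eta>. fd (M e) (z, Cj (x0, z)) (0, AdC z \<eta>))) (at x0)"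
    by (rule has_derivative_compose[OF Cj_deriv[OF z] has_derivative_partial_snd[OF d]])
  then have 1: "((\<lambda>x. M e (x, z)) has_derivative (\<lambda>\<eta>. fd (M e) (z, Cj (x0, z)) (0, AdC z \<eta>))) (at x0)"
  proof (rule has_derivative_transform_within_open[OF _ N])
    show "x0 \<in> ?N" using x0_conj_dom[OF z] by simp
    fix x assume "x \<in> ?N"
    then show "M e (z, Cj (x, z)) = M e (x, z)"
      by (simp add: M_def Cj_def conj_dom_def mult_assoc) (simp flip: mult_assoc)
  qed
  from fun_cong[OF has_derivative_unique[OF 1 M_deriv_fst[OF z]], of \<eta>] show ?thesis
    by (simp add: Cj_x0[OF z])
qed

lemma M_x0_snd: "fd (M e) (x0, x0) (0, v) = v"
proof -
  have "((\<lambda>z. M e (x0, z)) has_derivative (\<lambda>b. fd (M e) (x0, x0) (0, b))) (at x0)"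
    by (rule has_derivative_partial_snd[OF M_differentiable]) simp
  then have "((\<lambda>z. z) has_derivative (\<lambda>b. fd (M e) (x0, x0) (0, b))) (at x0)"
    by (rule has_derivative_transform_within_open[OF _ open_ran x0_ran]) simp
  from fun_cong[OF has_derivative_unique[OF this has_derivative_ident], of v] show ?thesis .
qed

lemma AdC_x0: "AdC x0 \<eta> = \<eta>"
  using M_AdC[OF x0_ran, of \<eta>] by (simp add: M_x0_snd)

text \<open>Differentiating \<open>M_AdC\<close> in \<open>z\<close> at the identity gives
  \<open>Bm \<eta> \<xi>\<close> on one side, and on the other a mixed second derivative of the
  multiplication plus the wanted derivative. By symmetry the mixed term is
  \<open>Bm \<xi> \<eta>\<close>, and the difference is \<open>lb \<xi> \<eta>\<close>.\<close>

lemma AdC_derivative: "((\<lambda>z. AdC z \<eta>) has_derivative (\<lambda>\<xi>. lb \<xi> \<eta>)) (at x0)"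
proof -
  have dA: "((\<lambda>z. AdC z \<eta>) has_derivative fd (\<lambda>z. AdC z \<eta>) x0) (at x0)"
    by (rule fd_has_derivative[OF smooth_on_differentiable[OF AdC_smooth x0_ran]])
  have "((\<lambda>q. AdC (fst q) \<eta>) has_derivative (\<lambda>w. fd (\<lambda>z. AdC z \<eta>) x0 (fst w))) (at (x0, x0))"
    using has_derivative_compose[OF has_derivative_fst[OF has_derivative_ident], of "\<lambda>z. AdC z \<eta>" _ "(x0, x0)"] dA by simp
  then have u: "((\<lambda>q. (0 :: 'e, AdC (fst q) \<eta>)) has_derivative (\<lambda>w. (0, fd (\<lambda>z. AdC z \<eta>) x0 (fst w)))) (at (x0, x0))"
    by (intro has_derivative_Pair has_derivative_const)
  have 3: "((\<lambda>q. fd (M e) q (0, AdC (fst q) \<eta>)) has_derivative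
      (\<lambda>w. fd (\<lambda>q. fd (M e) q (0, \<eta>)) (x0, x0) w + fd (\<lambda>z. AdC z \<eta>) x0 (fst w))) (at (x0, x0))"
    using has_derivative_fd_apply[OF open_M_dom x0_M_dom[OF x0_ran] M_smooth u]
    by (simp add: M_x0_snd AdC_x0)
  have "((\<lambda>y. (y, x0)) has_derivative (\<lambda>b. (b, 0))) (at x0)"
    by (auto intro!: derivative_eq_intros)
  from has_derivative_compose[OF this 3]
  have "((\<lambda>z. fd (M e) (z, x0) (0, AdC z \<eta>)) has_derivative
      (\<lambda>\<xi>. fd (\<lambda>q. fd (M e) q (0, \<eta>)) (x0, x0) (\<xi>, 0) + fd (\<lambda>z. AdC z \<eta>) x0 \<xi>)) (at x0)"
    by simp
  then have "((\<lambda>z. R e z \<eta>) has_derivative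
      (\<lambda>\<xi>. fd (\<lambda>q. fd (M e) q (0, \<eta>)) (x0, x0) (\<xi>, 0) + fd (\<lambda>z. AdC z \<eta>) x0 \<xi>)) (at x0)"
    by (rule has_derivative_transform_within_open[OF _ open_ran x0_ran]) (simp add: M_AdC)
  from fun_cong[OF fd_eq[OF this]]
  have 4: "Bm \<eta> \<xi> = fd (\<lambda>q. fd (M e) q (0, \<eta>)) (x0, x0) (\<xi>, 0) + fd (\<lambda>z. AdC z \<eta>) x0 \<xi>" for \<xi>
    by (simp add: Bm_def)
  have 5: "fd (\<lambda>q. fd (M e) q (0, \<eta>)) (x0, x0) (\<xi>, 0) = Bm \<xi> \<eta>" for \<xi>
  proof -
    have "(\<lambda>q. fd (M e) q (\<xi>, 0)) differentiable (at (x0, x0))"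
      by (rule smooth_on_differentiable[OF smooth_on_fd[OF M_smooth]]) simp
    from fd_eq[OF has_derivative_partial_snd[OF this]]
    have "Bm \<xi> \<eta> = fd (\<lambda>q. fd (M e) q (\<xi>, 0)) (x0, x0) (0, \<eta>)"
      by (simp add: Bm_def R_def)
    then show ?thesis
      using second_derivative_symmetric[OF open_M_dom x0_M_dom[OF x0_ran] M_smooth, of "(0, \<eta>)" "(\<xi>, 0)"] by simp
  qed
  have "fd (\<lambda>z. AdC z \<eta>) x0 = (\<lambda>\<xi>. lb \<xi> \<eta>)"
    using 4 5 by (auto simp: lb_def)
  with dA show ?thesis by simp
qed

text \<open>By the chain rule along the one-parameter subgroup only its velocity at time 0
  enters.\<close>

lemma lie_bracket_eq: "lie_bracket G \<xi> \<eta> = lb \<xi> \<eta>"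
proof -
  obtain \<gamma> where \<gamma>: "one_parameter_subgroup G \<xi> \<gamma>"
    using one_parameter_subgroup_exists by blast
  obtain d where d: "d > 0" "\<gamma> 0 = e" "\<And>s. \<bar>s\<bar> < d \<Longrightarrow> \<gamma> s \<in> cdom e"
    "\<And>s. \<bar>s\<bar> < d \<Longrightarrow> ((\<lambda>s. cm e (\<gamma> s)) has_vector_derivative R e (cm e (\<gamma> s)) \<xi>) (at s)"
    using one_parameter_subgroup_ode[OF \<gamma>] by blast
  have "((\<lambda>s. cm e (\<gamma> s)) has_derivative (\<lambda>h. h *\<^sub>R \<xi>)) (at 0)"
    using d(4)[of 0] d(1) by (simp add: d(2) has_vector_derivative_def flip: x0_def)
  moreover have "((\<lambda>z. AdC z \<eta>) has_derivative (\<lambda>\<xi>. lb \<xi> \<eta>)) (at (cm e (\<gamma> 0)))"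
    using AdC_derivative by (simp add: d(2) flip: x0_def)
  ultimately have "((\<lambda>s. AdC (cm e (\<gamma> s)) \<eta>) has_derivative (\<lambda>h. lb (h *\<^sub>R \<xi>) \<eta>)) (at 0)"
    by (rule has_derivative_compose)
  then have "((\<lambda>s. Ad G (\<gamma> s) \<eta>) has_derivative (\<lambda>h. lb (h *\<^sub>R \<xi>) \<eta>)) (at 0)"
  proof (rule has_derivative_transform_within_open[of _ _ _ _ "ball 0 d"])
    fix s :: real assume "s \<in> ball 0 d"
    then have s: "\<gamma> s \<in> cdom e" using d(3)[of s] by (simp add: dist_real_def)
    then show "AdC (cm e (\<gamma> s)) \<eta> = Ad G (\<gamma> s) \<eta>"
      using Ad_eq[of "cm e (\<gamma> s)" \<eta>] by simp
  qed (use d in auto)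
  then have "((\<lambda>s. Ad G (\<gamma> s) \<eta>) has_vector_derivative lb \<xi> \<eta>) (at 0)"
    by (simp add: has_vector_derivative_def bounded_bilinear.scaleR_left[OF bilinear_lb])
  then show ?thesis
    unfolding lie_bracket_def lie_exp_eq[OF \<gamma>] by (rule vector_derivative_at)
qed

end

section \<open>The Poisson structure in a chart\<close>

type_synonym 'e dual = "'e \<Rightarrow>\<^sub>L real"
type_synonym 'e chart_point = "'e \<times> 'e dual \<times> 'e dual"

text \<open>Everything that the Poisson structure takes from the group within one chart: fields
  \<open>R\<close> that represent the bracket \<open>lb\<close>. The Jacobi identity thus becomes
  calculus on an open subset of a vector space.\<close>

locale local_poisson =
  fixes V :: "'e::finite_dim_normed set" and R :: "'e \<Rightarrow> 'e \<Rightarrow> 'e" and lb :: "'e \<Rightarrow> 'e \<Rightarrow> 'e"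
  assumes open_V: "open V"
    and R_linear: "z \<in> V \<Longrightarrow> linear (R z)"
    and R_smooth: "smooth_on V (\<lambda>z. R z a)"
    and lb_bilinear: "bounded_bilinear lb"
    and lb_antisym: "lb a b = - lb b a"
    and lb_jacobi: "lb (lb a b) c + lb (lb b c) a + lb (lb c a) b = 0"
    and R_commutator: "z \<in> V \<Longrightarrow>
      fd (\<lambda>z. R z a) z (R z b) - fd (\<lambda>z. R z b) z (R z a) = R z (lb b a)"
begin

sublocale lb: bounded_bilinear lb by (rule lb_bilinear)

text \<open>The domain in which the chart point varies, not the symplectic form.\<close>

definition \<Omega> :: "'e chart_point set" where "\<Omega> = V \<times> UNIV"

lemma open_\<Omega>: "open \<Omega>"
  unfolding \<Omega>_def by (intro open_Times open_V open_UNIV)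

definition gm :: "('e chart_point \<Rightarrow> real) \<Rightarrow> 'e chart_point \<Rightarrow> 'e" where
  "gm F p = bidual_vector (\<lambda>\<alpha>. fd F p (0, \<alpha>, 0))"

definition gn :: "('e chart_point \<Rightarrow> real) \<Rightarrow> 'e chart_point \<Rightarrow> 'e" where
  "gn F p = bidual_vector (\<lambda>\<alpha>. fd F p (0, 0, \<alpha>))"

text \<open>The bracket formula with the dual of right translation moved to the other side of the
  pairing: the differential is evaluated on \<open>R (fst p) a\<close>.\<close>

definition br :: "('e chart_point \<Rightarrow> real) \<Rightarrow> ('e chart_point \<Rightarrow> real) \<Rightarrow>
    'e chart_point \<Rightarrow> real" where
  "br F K p = fd K p (R (fst p) (gm F p), 0) - fd F p (R (fst p) (gm K p), 0)
     + \<langle>fst (snd p), lb (gm F p) (gm K p)\<rangle>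
     + \<langle>snd (snd p), lb (gm F p) (gn K p) - lb (gm K p) (gn F p)\<rangle>"

lemma br_antisym: "br F K p = - br K F p"
  unfolding br_def by (subst lb_antisym[of "gm K p" "gm F p"]) (simp add: blinfun.minus_right blinfun.diff_right)

lemma fd_linear: "smooth_on \<Omega> F \<Longrightarrow> p \<in> \<Omega> \<Longrightarrow> linear (fd F p)"
  by (rule linear_fd[OF smooth_on_differentiable])

lemma linear_fd_mu:
  assumes "smooth_on \<Omega> F" "p \<in> \<Omega>"
  shows "linear (\<lambda>\<alpha>. fd F p (0, \<alpha>, 0))" "linear (\<lambda>\<alpha>. fd F p (0, 0, \<alpha>))"
proof -
  have "linear (\<lambda>\<alpha>::'e dual. (0::'e, \<alpha>, 0::'e dual))" "linear (\<lambda>\<alpha>::'e dual. (0::'e, 0::'e dual, \<alpha>))"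
    by (auto simp: linear_iff)
  from this[THEN linear_compose, OF fd_linear[OF assms]]
  show "linear (\<lambda>\<alpha>. fd F p (0, \<alpha>, 0))" "linear (\<lambda>\<alpha>. fd F p (0, 0, \<alpha>))"
    by (simp_all add: o_def)
qed

lemma pairing_gm: "smooth_on \<Omega> F \<Longrightarrow> p \<in> \<Omega> \<Longrightarrow> \<langle>\<alpha>, gm F p\<rangle> = fd F p (0, \<alpha>, 0)"
  and pairing_gn: "smooth_on \<Omega> F \<Longrightarrow> p \<in> \<Omega> \<Longrightarrow> \<langle>\<alpha>, gn F p\<rangle> = fd F p (0, 0, \<alpha>)"
  unfolding gm_def gn_def by (simp_all add: pairing_bidual_vector linear_fd_mu)

lemma gm_smooth: "smooth_on \<Omega> F \<Longrightarrow> smooth_on \<Omega> (gm F)"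
  and gn_smooth: "smooth_on \<Omega> F \<Longrightarrow> smooth_on \<Omega> (gn F)"
proof -
  assume F: "smooth_on \<Omega> F"
  have s: "smooth_on \<Omega> (\<lambda>p. \<Sum>b\<in>fbasis. fd F p (v b) *\<^sub>R (b :: 'e))" for v
    by (intro smooth_on_sum open_\<Omega> smooth_on_bilinear[OF bounded_bilinear_scaleR] smooth_on_fd[OF F] smooth_on_const)
  show "smooth_on \<Omega> (gm F)"
    by (rule smooth_on_cong[OF open_\<Omega> _ s]) (simp add: gm_def bidual_vector_eq linear_fd_mu[OF F])
  show "smooth_on \<Omega> (gn F)"
    by (rule smooth_on_cong[OF open_\<Omega> _ s]) (simp add: gn_def bidual_vector_eq linear_fd_mu[OF F])
qed

lemma R_fst_smooth: "smooth_on \<Omega> (\<lambda>p. R (fst p) a)"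
  by (rule smooth_on_compose[OF open_\<Omega> _ smooth_on_linear[OF bounded_linear_fst] R_smooth]) (auto simp: \<Omega>_def)

lemma R_fst_linear: "p \<in> \<Omega> \<Longrightarrow> linear (R (fst p))"
  by (rule R_linear) (auto simp: \<Omega>_def)

lemma R_gm_smooth: "smooth_on \<Omega> F \<Longrightarrow> smooth_on \<Omega> (\<lambda>p. R (fst p) (gm F p))"
  by (rule smooth_on_linear_family[OF open_\<Omega> R_fst_linear R_fst_smooth gm_smooth])

lemma br_smooth:
  assumes F: "smooth_on \<Omega> F" and K: "smooth_on \<Omega> K"
  shows "smooth_on \<Omega> (br F K)"
proof -
  note o = open_\<Omega>
  have fs: "smooth_on \<Omega> (\<lambda>p. fst (snd p))" "smooth_on \<Omega> (\<lambda>p. snd (snd p))"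
    by (intro smooth_on_linear bounded_linear_compose[OF bounded_linear_fst bounded_linear_snd]
        bounded_linear_compose[OF bounded_linear_snd bounded_linear_snd])+
  have fdR: "smooth_on \<Omega> (\<lambda>p. fd F p (R (fst p) (gm K p), 0))"
    if "smooth_on \<Omega> F" "smooth_on \<Omega> K" for F K
    by (rule smooth_on_fd_apply[OF o _ that(1) smooth_on_linear[OF bounded_linear_ident]
          smooth_on_Pair[OF o R_gm_smooth[OF that(2)] smooth_on_const]]) auto
  note lbs = smooth_on_bilinear[OF lb_bilinear o]
  note prs = smooth_on_bilinear[OF bounded_bilinear_blinfun_apply o]
  show ?thesis
    unfolding br_def[abs_def]
    by (rule smooth_on_add[OF o smooth_on_add[OF o smooth_on_diff[OF o fdR[OF K F] fdR[OF F K]]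
            prs[OF fs(1) lbs[OF gm_smooth[OF F] gm_smooth[OF K]]]]
          prs[OF fs(2) smooth_on_diff[OF o lbs[OF gm_smooth[OF F] gn_smooth[OF K]] lbs[OF gm_smooth[OF K] gn_smooth[OF F]]]]])
qed

section \<open>Hamiltonian vector fields and the Jacobi identity in a chart\<close>

definition mdot :: "('e chart_point \<Rightarrow> real) \<Rightarrow> 'e chart_point \<Rightarrow> 'e dual" where
  "mdot F p = Blinfun (\<lambda>a. - fd F p (R (fst p) a, 0) + \<langle>fst (snd p), lb (gm F p) a\<rangle> - \<langle>snd (snd p), lb a (gn F p)\<rangle>)"

definition ndot :: "('e chart_point \<Rightarrow> real) \<Rightarrow> 'e chart_point \<Rightarrow> 'e dual" where
  "ndot F p = Blinfun (\<lambda>b. \<langle>snd (snd p), lb (gm F p) b\<rangle>)"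

text \<open>The components are found by collecting in \<open>br F K\<close> the coefficients of
  \<open>gm K\<close> and \<open>gn K\<close>, including the hidden one in
  \<open>R (fst p) (gm K p)\<close>, so that the derivative of every \<open>K\<close> along this
  field is \<open>br F K\<close>.\<close>

definition ham_field :: "('e chart_point \<Rightarrow> real) \<Rightarrow> 'e chart_point \<Rightarrow> 'e chart_point" where
  "ham_field F p = (R (fst p) (gm F p), mdot F p, ndot F p)"

lemma linear_fd_R:
  assumes "smooth_on \<Omega> F" "p \<in> \<Omega>"
  shows "linear (\<lambda>a. fd F p (R (fst p) a, 0))"
proof -
  have "linear (\<lambda>v. (v, 0 :: 'e dual \<times> 'e dual))" by (auto simp: linear_iff)
  from linear_compose[OF linear_compose[OF R_fst_linear[OF assms(2)] this] fd_linear[OF assms]]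
  show ?thesis by (simp add: o_def)
qed

lemma mdot_apply:
  assumes "smooth_on \<Omega> F" "p \<in> \<Omega>"
  shows "\<langle>mdot F p, a\<rangle> = - fd F p (R (fst p) a, 0) + \<langle>fst (snd p), lb (gm F p) a\<rangle> - \<langle>snd (snd p), lb a (gn F p)\<rangle>"
proof -
  note l = linear_fd_R[OF assms]
  have "linear (\<lambda>a. - fd F p (R (fst p) a, 0) + \<langle>fst (snd p), lb (gm F p) a\<rangle> - \<langle>snd (snd p), lb a (gn F p)\<rangle>)"
    by (rule linearI)
      (simp_all add: linear_add[OF l] linear_scale[OF l] lb.add_right lb.add_left lb.scaleR_right lb.scaleR_left
        blinfun.add_right blinfun.scaleR_right algebra_simps)
  then show ?thesis by (simp add: mdot_def Blinfun_apply_linear)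
qed

lemma ndot_apply: "\<langle>ndot F p, b\<rangle> = \<langle>snd (snd p), lb (gm F p) b\<rangle>"
proof -
  have "linear (\<lambda>b. \<langle>snd (snd p), lb (gm F p) b\<rangle>)"
    by (rule linearI) (simp_all add: lb.add_right lb.scaleR_right blinfun.add_right blinfun.scaleR_right)
  then show ?thesis by (simp add: ndot_def Blinfun_apply_linear)
qed

lemma fd_split:
  assumes K: "smooth_on \<Omega> K" and p: "p \<in> \<Omega>"
  shows "fd K p (a, \<alpha>, \<beta>) = fd K p (a, 0) + \<langle>\<alpha>, gm K p\<rangle> + \<langle>\<beta>, gn K p\<rangle>"
proof -
  have "fd K p (a, \<alpha>, \<beta>) = fd K p ((a, 0) + (0, \<alpha>, 0) + (0, 0, \<beta>))"
    by (simp add: zero_prod_def)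
  then show ?thesis
    by (simp only: linear_add[OF fd_linear[OF K p]] pairing_gm[OF K p] pairing_gn[OF K p])
qed

text \<open>In its second argument the bracket is the derivative along a vector field. Linearity,
  the product rule and the outer bracket in the Jacobi identity all use this form.\<close>

lemma br_eq_derivative:
  assumes F: "smooth_on \<Omega> F" and K: "smooth_on \<Omega> K" and p: "p \<in> \<Omega>"
  shows "br F K p = fd K p (ham_field F p)"
  unfolding ham_field_def fd_split[OF K p] mdot_apply[OF F p] ndot_apply br_def
  by (simp add: blinfun.diff_right)

definition D2 :: "('e chart_point \<Rightarrow> real) \<Rightarrow> 'e chart_point \<Rightarrow> _ \<Rightarrow> _ \<Rightarrow> real" where
  "D2 F p u w = fd (\<lambda>q. fd F q u) p w"

lemma D2_symmetric: "smooth_on \<Omega> F \<Longrightarrow> p \<in> \<Omega> \<Longrightarrow> D2 F p u w = D2 F p w u"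
  unfolding D2_def by (rule second_derivative_symmetric[OF open_\<Omega>])

text \<open>Second derivatives with one slot in a dual direction are derivatives of the gradients
  \<open>gm\<close> and \<open>gn\<close>; the split allows them to be reassembled into a single
  \<open>D2\<close>.\<close>

lemma D2_split:
  assumes K: "smooth_on \<Omega> K" and p: "p \<in> \<Omega>"
  shows "D2 K p (a, \<alpha>, \<beta>) w = D2 K p (a, 0) w + \<langle>\<alpha>, fd (gm K) p w\<rangle> + \<langle>\<beta>, fd (gn K) p w\<rangle>"
proof -
  have d: "((\<lambda>q. fd K q u) has_derivative D2 K p u) (at p)" for u
    unfolding D2_def by (rule fd_has_derivative[OF smooth_on_differentiable[OF smooth_on_fd[OF K] p]])
  have g: "((\<lambda>q. \<langle>\<alpha>, gm K q\<rangle>) has_derivative (\<lambda>w. \<langle>\<alpha>, fd (gm K) p w\<rangle>)) (at p)"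
    "((\<lambda>q. \<langle>\<beta>, gn K q\<rangle>) has_derivative (\<lambda>w. \<langle>\<beta>, fd (gn K) p w\<rangle>)) (at p)"
    by (intro bounded_linear.has_derivative[OF blinfun.bounded_linear_right] fd_has_derivative
        smooth_on_differentiable[OF gm_smooth[OF K] p] smooth_on_differentiable[OF gn_smooth[OF K] p])+
  have "((\<lambda>q. fd K q (a, \<alpha>, \<beta>)) has_derivative
      (\<lambda>w. D2 K p (a, 0) w + \<langle>\<alpha>, fd (gm K) p w\<rangle> + \<langle>\<beta>, fd (gn K) p w\<rangle>)) (at p)"
    by (rule has_derivative_transform_within_open[OF has_derivative_add[OF has_derivative_add[OF d g(1)] g(2)] open_\<Omega> p])
      (simp add: fd_split[OF K])
  from fun_cong[OF has_derivative_unique[OF d this], of w] show ?thesis .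
qed

lemma has_derivative_fd_R_gm:
  assumes F: "smooth_on \<Omega> F" and K: "smooth_on \<Omega> K" and p: "p \<in> \<Omega>"
  shows "((\<lambda>q. fd K q (R (fst q) (gm F q), 0)) has_derivative
    (\<lambda>w. D2 K p (R (fst p) (gm F p), 0) w + fd K p (fd (\<lambda>z. R z (gm F p)) (fst p) (fst w), 0)
        + fd K p (R (fst p) (fd (gm F) p w), 0))) (at p)"
proof -
  have pV: "fst p \<in> V" using p by (auto simp: \<Omega>_def)
  have dR: "((\<lambda>q. R (fst q) a) has_derivative (\<lambda>w. fd (\<lambda>z. R z a) (fst p) (fst w))) (at p)" for a
    by (rule has_derivative_compose[OF has_derivative_fst[OF has_derivative_ident]
          fd_has_derivative[OF smooth_on_differentiable[OF R_smooth pV]]])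
  have "((\<lambda>q. R (fst q) (gm F q)) has_derivative
      (\<lambda>w. fd (\<lambda>q. R (fst q) (gm F p)) p w + R (fst p) (fd (gm F) p w))) (at p)"
    by (rule has_derivative_linear_family[OF open_\<Omega> p R_fst_linear smooth_on_differentiable[OF R_fst_smooth p]
          fd_has_derivative[OF smooth_on_differentiable[OF gm_smooth[OF F] p]]])
  then have "((\<lambda>q. (R (fst q) (gm F q), 0 :: 'e dual \<times> 'e dual)) has_derivative
      (\<lambda>w. (fd (\<lambda>z. R z (gm F p)) (fst p) (fst w) + R (fst p) (fd (gm F) p w), 0))) (at p)"
    unfolding fd_eq[OF dR] by (intro has_derivative_Pair has_derivative_const)
  from has_derivative_fd_apply[OF open_\<Omega> p K this]
  have *: "((\<lambda>q. fd K q (R (fst q) (gm F q), 0)) has_derivative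
    (\<lambda>w. D2 K p (R (fst p) (gm F p), 0) w
      + fd K p (fd (\<lambda>z. R z (gm F p)) (fst p) (fst w) + R (fst p) (fd (gm F) p w), 0))) (at p)"
    unfolding D2_def .
  have "fd K p (a + b, 0) = fd K p (a, 0) + fd K p (b, 0)" for a b
    using linear_add[OF fd_linear[OF K p], of "(a, 0)" "(b, 0)"] by simp
  then show ?thesis using * by (simp add: add.assoc)
qed

text \<open>Differentiating the gradients produces many terms, but they regroup: second derivatives
  of \<open>K\<close> appear only with \<open>ham_field F\<close> in one slot, those of
  \<open>F\<close> only with \<open>ham_field K\<close>. All other terms contain first derivatives
  only.\<close>

lemma br_derivative:
  assumes F: "smooth_on \<Omega> F" and K: "smooth_on \<Omega> K" and p: "p \<in> \<Omega>"
  shows "fd (br F K) p w = D2 K p (ham_field F p) w - D2 F p (ham_field K p) w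
    + fd K p (fd (\<lambda>z. R z (gm F p)) (fst p) (fst w), 0)
    - fd F p (fd (\<lambda>z. R z (gm K p)) (fst p) (fst w), 0)
    + \<langle>fst (snd w), lb (gm F p) (gm K p)\<rangle>
    + \<langle>snd (snd w), lb (gm F p) (gn K p) - lb (gm K p) (gn F p)\<rangle>"
proof -
  note dgm = fd_has_derivative[OF smooth_on_differentiable[OF gm_smooth p]]
  note dgn = fd_has_derivative[OF smooth_on_differentiable[OF gn_smooth p]]
  have fs: "((\<lambda>q. fst (snd q)) has_derivative (\<lambda>w. fst (snd w))) (at p)"
    "((\<lambda>q. snd (snd q)) has_derivative (\<lambda>w. snd (snd w))) (at p)"
    by (auto intro!: derivative_eq_intros)
  note l = lb.FDERIV
  have "(br F K has_derivative (\<lambda>w.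
      (D2 K p (R (fst p) (gm F p), 0) w + fd K p (fd (\<lambda>z. R z (gm F p)) (fst p) (fst w), 0)
        + fd K p (R (fst p) (fd (gm F) p w), 0))
      - (D2 F p (R (fst p) (gm K p), 0) w + fd F p (fd (\<lambda>z. R z (gm K p)) (fst p) (fst w), 0)
        + fd F p (R (fst p) (fd (gm K) p w), 0))
      + (\<langle>fst (snd p), lb (gm F p) (fd (gm K) p w) + lb (fd (gm F) p w) (gm K p)\<rangle>
        + \<langle>fst (snd w), lb (gm F p) (gm K p)\<rangle>)
      + (\<langle>snd (snd p), lb (gm F p) (fd (gn K) p w) + lb (fd (gm F) p w) (gn K p)
           - (lb (gm K p) (fd (gn F) p w) + lb (fd (gm K) p w) (gn F p))\<rangle>
        + \<langle>snd (snd w), lb (gm F p) (gn K p) - lb (gm K p) (gn F p)\<rangle>))) (at p)"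
    unfolding br_def[abs_def]
    by (rule has_derivative_add[OF has_derivative_add[OF has_derivative_diff[OF
              has_derivative_fd_R_gm[OF F K p] has_derivative_fd_R_gm[OF K F p]]
            blinfun.FDERIV[OF fs(1) l[OF dgm[OF F] dgm[OF K]]]]
          blinfun.FDERIV[OF fs(2) has_derivative_diff[OF l[OF dgm[OF F] dgn[OF K]] l[OF dgm[OF K] dgn[OF F]]]]])
  from fun_cong[OF fd_eq[OF this], of w] show ?thesis
    unfolding ham_field_def D2_split[OF K p] D2_split[OF F p] mdot_apply[OF F p] mdot_apply[OF K p] ndot_apply
      lb_antisym[of "fd (gm F) p w" "gm K p"]
    by (simp add: blinfun.add_right blinfun.diff_right blinfun.minus_right)
qed

text \<open>In the cyclic sum each function has two second-derivative terms with opposite signs and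
  exchanged slots, which cancel by symmetry. The derivatives of \<open>R\<close> combine into
  commutators and cancel against the differentials evaluated on \<open>R (fst p) (lb _ _)\<close>.
  The rest is the Jacobi identity of \<open>lb\<close>, paired with \<mu> and \<nu>.\<close>

lemma br_jacobi:
  assumes F: "smooth_on \<Omega> F" and G: "smooth_on \<Omega> G" and H: "smooth_on \<Omega> H" and p: "p \<in> \<Omega>"
  shows "br F (br G H) p + br G (br H F) p + br H (br F G) p = 0"
proof -
  have pV: "fst p \<in> V" using p by (auto simp: \<Omega>_def)
  have comm: "fd F p (fd (\<lambda>z. R z a) (fst p) (R (fst p) b), 0) - fd F p (fd (\<lambda>z. R z b) (fst p) (R (fst p) a), 0)
      = fd F p (R (fst p) (lb b a), 0)" if "smooth_on \<Omega> F" for F a b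
    using linear_diff[OF fd_linear[OF that p], of "(fd (\<lambda>z. R z a) (fst p) (R (fst p) b), 0)" "(fd (\<lambda>z. R z b) (fst p) (R (fst p) a), 0)"]
    by (simp add: R_commutator[OF pV])
  have an: "\<langle>\<nu>, lb a b\<rangle> = - \<langle>\<nu>, lb b a\<rangle>" "\<langle>\<nu>, lb a (lb b c)\<rangle> = - \<langle>\<nu>, lb a (lb c b)\<rangle>" for \<nu> :: "'e dual" and a b c
    using lb_antisym[of a b] lb_antisym[of b c] by (simp_all add: blinfun.minus_right lb.minus_right)
  have jac: "\<langle>\<nu>, lb (lb a b) c\<rangle> + \<langle>\<nu>, lb (lb b c) a\<rangle> + \<langle>\<nu>, lb (lb c a) b\<rangle> = 0" for \<nu> :: "'e dual" and a b c
    using arg_cong[OF lb_jacobi[of a b c], of "blinfun_apply \<nu>"] by (simp add: blinfun.add_right)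
  \<comment> \<open>Here \<open>lb a\<close> acts as a derivation, the shape in which the
    \<nu>-terms occur; the \<mu>-terms have the cyclic shape \<open>mu\<close>.\<close>
  have nu: "\<langle>\<nu>, lb a (lb b c)\<rangle> = \<langle>\<nu>, lb (lb a b) c\<rangle> + \<langle>\<nu>, lb b (lb a c)\<rangle>" for \<nu> :: "'e dual" and a b c
    using jac[of \<nu> a b c] an(1)[of \<nu> "lb b c" a] an(1)[of \<nu> "lb c a" b] an(2)[of \<nu> b c a] by linarith
  have mu: "\<langle>\<mu>, lb a (lb b c)\<rangle> + \<langle>\<mu>, lb b (lb c a)\<rangle> + \<langle>\<mu>, lb c (lb a b)\<rangle> = 0" for \<mu> :: "'e dual" and a b c
    using jac[of \<mu> a b c] an(1)[of \<mu> "lb a b" c] an(1)[of \<mu> "lb b c" a] an(1)[of \<mu> "lb c a" b] by linarith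
  have step: "br F (br G H) p = D2 H p (ham_field G p) (ham_field F p) - D2 G p (ham_field H p) (ham_field F p)
      + fd H p (fd (\<lambda>z. R z (gm G p)) (fst p) (R (fst p) (gm F p)), 0)
      - fd G p (fd (\<lambda>z. R z (gm H p)) (fst p) (R (fst p) (gm F p)), 0)
      - fd F p (R (fst p) (lb (gm G p) (gm H p)), 0)
      + \<langle>fst (snd p), lb (gm F p) (lb (gm G p) (gm H p))\<rangle>
      - \<langle>snd (snd p), lb (lb (gm G p) (gm H p)) (gn F p)\<rangle>
      + \<langle>snd (snd p), lb (gm F p) (lb (gm G p) (gn H p))\<rangle>
      - \<langle>snd (snd p), lb (gm F p) (lb (gm H p) (gn G p))\<rangle>"
    if F: "smooth_on \<Omega> F" and G: "smooth_on \<Omega> G" and H: "smooth_on \<Omega> H" for F G H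
    unfolding br_eq_derivative[OF F br_smooth[OF G H] p] br_derivative[OF G H p]
    by (simp add: ham_field_def mdot_apply[OF F p] ndot_apply lb.diff_right blinfun.diff_right)
  show ?thesis
    unfolding step[OF F G H] step[OF G H F] step[OF H F G]
    using comm[OF F, of "gm H p" "gm G p"] comm[OF G, of "gm F p" "gm H p"] comm[OF H, of "gm G p" "gm F p"]
      D2_symmetric[OF F p, of "ham_field G p" "ham_field H p"] D2_symmetric[OF G p, of "ham_field F p" "ham_field H p"] D2_symmetric[OF H p, of "ham_field F p" "ham_field G p"]
      mu[of "fst (snd p)" "gm F p" "gm G p" "gm H p"]
      nu[of "snd (snd p)" "gm G p" "gm H p" "gn F p"] nu[of "snd (snd p)" "gm H p" "gm F p" "gn G p"]
      nu[of "snd (snd p)" "gm F p" "gm G p" "gn H p"]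
    by linarith
qed

lemma br_diff_product:
  assumes F: "smooth_on \<Omega> F" and K: "smooth_on \<Omega> K" and L: "smooth_on \<Omega> L" and p: "p \<in> \<Omega>"
  shows "br F (\<lambda>q. K q * L q) p = br F K p * L p + K p * br F L p"
proof -
  note d = fd_has_derivative[OF smooth_on_differentiable[OF _ p]]
  have "smooth_on \<Omega> (\<lambda>q. K q * L q)"
    by (rule smooth_on_bilinear[OF bounded_bilinear_mult open_\<Omega> K L])
  from br_eq_derivative[OF F this p] show ?thesis
    unfolding br_eq_derivative[OF F K p] br_eq_derivative[OF F L p]
    by (simp add: fd_eq[OF has_derivative_mult[OF d[OF K] d[OF L]]])
qed

lemma br_linear_right:
  assumes F: "smooth_on \<Omega> F" and K: "smooth_on \<Omega> K" and L: "smooth_on \<Omega> L" and p: "p \<in> \<Omega>"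
  shows "br F (\<lambda>q. a * K q + b * L q) p = a * br F K p + b * br F L p"
proof -
  note d = fd_has_derivative[OF smooth_on_differentiable[OF _ p]]
  have "smooth_on \<Omega> (\<lambda>q. a * K q + b * L q)"
    by (intro smooth_on_add open_\<Omega> smooth_on_bilinear[OF bounded_bilinear_mult] K L smooth_on_const)
  from br_eq_derivative[OF F this p] show ?thesis
    unfolding br_eq_derivative[OF F K p] br_eq_derivative[OF F L p]
    by (simp add: fd_eq[OF has_derivative_add[OF has_derivative_mult_right[OF d[OF K]] has_derivative_mult_right[OF d[OF L]]]])
qed

text \<open>Locality: an inner bracket is known in chart form only on \<open>\<Omega>\<close>, and
  this suffices to replace it inside an outer bracket.\<close>

lemma br_cong:
  assumes "\<And>q. q \<in> \<Omega> \<Longrightarrow> F q = F' q" "\<And>q. q \<in> \<Omega> \<Longrightarrow> K q = K' q" "p \<in> \<Omega>"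
  shows "br F K p = br F' K' p"
proof -
  have "fd F p = fd F' p" "fd K p = fd K' p"
    using fd_cong[OF open_\<Omega> assms(3)] assms(1,2) by blast+
  then show ?thesis by (simp add: br_def gm_def gn_def)
qed

end

section \<open>The reduced bracket\<close>

context lie_grp
begin

lemma local_poisson_chart: "local_poisson (cran g) (R g) lb"
  by (rule local_poisson.intro) (fact open_ran linear_R R_smooth bilinear_lb lb_antisym lb_jacobi R_commutator)+

interpretation loc: local_poisson "cran g" "R g" lb for g
  by (rule local_poisson_chart)

section \<open>Functions on the reduced space and their partial derivatives in charts\<close>

abbreviation "reduced_functions \<equiv> smooth_functions (reduced_atlas G)"

definition chart_fun :: "'g \<Rightarrow> ('g \<times> 'v \<Rightarrow> real) \<Rightarrow> 'e \<times> 'v \<Rightarrow> real" where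
  "chart_fun g H p = H (ci g (fst p), snd p)"

lemma chart_fun_apply [simp]: "chart_fun g H (z, v) = H (ci g z, v)"
  by (simp add: chart_fun_def)

lemma smooth_functions_reduced:
  "H \<in> reduced_functions \<longleftrightarrow> (\<forall>g. smooth_on (loc.\<Omega> g) (chart_fun g H))"
  unfolding reduced_atlas_def smooth_functions_prod_iff[OF mfd] loc.\<Omega>_def chart_fun_def[abs_def] ..

lemma chart_fun_smooth: "H \<in> reduced_functions \<Longrightarrow> smooth_on (loc.\<Omega> g) (chart_fun g H)"
  unfolding smooth_functions_reduced by blast

lemma \<Omega>_mem: "(z, v) \<in> loc.\<Omega> g \<longleftrightarrow> z \<in> cran g"
  by (simp add: loc.\<Omega>_def)

text \<open>The left-hand map is formed with the group product, so its derivative can be computed in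
  any chart containing the point. This is how derivatives along \<open>R\<close> are seen to be
  independent of the chart.\<close>

lemma right_translate_derivative:
  assumes H: "H \<in> reduced_functions" and z: "z \<in> cran g"
  shows "((\<lambda>x. H (ci e x \<odot> ci g z, v)) has_derivative (\<lambda>a. fd (chart_fun g H) (z, v) (R g z a, 0))) (at x0)"
proof -
  let ?N = "{x. (x, z) \<in> M_dom g}"
  have "open ((\<lambda>x. (x, z)) -` M_dom g)"
    by (intro open_vimage open_M_dom continuous_intros)
  then have N: "open ?N" by (simp add: vimage_def)
  have "chart_fun g H differentiable (at (z, v))"
    by (rule smooth_on_differentiable[OF chart_fun_smooth[OF H]]) (simp add: \<Omega>_mem z)
  from has_derivative_partial_fst[OF this]
  have "((\<lambda>z. chart_fun g H (z, v)) has_derivative (\<lambda>a. fd (chart_fun g H) (z, v) (a, 0))) (at (M g (x0, z)))"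
    using z by simp
  from has_derivative_compose[OF M_deriv_fst[OF z] this]
  show ?thesis
    by (rule has_derivative_transform_within_open[OF _ N]) (use z in \<open>auto simp: ci_M\<close>)
qed

lemma chart_fun_R_independent:
  assumes H: "H \<in> reduced_functions" and z: "z \<in> cran g" and w: "w \<in> cran h"
    and eq: "ci g z = ci h w"
  shows "fd (chart_fun g H) (z, v) (R g z a, 0) = fd (chart_fun h H) (w, v) (R h w a, 0)"
  using fun_cong[OF has_derivative_unique[OF right_translate_derivative[OF H z, of v, unfolded eq]
        right_translate_derivative[OF H w, of v]], of a] .

lemma linear_TR: "linear (TR G g)"
  using linear_R[OF cm_ran[OF mem_dom]] unfolding TR_eq[abs_def] .

lemma pairing_delta_g:
  assumes H: "H \<in> reduced_functions"
  shows "\<langle>delta_g G H (g, v), b\<rangle> = fd (chart_fun g H) (cm g g, v) (b, 0)"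
proof -
  obtain \<mu> \<nu> where v: "v = (\<mu>, \<nu>)" by (cases v)
  have d: "chart_fun g H differentiable (at (cm g g, v))"
    by (rule smooth_on_differentiable[OF chart_fun_smooth[OF H]]) (simp add: \<Omega>_mem)
  have "tangent_map (atlas G) vector_atlas (\<lambda>h. H (h, \<mu>, \<nu>)) g = (\<lambda>b. fd (chart_fun g H) (cm g g, v) (b, 0))"
    using fd_eq[OF has_derivative_partial_fst[OF d]] by (simp add: tangent_map_def o_def v)
  moreover have "linear (\<lambda>b. fd (chart_fun g H) (cm g g, v) (b, 0))"
    using has_derivative_linear[OF has_derivative_partial_fst[OF d]] .
  ultimately show ?thesis
    by (simp add: delta_g_def v Blinfun_apply_linear)
qed

lemma pairing_TR_dual: "\<langle>TR_dual G g \<alpha>, \<eta>\<rangle> = \<langle>\<alpha>, TR G g \<eta>\<rangle>"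
proof -
  have "linear (\<lambda>\<eta>. \<langle>\<alpha>, TR G g \<eta>\<rangle>)"
    by (rule linearI) (simp_all add: linear_add[OF linear_TR] linear_scale[OF linear_TR] blinfun.add_right blinfun.scaleR_right)
  then show ?thesis by (simp add: TR_dual_def Blinfun_apply_linear)
qed

text \<open>\<open>delta_g\<close> and \<open>TR\<close> refer to the distinguished chart at
  \<open>ci g z\<close>, the right-hand side to the fixed chart at \<open>g\<close>; independence of
  the chart bridges the two.\<close>

lemma pairing_TR_dual_delta_g:
  assumes H: "H \<in> reduced_functions" and z: "z \<in> cran g"
  shows "\<langle>TR_dual G (ci g z) (delta_g G H (ci g z, v)), \<eta>\<rangle> = fd (chart_fun g H) (z, v) (R g z \<eta>, 0)"
  unfolding pairing_TR_dual pairing_delta_g[OF H] TR_eq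
  by (rule chart_fun_R_independent[OF H _ z]) simp_all

lemma delta_mu_eq:
  assumes H: "H \<in> reduced_functions" and z: "z \<in> cran g"
  shows "delta_mu H (ci g z, v) = loc.gm (chart_fun g H) (z, v)"
    and delta_nu_eq: "delta_nu H (ci g z, v) = loc.gn (chart_fun g H) (z, v)"
proof -
  obtain \<mu> \<nu> where v: "v = (\<mu>, \<nu>)" by (cases v)
  have d: "(chart_fun g H has_derivative fd (chart_fun g H) (z, \<mu>, \<nu>)) (at (z, \<mu>, \<nu>))"
    by (rule fd_has_derivative[OF smooth_on_differentiable[OF chart_fun_smooth[OF H]]]) (simp add: \<Omega>_mem z)
  have m: "((\<lambda>m. (z, m, \<nu>)) has_derivative (\<lambda>m. (0, m, 0))) (at \<mu>)"
    "((\<lambda>n. (z, \<mu>, n)) has_derivative (\<lambda>n. (0, 0, n))) (at \<nu>)"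
    by (auto intro!: derivative_eq_intros)
  show "delta_mu H (ci g z, v) = loc.gm (chart_fun g H) (z, v)"
    using fd_eq[OF has_derivative_compose[OF m(1) d]] by (simp add: delta_mu_def loc.gm_def v)
  show "delta_nu H (ci g z, v) = loc.gn (chart_fun g H) (z, v)"
    using fd_eq[OF has_derivative_compose[OF m(2) d]] by (simp add: delta_nu_def loc.gn_def v)
qed

section \<open>The bracket formula as a Poisson structure\<close>

definition red :: "(('g, 'e) reduced_space \<Rightarrow> real) \<Rightarrow> (('g, 'e) reduced_space \<Rightarrow> real) \<Rightarrow> ('g, 'e) reduced_space \<Rightarrow> real" where
  "red H K x = (case x of (g, \<mu>, \<nu>) \<Rightarrow>
     \<langle>TR_dual G g (delta_g G K x), delta_mu H x\<rangle> - \<langle>TR_dual G g (delta_g G H x), delta_mu K x\<rangle>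
     + \<langle>\<mu>, lb (delta_mu H x) (delta_mu K x)\<rangle>
     + \<langle>\<nu>, lb (delta_mu H x) (delta_nu K x) - lb (delta_mu K x) (delta_nu H x)\<rangle>)"

text \<open>Valid on the whole chart, not only at its centre: smoothness of the bracket and nesting
  of brackets require a fixed chart while the point moves.\<close>

lemma red_chart:
  assumes H: "H \<in> reduced_functions" and K: "K \<in> reduced_functions" and z: "z \<in> cran g"
  shows "red H K (ci g z, v) = loc.br g (chart_fun g H) (chart_fun g K) (z, v)"
proof -
  obtain \<mu> \<nu> where v: "v = (\<mu>, \<nu>)" by (cases v)
  show ?thesis
    unfolding red_def loc.br_def v
    using pairing_TR_dual_delta_g[OF H z, of v] pairing_TR_dual_delta_g[OF K z, of v]
      delta_mu_eq[OF H z, of v] delta_mu_eq[OF K z, of v] delta_nu_eq[OF H z, of v] delta_nu_eq[OF K z, of v]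
    by (simp add: v)
qed

lemma chart_fun_red:
  assumes "H \<in> reduced_functions" "K \<in> reduced_functions" "p \<in> loc.\<Omega> g"
  shows "chart_fun g (red H K) p = loc.br g (chart_fun g H) (chart_fun g K) p"
  using red_chart[OF assms(1,2)] assms(3) by (cases p) (auto simp: \<Omega>_mem)

lemma red_smooth:
  assumes H: "H \<in> reduced_functions" and K: "K \<in> reduced_functions"
  shows "red H K \<in> reduced_functions"
  unfolding smooth_functions_reduced
proof
  fix g
  show "smooth_on (loc.\<Omega> g) (chart_fun g (red H K))"
    by (rule smooth_on_cong[OF loc.open_\<Omega> _ loc.br_smooth[OF chart_fun_smooth[OF H] chart_fun_smooth[OF K]]])
      (simp add: chart_fun_red[OF H K])
qed

lemma red_at_center:
  assumes "H \<in> reduced_functions" "K \<in> reduced_functions"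
  shows "red H K (g, v) = loc.br g (chart_fun g H) (chart_fun g K) (cm g g, v)"
  using red_chart[OF assms, of "cm g g" g v] by simp

lemma center_\<Omega>: "(cm g g, v) \<in> loc.\<Omega> g"
  by (simp add: \<Omega>_mem)

lemma red_antisym:
  assumes "H \<in> reduced_functions" "K \<in> reduced_functions"
  shows "red H K x = - red K H x"
  by (cases x) (simp only: red_at_center[OF assms] red_at_center[OF assms(2,1)], rule loc.br_antisym)

lemma
  assumes H: "H \<in> reduced_functions" and K: "K \<in> reduced_functions"
  shows smooth_functions_mult: "(\<lambda>x. H x * K x) \<in> reduced_functions"
    and smooth_functions_lincomb: "(\<lambda>x. a * H x + b * K x) \<in> reduced_functions"
  using chart_fun_smooth[OF H] chart_fun_smooth[OF K]
  unfolding smooth_functions_reduced chart_fun_def[abs_def]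
  by (auto intro!: smooth_on_add smooth_on_bilinear[OF bounded_bilinear_mult] loc.open_\<Omega> smooth_on_const)

lemma red_lincomb_right:
  assumes F: "F \<in> reduced_functions" and H: "H \<in> reduced_functions"
    and K: "K \<in> reduced_functions"
  shows "red F (\<lambda>y. a * H y + b * K y) x = a * red F H x + b * red F K x"
proof (cases x rule: prod.exhaust)
  case (Pair g v)
  have "chart_fun g (\<lambda>y. a * H y + b * K y) = (\<lambda>q. a * chart_fun g H q + b * chart_fun g K q)"
    by (simp add: chart_fun_def[abs_def])
  then show ?thesis
    unfolding Pair red_at_center[OF F smooth_functions_lincomb[OF H K]] red_at_center[OF F H] red_at_center[OF F K]
    using loc.br_linear_right[OF chart_fun_smooth[OF F] chart_fun_smooth[OF H] chart_fun_smooth[OF K] center_\<Omega>] by simp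
qed

lemma red_mult_right:
  assumes F: "F \<in> reduced_functions" and H: "H \<in> reduced_functions"
    and K: "K \<in> reduced_functions"
  shows "red F (\<lambda>y. H y * K y) x = red F H x * K x + H x * red F K x"
proof (cases x rule: prod.exhaust)
  case (Pair g v)
  have "chart_fun g (\<lambda>y. H y * K y) = (\<lambda>q. chart_fun g H q * chart_fun g K q)"
    by (simp add: chart_fun_def[abs_def])
  then show ?thesis
    unfolding Pair red_at_center[OF F smooth_functions_mult[OF H K]] red_at_center[OF F H] red_at_center[OF F K]
    using loc.br_diff_product[OF chart_fun_smooth[OF F] chart_fun_smooth[OF H] chart_fun_smooth[OF K] center_\<Omega>, of g v]
    by simp
qed

lemma red_jacobi:
  assumes F: "F \<in> reduced_functions" and H: "H \<in> reduced_functions"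
    and K: "K \<in> reduced_functions"
  shows "red F (red H K) x + red H (red K F) x + red K (red F H) x = 0"
proof (cases x rule: prod.exhaust)
  case (Pair g v)
  have nest: "red F (red H K) (g, v)
      = loc.br g (chart_fun g F) (loc.br g (chart_fun g H) (chart_fun g K)) (cm g g, v)"
    if "F \<in> reduced_functions" "H \<in> reduced_functions"
      "K \<in> reduced_functions" for F H K
    unfolding red_at_center[OF that(1) red_smooth[OF that(2,3)]]
    by (rule loc.br_cong[OF _ _ center_\<Omega>]) (simp_all add: chart_fun_red[OF that(2,3)])
  show ?thesis
    unfolding Pair nest[OF F H K] nest[OF H K F] nest[OF K F H]
    by (rule loc.br_jacobi[OF chart_fun_smooth[OF F] chart_fun_smooth[OF H] chart_fun_smooth[OF K] center_\<Omega>])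
qed

lemma smooth_manifold_reduced: "smooth_manifold (reduced_atlas G)"
  unfolding reduced_atlas_def by (rule smooth_manifold_prod[OF mfd smooth_manifold_vector_atlas])

section \<open>Hamiltonian vector fields\<close>

text \<open>The inverse is the derivative of right translation by \<open>inverse_of G g\<close>,
  read from the chart at \<open>g\<close> into the chart at the identity.\<close>

lemma TR_bij: "bij (TR G g)"
proof -
  let ?z = "cm g g"
  let ?T = "\<lambda>h. h \<odot> inverse_of G g"
  have T: "smooth_map (atlas G) (atlas G) ?T"
    using smooth_map_compose[OF mfd mfd2 mfd
        smooth_map_Pair[OF mfd mfd mfd smooth_map_id[OF mfd] smooth_map_const] mul_smooth, of "inverse_of G g"] by simp
  define W where "W = {w \<in> cran g. ?T (ci g w) \<in> cdom e}"
  define L where "L w = cm e (?T (ci g w))" for w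
  have W: "open W" unfolding W_def by (rule smooth_map_open_chart[OF T mfd mfd])
  have L: "smooth_on W L" unfolding W_def L_def[abs_def] by (rule smooth_mapD(2)[OF T mfd])
  have zW: "?z \<in> W" by (simp add: W_def)
  have Lz: "L ?z = x0" by (simp add: L_def x0_def)
  have dL: "(L has_derivative fd L ?z) (at ?z)"
    by (rule fd_has_derivative[OF smooth_on_differentiable[OF L zW]])
  have dM: "((\<lambda>x. M g (x, ?z)) has_derivative R g ?z) (at x0)"
    by (rule M_deriv_fst) simp
  let ?N = "{x. (x, ?z) \<in> M_dom g}"
  have "open ((\<lambda>x. (x, ?z)) -` M_dom g)"
    by (intro open_vimage open_M_dom continuous_intros)
  then have N: "open ?N" by (simp add: vimage_def)
  have "((\<lambda>x. L (M g (x, ?z))) has_derivative (\<lambda>a. fd L ?z (R g ?z a))) (at x0)"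
    by (rule has_derivative_compose[OF dM]) (simp add: dL)
  then have "((\<lambda>x. x) has_derivative (\<lambda>a. fd L ?z (R g ?z a))) (at x0)"
    by (rule has_derivative_transform_within_open[OF _ N])
      (auto simp: L_def ci_M mult_assoc, simp add: M_dom_mem)
  from fun_cong[OF has_derivative_unique[OF this has_derivative_ident]]
  have 1: "fd L ?z (R g ?z a) = a" for a .
  have "((\<lambda>w. M g (L w, ?z)) has_derivative (\<lambda>b. R g ?z (fd L ?z b))) (at ?z)"
    by (rule has_derivative_compose[OF dL]) (simp add: Lz dM)
  then have "((\<lambda>w. w) has_derivative (\<lambda>b. R g ?z (fd L ?z b))) (at ?z)"
    by (rule has_derivative_transform_within_open[OF _ W zW])
      (simp add: M_def L_def W_def mult_assoc)
  from fun_cong[OF has_derivative_unique[OF this has_derivative_ident]]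
  have 2: "R g ?z (fd L ?z b) = b" for b .
  show ?thesis
    unfolding TR_eq[abs_def] by (rule bij_betw_byWitness[of _ "fd L ?z"]) (use 1 2 in auto)
qed

lemma pairing_coad: "\<langle>coad G \<xi> \<mu>, \<eta>\<rangle> = \<langle>\<mu>, lb \<xi> \<eta>\<rangle>"
proof -
  have "linear (\<lambda>\<eta>. \<langle>\<mu>, lb \<xi> \<eta>\<rangle>)"
    by (rule linearI) (simp_all add: loc.lb.add_right loc.lb.scaleR_right blinfun.add_right blinfun.scaleR_right)
  then show ?thesis by (simp add: coad_def lie_bracket_eq Blinfun_apply_linear)
qed

text \<open>The system is triangular: the first component determines \<eta>, the second then
  \<zeta>, and these determine the last two parameters.\<close>

lemma right_inv_field_bij: "bij (\<lambda>a. right_inv_field G a p)"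
proof -
  obtain g \<xi> \<mu> \<nu> where p: "p = (g, \<xi>, \<mu>, \<nu>)" by (cases p) auto
  let ?T = "inv (TR G g)"
  have T: "?T (TR G g \<eta>) = \<eta>" "TR G g (?T \<eta>) = \<eta>" for \<eta>
    using TR_bij[of g] by (simp_all add: bij_is_inj bij_is_surj surj_f_inv_f)
  let ?i = "\<lambda>(v1, v2, v3, v4). (?T v1, v2 - lie_bracket G \<xi> (?T v1),
      v3 - coad G (?T v1) \<mu> - coad G (v2 - lie_bracket G \<xi> (?T v1)) \<nu>, v4 - coad G (?T v1) \<nu>)"
  show ?thesis
    by (rule bij_betw_byWitness[of _ ?i]) (auto simp: right_inv_field_def p T)
qed

definition symp :: "'e dual \<Rightarrow> 'e dual \<Rightarrow> 'e tangent4 \<Rightarrow> 'e tangent4 \<Rightarrow> real" where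
  "symp \<mu> \<nu> = (\<lambda>(\<eta>, \<zeta>, \<alpha>, \<beta>) (\<eta>', \<zeta>', \<alpha>', \<beta>').
     \<langle>\<alpha>, \<eta>'\<rangle> + \<langle>\<beta>, \<zeta>'\<rangle> - \<langle>\<alpha>', \<eta>\<rangle> - \<langle>\<beta>', \<zeta>\<rangle> + \<langle>\<mu>, lb \<eta> \<eta>'\<rangle> + \<langle>\<nu>, lb \<eta> \<zeta>' - lb \<eta>' \<zeta>\<rangle>)"

lemma Omega_right_inv_field:
  "Omega G (g, \<xi>, \<mu>, \<nu>) (right_inv_field G a (g, \<xi>, \<mu>, \<nu>)) (right_inv_field G b (g, \<xi>, \<mu>, \<nu>)) = symp \<mu> \<nu> a b"
  unfolding Omega_def inv_f_f[OF bij_is_inj[OF right_inv_field_bij]]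
  by (simp add: symp_def lie_bracket_eq split_beta)

text \<open>Test vectors with one nonzero slot isolate the components one at a time; \<alpha> and
  \<beta> come last because the terms with \<mu> and \<nu> cancel only once \<eta> and \<zeta>
  agree.\<close>

lemma symp_nondegenerate:
  assumes "\<And>c. symp \<mu> \<nu> a c = symp \<mu> \<nu> b c"
  shows "a = b"
proof -
  obtain \<eta> \<zeta> \<alpha> \<beta> where a: "a = (\<eta>, \<zeta>, \<alpha>, \<beta>)" by (cases a) auto
  obtain \<eta>' \<zeta>' \<alpha>' \<beta>' where b: "b = (\<eta>', \<zeta>', \<alpha>', \<beta>')" by (cases b) auto
  have \<eta>: "\<eta> = \<eta>'"
    by (rule dual_separates) (use assms[of "(0, 0, _, 0)"] in \<open>simp add: symp_def a b loc.lb.zero_left loc.lb.zero_right\<close>)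
  have \<zeta>: "\<zeta> = \<zeta>'"
    by (rule dual_separates) (use assms[of "(0, 0, 0, _)"] in \<open>simp add: symp_def a b loc.lb.zero_left loc.lb.zero_right\<close>)
  have \<beta>: "\<beta> = \<beta>'"
    by (rule blinfun_eqI) (use assms[of "(0, _, 0, 0)"] in \<open>simp add: symp_def a b \<eta> loc.lb.zero_left loc.lb.zero_right\<close>)
  have \<alpha>: "\<alpha> = \<alpha>'"
    by (rule blinfun_eqI) (use assms[of "(_, 0, 0, 0)"] in \<open>simp add: symp_def a b \<eta> \<zeta> loc.lb.zero_left loc.lb.zero_right\<close>)
  show ?thesis by (simp add: a b \<eta> \<zeta> \<alpha> \<beta>)
qed

lemma phase_bracket_red:
  assumes H: "H \<in> reduced_functions" and K: "K \<in> reduced_functions"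
  shows "phase_bracket G (H \<circ> reduction_map) (K \<circ> reduction_map) = red H K \<circ> reduction_map"
proof
  fix p :: "('g, 'e) phase_space"
  obtain g \<xi> \<mu> \<nu> where p: "p = (g, \<xi>, \<mu>, \<nu>)" by (cases p) auto
  let ?X = "\<lambda>a. right_inv_field G a p"
  let ?x = "(g, \<mu>, \<nu>)"
  define \<pi> where "\<pi> H = (delta_mu H ?x, delta_nu H ?x, - TR_dual G g (delta_g G H ?x), 0 :: 'e dual)" for H
  have ham: "hamiltonian_field G (H \<circ> reduction_map) p = ?X (\<pi> H)"
    if H: "H \<in> reduced_functions" for H
  proof -
    let ?z = "cm g g"
    let ?F = "chart_fun g H"
    have zr: "?z \<in> cran g" by simp
    have F: "smooth_on (loc.\<Omega> g) ?F" by (rule chart_fun_smooth[OF H])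
    have z\<Omega>: "(?z, \<mu>, \<nu>) \<in> loc.\<Omega> g" by (rule center_\<Omega>)
    have dF: "(?F has_derivative fd ?F (?z, \<mu>, \<nu>)) (at (?z, \<mu>, \<nu>))"
      by (rule fd_has_derivative[OF smooth_on_differentiable[OF F z\<Omega>]])
    \<comment> \<open>Independence of \<xi> enters here: the function factors through the projection
      that forgets \<xi>, so the component \<open>w2\<close> disappears.\<close>
    have tan: "tangent_map (phase_atlas G) vector_atlas (H \<circ> reduction_map) p (w1, w2, w3, w4)
        = fd ?F (?z, \<mu>, \<nu>) (w1, w3, w4)" for w1 w2 w3 w4
    proof -
      have "((\<lambda>q :: 'e tangent4. (fst q, snd (snd q))) has_derivative (\<lambda>q. (fst q, snd (snd q)))) (at (?z, \<xi>, \<mu>, \<nu>))"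
        by (auto intro!: derivative_eq_intros)
      from has_derivative_compose[OF this, of ?F "fd ?F (?z, \<mu>, \<nu>)"] dF
      have "((\<lambda>q :: 'e tangent4. ?F (fst q, snd (snd q))) has_derivative (\<lambda>q. fd ?F (?z, \<mu>, \<nu>) (fst q, snd (snd q)))) (at (?z, \<xi>, \<mu>, \<nu>))"
        by simp
      then have "((chart_map vector_atlas ((H \<circ> reduction_map) p) \<circ> (H \<circ> reduction_map) \<circ> chart_inv (phase_atlas G) p)
          has_derivative (\<lambda>q. fd ?F (?z, \<mu>, \<nu>) (fst q, snd (snd q)))) (at (?z, \<xi>, \<mu>, \<nu>))"
      proof (rule has_derivative_transform_within_open[of _ _ _ _ "cran g \<times> UNIV"])
        show "open (cran g \<times> (UNIV :: 'e chart_point set))"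
          by (intro open_Times open_ran open_UNIV)
        fix q :: "'e tangent4" assume q: "q \<in> cran g \<times> UNIV"
        obtain w v1 v2 v3 where qq: "q = (w, v1, v2, v3)" by (cases q) auto
        have "chart_inv (phase_atlas G) p q = (ci g w, v1, v2, v3)"
          using q chart_inv_prod[OF mfd smooth_manifold_vector_atlas, of w g "(v1, v2, v3)" "(\<xi>, \<mu>, \<nu>)"]
          by (simp add: phase_atlas_def p qq)
        then show "?F (fst q, snd (snd q)) = (chart_map vector_atlas ((H \<circ> reduction_map) p) \<circ> (H \<circ> reduction_map) \<circ> chart_inv (phase_atlas G) p) q"
          by (simp add: qq reduction_map_def)
      qed simp
      from fun_cong[OF fd_eq[OF this], of "(w1, w2, w3, w4)"] show ?thesis
        by (simp add: tangent_map_def phase_atlas_def p)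
    qed
    have \<pi>: "loc.gm ?F (?z, \<mu>, \<nu>) = delta_mu H ?x" "loc.gn ?F (?z, \<mu>, \<nu>) = delta_nu H ?x"
      using delta_mu_eq[OF H zr, of "(\<mu>, \<nu>)"] delta_nu_eq[OF H zr, of "(\<mu>, \<nu>)"] by simp_all
    have dH: "tangent_map (phase_atlas G) vector_atlas (H \<circ> reduction_map) p (?X c) = - symp \<mu> \<nu> (\<pi> H) c" for c
    proof -
      obtain \<eta> \<zeta> \<alpha> \<beta> where c: "c = (\<eta>, \<zeta>, \<alpha>, \<beta>)" by (cases c) auto
      have X: "?X c = (TR G g \<eta>, \<zeta> + lie_bracket G \<xi> \<eta>, \<alpha> + coad G \<eta> \<mu> + coad G \<zeta> \<nu>, \<beta> + coad G \<eta> \<nu>)"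
        by (simp add: right_inv_field_def c p)
      have "tangent_map (phase_atlas G) vector_atlas (H \<circ> reduction_map) p (?X c)
          = fd ?F (?z, \<mu>, \<nu>) (TR G g \<eta>, \<alpha> + coad G \<eta> \<mu> + coad G \<zeta> \<nu>, \<beta> + coad G \<eta> \<nu>)"
        unfolding X by (rule tan)
      also have "\<dots> = \<langle>TR_dual G g (delta_g G H ?x), \<eta>\<rangle>
          + \<langle>\<alpha> + coad G \<eta> \<mu> + coad G \<zeta> \<nu>, delta_mu H ?x\<rangle> + \<langle>\<beta> + coad G \<eta> \<nu>, delta_nu H ?x\<rangle>"
        unfolding loc.fd_split[OF F z\<Omega>] \<pi> pairing_TR_dual pairing_delta_g[OF H] ..
      \<comment> \<open>The terms paired with \<open>delta_mu\<close> carry \<eta> or \<zeta> in the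
        first slot of \<open>lb\<close>, those in \<open>symp\<close> in the second; antisymmetry
        reconciles the signs.\<close>
      finally show ?thesis
        unfolding c \<pi>_def symp_def
        using lb_antisym[of "delta_mu H ?x" \<eta>] lb_antisym[of "delta_mu H ?x" \<zeta>]
        by (simp add: blinfun.add_left blinfun.minus_left blinfun.add_right blinfun.diff_right blinfun.minus_right pairing_coad)
    qed
    show ?thesis
      unfolding hamiltonian_field_def
    proof (rule the_equality)
      show "\<forall>w. Omega G p (?X (\<pi> H)) w = - tangent_map (phase_atlas G) vector_atlas (H \<circ> reduction_map) p w"
      proof
        fix w
        obtain c where w: "w = ?X c" using bij_is_surj[OF right_inv_field_bij[of p]] by (meson surjD)
        show "Omega G p (?X (\<pi> H)) w = - tangent_map (phase_atlas G) vector_atlas (H \<circ> reduction_map) p w"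
          unfolding w dH by (simp add: p Omega_right_inv_field)
      qed
      \<comment> \<open>Uniqueness for the definite description: every tangent vector lies in the
        range of the frame, and the form is nondegenerate there.\<close>
      fix v assume v: "\<forall>w. Omega G p v w = - tangent_map (phase_atlas G) vector_atlas (H \<circ> reduction_map) p w"
      obtain a where a: "v = ?X a" using bij_is_surj[OF right_inv_field_bij[of p]] by (meson surjD)
      have "symp \<mu> \<nu> a c = symp \<mu> \<nu> (\<pi> H) c" for c
        using v[rule_format, of "?X c"] unfolding a dH by (simp add: p Omega_right_inv_field)
      then show "v = ?X (\<pi> H)" using symp_nondegenerate a by blast
    qed
  qed
  have "phase_bracket G (H \<circ> reduction_map) (K \<circ> reduction_map) p = symp \<mu> \<nu> (\<pi> H) (\<pi> K)"
    unfolding phase_bracket_def ham[OF H] ham[OF K] by (simp add: p Omega_right_inv_field)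
  also have "\<dots> = red H K ?x"
    by (simp add: symp_def \<pi>_def red_def blinfun.minus_left)
  finally show "phase_bracket G (H \<circ> reduction_map) (K \<circ> reduction_map) p = (red H K \<circ> reduction_map) p"
    by (simp add: p reduction_map_def)
qed

section \<open>Descent to the reduced space\<close>

lemma surj_reduction_map: "surj (reduction_map :: ('g, 'e) phase_space \<Rightarrow> ('g, 'e) reduced_space)"
  by (rule surjI[of reduction_map "\<lambda>x. (fst x, 0, snd x)"]) (simp add: reduction_map_def split_beta)

text \<open>Since \<open>reduction_map\<close> is surjective, a function is determined by its
  pullback, so the definite description has exactly one solution.\<close>

lemma reduced_bracket_red:
  assumes "H \<in> reduced_functions" "K \<in> reduced_functions"
  shows "reduced_bracket G H K = red H K"
  unfolding reduced_bracket_def phase_bracket_red[OF assms]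
proof (rule the_equality)
  fix F assume F: "F \<circ> reduction_map = red H K \<circ> reduction_map"
  show "F = red H K"
  proof
    fix x :: "('g, 'e) reduced_space"
    obtain p :: "('g, 'e) phase_space" where "x = reduction_map p"
      using surj_reduction_map by (meson surjD)
    then show "F x = red H K x" using fun_cong[OF F, of p] by simp
  qed
qed rule

lemma poisson_manifold_reduced: "poisson_manifold (reduced_atlas G) (reduced_bracket G)"
  unfolding poisson_manifold_def
proof (intro conjI ballI allI)
  let ?S = "reduced_functions"
  note rb = reduced_bracket_red
  show "smooth_manifold (reduced_atlas G)" by (rule smooth_manifold_reduced)
  fix f h assume f: "f \<in> ?S" and h: "h \<in> ?S"
  show "reduced_bracket G f h \<in> ?S" unfolding rb[OF f h] by (rule red_smooth[OF f h])
  show "reduced_bracket G f h x = - reduced_bracket G h f x" for x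
    unfolding rb[OF f h] rb[OF h f] by (rule red_antisym[OF f h])
  fix k assume k: "k \<in> ?S"
  \<comment> \<open>Linearity in the first argument is transferred from the second by
    antisymmetry.\<close>
  show "reduced_bracket G (\<lambda>y. a * f y + b * h y) k x = a * reduced_bracket G f k x + b * reduced_bracket G h k x" for a b x
    unfolding rb[OF smooth_functions_lincomb[OF f h] k] rb[OF f k] rb[OF h k]
      red_antisym[OF smooth_functions_lincomb[OF f h] k] red_lincomb_right[OF k f h]
      red_antisym[OF f k] red_antisym[OF h k] by simp
  show "reduced_bracket G f (\<lambda>y. h y * k y) x = reduced_bracket G f h x * k x + h x * reduced_bracket G f k x" for x
    unfolding rb[OF f smooth_functions_mult[OF h k]] rb[OF f h] rb[OF f k] by (rule red_mult_right[OF f h k])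
  show "reduced_bracket G f (reduced_bracket G h k) x + reduced_bracket G h (reduced_bracket G k f) x
      + reduced_bracket G k (reduced_bracket G f h) x = 0" for x
    unfolding rb[OF h k] rb[OF k f] rb[OF f h] rb[OF f red_smooth[OF h k]] rb[OF h red_smooth[OF k f]]
      rb[OF k red_smooth[OF f h]]
    by (rule red_jacobi[OF f h k])
qed

text \<open>The inverse restricts a function to the slice where \<xi> is 0. In charts both
  directions are compositions with linear maps, a projection and an inclusion, so smoothness passes
  both ways.\<close>

lemma bij_betw_invariant_functions:
  "bij_betw (\<lambda>H. H \<circ> reduction_map) (reduced_functions) (invariant_functions G)"
proof (rule bij_betw_byWitness[of _ "\<lambda>H (g, v). H (g, 0, v)"])
  have red: "reduction_map (g, \<xi>, v) = (g, v)" for g :: 'g and \<xi> :: 'e and v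
    by (cases v) (simp add: reduction_map_def)
  have phase: "H \<in> smooth_functions (phase_atlas G) \<longleftrightarrow>
      (\<forall>g. smooth_on (cran g \<times> UNIV) (\<lambda>p. H (ci g (fst p), snd p)))" for H :: "('g, 'e) phase_space \<Rightarrow> real"
    unfolding phase_atlas_def smooth_functions_prod_iff[OF mfd] ..
  have reduced: "H \<in> reduced_functions \<longleftrightarrow>
      (\<forall>g. smooth_on (cran g \<times> UNIV) (\<lambda>p. H (ci g (fst p), snd p)))" for H
    unfolding reduced_atlas_def smooth_functions_prod_iff[OF mfd] ..
  have o: "open (cran g \<times> (UNIV :: 'e chart_point set))" "open (cran g \<times> (UNIV :: ('e dual \<times> 'e dual) set))" for g
    by (intro open_Times open_ran open_UNIV)+
  show "\<forall>H\<in>reduced_functions. (\<lambda>(g, v). (H \<circ> reduction_map) (g, 0, v)) = H"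
    by (auto simp: red)
  show "\<forall>H\<in>invariant_functions G. (\<lambda>(g, v). H (g, 0, v)) \<circ> reduction_map = H"
    by (auto simp: reduction_map_def invariant_functions_def xi_independent_def fun_eq_iff)
  show "(\<lambda>H. H \<circ> reduction_map) ` reduced_functions \<subseteq> invariant_functions G"
  proof safe
    fix H assume H: "H \<in> reduced_functions"
    have l: "bounded_linear (\<lambda>p :: 'e tangent4. (fst p, snd (snd p)))"
      by (rule bounded_linear_Pair[OF bounded_linear_fst bounded_linear_compose[OF bounded_linear_snd bounded_linear_snd]])
    have "smooth_on (cran g \<times> UNIV) (\<lambda>p :: 'e tangent4. H (ci g (fst (fst p, snd (snd p))), snd (fst p, snd (snd p))))" for g
      by (rule smooth_on_compose[OF o(1) _ smooth_on_linear[OF l] H[unfolded reduced, rule_format, of g]]) auto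
    then have "H \<circ> reduction_map \<in> smooth_functions (phase_atlas G)"
      unfolding phase by (simp add: reduction_map_def split_beta)
    then show "H \<circ> reduction_map \<in> invariant_functions G"
      by (simp add: invariant_functions_def xi_independent_def reduction_map_def)
  qed
  show "(\<lambda>H (g, v). H (g, 0, v)) ` invariant_functions G \<subseteq> reduced_functions"
  proof safe
    fix H assume "H \<in> invariant_functions G"
    then have H: "H \<in> smooth_functions (phase_atlas G)" by (simp add: invariant_functions_def)
    have l: "bounded_linear (\<lambda>p :: 'e chart_point. (fst p, 0 :: 'e, snd p))"
      by (rule bounded_linear_Pair[OF bounded_linear_fst bounded_linear_Pair[OF bounded_linear_zero bounded_linear_snd]])
    have "smooth_on (cran g \<times> UNIV) (\<lambda>p :: 'e chart_point.
        H (ci g (fst (fst p, 0 :: 'e, snd p)), snd (fst p, 0 :: 'e, snd p)))" for g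
      by (rule smooth_on_compose[OF o(2) _ smooth_on_linear[OF l] H[unfolded phase, rule_format, of g]]) auto
    then show "(\<lambda>(g, v). H (g, 0, v)) \<in> reduced_functions"
      unfolding reduced by simp
  qed
qed

end

theorem mainTheorem6:
  fixes G :: "('g::topological_space, 'e::finite_dim_normed) lie_data"
  assumes "lie_group G"
  shows "(\<forall>H\<in>invariant_functions G. \<forall>K\<in>invariant_functions G.
            phase_bracket G H K \<in> invariant_functions G) \<and>
         bij_betw (\<lambda>H. H \<circ> reduction_map)
           (smooth_functions (reduced_atlas G)) (invariant_functions G) \<and>
         poisson_manifold (reduced_atlas G) (reduced_bracket G) \<and>
         (\<forall>H\<in>smooth_functions (reduced_atlas G). \<forall>K\<in>smooth_functions (reduced_atlas G).
            reduced_bracket G H K \<circ> reduction_map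
              = phase_bracket G (H \<circ> reduction_map) (K \<circ> reduction_map)) \<and>
         (\<forall>H\<in>smooth_functions (reduced_atlas G). \<forall>K\<in>smooth_functions (reduced_atlas G).
            \<forall>g \<mu> \<nu>.
              (let Hg = delta_g G H (g, \<mu>, \<nu>); Kg = delta_g G K (g, \<mu>, \<nu>);
                   H\<mu> = delta_mu H (g, \<mu>, \<nu>); K\<mu> = delta_mu K (g, \<mu>, \<nu>);
                   H\<nu> = delta_nu H (g, \<mu>, \<nu>); K\<nu> = delta_nu K (g, \<mu>, \<nu>)
               in reduced_bracket G H K (g, \<mu>, \<nu>) =
                    \<langle>TR_dual G g Kg, H\<mu>\<rangle> - \<langle>TR_dual G g Hg, K\<mu>\<rangle>
                    + \<langle>\<mu>, lie_bracket G H\<mu> K\<mu>\<rangle>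
                    + \<langle>\<nu>, lie_bracket G H\<mu> K\<nu> - lie_bracket G K\<mu> H\<nu>\<rangle>))"
proof -
  interpret lie_grp G by unfold_locales (rule assms)
  note bij = bij_betw_invariant_functions
  \<comment> \<open>Invariant functions are pullbacks, so their bracket on phase space is the
    pullback of a smooth function on the reduced space.\<close>
  have closed: "phase_bracket G H K \<in> invariant_functions G"
    if HK: "H \<in> invariant_functions G" "K \<in> invariant_functions G" for H K
  proof -
    obtain H' K' where H': "H' \<in> smooth_functions (reduced_atlas G)" "H = H' \<circ> reduction_map"
      and K': "K' \<in> smooth_functions (reduced_atlas G)" "K = K' \<circ> reduction_map"
      using HK bij_betw_imp_surj_on[OF bij] by blast
    show ?thesis
      unfolding H'(2) K'(2) phase_bracket_red[OF H'(1) K'(1)]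
      using bij_betw_apply[OF bij red_smooth[OF H'(1) K'(1)]] .
  qed
  show ?thesis
  proof (intro conjI ballI allI closed bij poisson_manifold_reduced)
    fix H K assume HK: "H \<in> smooth_functions (reduced_atlas G)" "K \<in> smooth_functions (reduced_atlas G)"
    show "reduced_bracket G H K \<circ> reduction_map = phase_bracket G (H \<circ> reduction_map) (K \<circ> reduction_map)"
      by (simp only: reduced_bracket_red[OF HK] phase_bracket_red[OF HK])
    fix g \<mu> \<nu>
    show "let Hg = delta_g G H (g, \<mu>, \<nu>); Kg = delta_g G K (g, \<mu>, \<nu>);
                   H\<mu> = delta_mu H (g, \<mu>, \<nu>); K\<mu> = delta_mu K (g, \<mu>, \<nu>);
                   H\<nu> = delta_nu H (g, \<mu>, \<nu>); K\<nu> = delta_nu K (g, \<mu>, \<nu>)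
               in reduced_bracket G H K (g, \<mu>, \<nu>) =
                    \<langle>TR_dual G g Kg, H\<mu>\<rangle> - \<langle>TR_dual G g Hg, K\<mu>\<rangle>
                    + \<langle>\<mu>, lie_bracket G H\<mu> K\<mu>\<rangle>
                    + \<langle>\<nu>, lie_bracket G H\<mu> K\<nu> - lie_bracket G K\<mu> H\<nu>\<rangle>"
      unfolding Let_def reduced_bracket_red[OF HK] lie_bracket_eq red_def by simp
  qed
qed

end
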